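(* Let $(N,\mathcal{L},g)$ be a leafwise $C^2$ foliated $I$-bundle over a closed connected $C^2$ Riemannian manifold $K$, and assume that $\mathcal{L}$ has no compact leaf contained in the interior $\mathrm{Int}(N)=K\times(0,1)$. Then every continuous leafwise harmonic function on $N$ is constant on $N$.
   Context: A leafwise $C^2$ foliated $I$-bundle is a triplet $(N,\mathcal{L},g)$ constructed as follows. Let $K$ be a closed $C^2$ manifold of dimension $\ge 2$ with a $C^2$ Riemannian metric $g_K$. Let $I=[0,1]$, $N=K\times I$, and let $\pi:N\to K$ be the canonical projection. $\mathcal{L}$ is a continuous codimension one foliation of $N$ transverse to the fibers $\pi^{-1}(y)$, $y\in K$; the restriction of $\pi$ to each leaf is a covering map onto $K$ (in particular $K\times\{0\}$ and $K\times\{1\}$ are leaves). Each leaf is given the $C^2$ structure for which $\pi$ restricted to the leaf is a $C^2$ covering of $K$, and $g$ is the leafwise Riemannian metric obtained by lifting $g_K$ to each leaf by $\pi$. A function $h:N\to\mathbb{R}$ is continuous leafwise $C^2$ if it is continuous and its leafwise partial derivatives up to order 2 in each foliation chart are continuous in the chart. It is leafwise harmonic if moreover $\Delta h=0$, where $\Delta$ is the leafwise Laplacian defined with $g$. *)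

theory Defs
  imports "HOL-Analysis.Analysis"
begin

subsection \<open>Functions of class $C^1$ and $C^2$ on open subsets of Euclidean space\<close>

definition pd :: "'n \<Rightarrow> (real^'n::finite \<Rightarrow> real) \<Rightarrow> real^'n \<Rightarrow> real" where
  "pd i f x = deriv (\<lambda>t. f (x + t *\<^sub>R axis i 1)) 0"

definition C1_on :: "(real^'n::finite) set \<Rightarrow> (real^'n \<Rightarrow> real) \<Rightarrow> bool" where
  "C1_on S f \<longleftrightarrow> continuous_on S f \<and>
     (\<forall>i. (\<forall>x\<in>S. (\<lambda>t. f (x + t *\<^sub>R axis i 1)) differentiable (at 0)) \<and>
          continuous_on S (pd i f))"

definition C2_on :: "(real^'n::finite) set \<Rightarrow> (real^'n \<Rightarrow> real) \<Rightarrow> bool" where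
  "C2_on S f \<longleftrightarrow> C1_on S f \<and> (\<forall>i. C1_on S (pd i f))"

definition jacobian :: "(real^'n::finite \<Rightarrow> real^'n) \<Rightarrow> real^'n \<Rightarrow> real^'n^'n" where
  "jacobian f x = (\<chi> i j. pd j (\<lambda>y. f y $ i) x)"


subsection \<open>Closed Riemannian manifolds\<close>

text \<open>The manifold is the whole type \<^typ>\<open>'k\<close>. Its $C^2$ structure is given by an atlas, which
  is not assumed to be maximal; a chart is a pair of an open domain and a coordinate map.
  Second countability follows from compactness.\<close>

type_synonym ('k, 'n) chart = "'k set \<times> ('k \<Rightarrow> real^'n)"

definition topological_chart :: "('k::topological_space, 'n::finite) chart \<Rightarrow> bool" where
  "topological_chart c \<longleftrightarrow>
     (case c of (U, \<phi>) \<Rightarrow>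
        open U \<and> open (\<phi> ` U) \<and> homeomorphism U (\<phi> ` U) \<phi> (inv_into U \<phi>))"

definition transition ::
  "('k, 'n::finite) chart \<Rightarrow> ('k, 'n) chart \<Rightarrow> real^'n \<Rightarrow> real^'n" where
  "transition c c' x = snd c' (inv_into (fst c) (snd c) x)"

definition closed_C2_manifold :: "('k::t2_space, 'n::finite) chart set \<Rightarrow> bool" where
  "closed_C2_manifold \<A> \<longleftrightarrow>
     compact (UNIV :: 'k set) \<and>
     (\<forall>c\<in>\<A>. topological_chart c) \<and>
     (\<Union>c\<in>\<A>. fst c) = UNIV \<and>
     (\<forall>c\<in>\<A>. \<forall>c'\<in>\<A>. \<forall>i. C2_on (snd c ` (fst c \<inter> fst c')) (\<lambda>x. transition c c' x $ i))"

text \<open>\<open>G c x\<close> is the matrix of the metric in the chart \<open>c\<close> at the point with coordinates \<open>x\<close>.\<close>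

definition C2_riemannian_metric ::
  "('k, 'n::finite) chart set \<Rightarrow> (('k, 'n) chart \<Rightarrow> real^'n \<Rightarrow> real^'n^'n) \<Rightarrow> bool" where
  "C2_riemannian_metric \<A> G \<longleftrightarrow>
     (\<forall>c\<in>\<A>. \<forall>x \<in> snd c ` fst c.
        transpose (G c x) = G c x \<and> (\<forall>v. v \<noteq> 0 \<longrightarrow> v \<bullet> (G c x *v v) > 0)) \<and>
     (\<forall>c\<in>\<A>. \<forall>i j. C2_on (snd c ` fst c) (\<lambda>x. G c x $ i $ j)) \<and>
     (\<forall>c\<in>\<A>. \<forall>c'\<in>\<A>. \<forall>x \<in> snd c ` (fst c \<inter> fst c').
        G c x = transpose (jacobian (transition c c') x) ** G c' (transition c c' x)
                ** jacobian (transition c c') x)"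

text \<open>The Laplacian $\frac{1}{\sqrt{\det g}}\sum_{i,j}\partial_i
  (\sqrt{\det g}\, g^{ij}\,\partial_j u)$ of the metric with coefficient matrix \<open>g\<close>.\<close>

definition laplacian ::
  "(real^'n::finite \<Rightarrow> real^'n^'n) \<Rightarrow> (real^'n \<Rightarrow> real) \<Rightarrow> real^'n \<Rightarrow> real" where
  "laplacian g u x =
     (1 / sqrt (det (g x))) *
     (\<Sum>i\<in>UNIV. pd i (\<lambda>y. sqrt (det (g y)) *
        (\<Sum>j\<in>UNIV. matrix_inv (g y) $ i $ j * pd j u y)) x)"


subsection \<open>Covering maps between abstract topologies\<close>

text \<open>The library's \<^const>\<open>covering_space\<close> uses subspace topologies, whereas leaves carry the
  leaf topology, which is finer in general.\<close>

definition covering_map :: "'a topology \<Rightarrow> 'b topology \<Rightarrow> ('a \<Rightarrow> 'b) \<Rightarrow> bool" where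
  "covering_map X Y p \<longleftrightarrow>
     continuous_map X Y p \<and> p ` topspace X = topspace Y \<and>
     (\<forall>y\<in>topspace Y. \<exists>U. openin Y U \<and> y \<in> U \<and>
        (\<exists>\<V>. \<Union>\<V> = {x \<in> topspace X. p x \<in> U} \<and>
             (\<forall>S\<in>\<V>. openin X S) \<and> pairwise disjnt \<V> \<and>
             (\<forall>S\<in>\<V>. homeomorphic_map (subtopology X S) (subtopology Y U) p)))"


subsection \<open>Foliated \<open>I\<close>-bundles\<close>

definition total_space :: "('k \<times> real) set" where
  "total_space = UNIV \<times> {0..1}"

definition interior_space :: "('k \<times> real) set" where
  "interior_space = UNIV \<times> {0<..<1}"

text \<open>A foliation is a partition \<open>\<L>\<close> of the total space into leaves. In a foliation chart
  \<open>\<psi> : W \<rightarrow> V \<times> J\<close>, with inverse \<open>\<theta>\<close>, the path components of the trace on \<open>W\<close> of each leaf are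
  plaques \<open>\<theta> ` (V \<times> {s})\<close>. The interval \<open>J\<close> contains an end point for charts at the boundary.\<close>

definition foliation_chart ::
  "('k::topological_space \<times> real) set set \<Rightarrow> ('k \<times> real) set \<Rightarrow>
   (real^'n::finite) set \<Rightarrow> real set \<Rightarrow>
   ('k \<times> real \<Rightarrow> (real^'n) \<times> real) \<Rightarrow> ((real^'n) \<times> real \<Rightarrow> 'k \<times> real) \<Rightarrow> bool" where
  "foliation_chart \<L> W V J \<psi> \<theta> \<longleftrightarrow>
     openin (top_of_set total_space) W \<and> open V \<and> is_interval J \<and>
     homeomorphism W (V \<times> J) \<psi> \<theta> \<and>
     (\<forall>L\<in>\<L>. \<forall>z \<in> L \<inter> W.
        path_component_set (L \<inter> W) z = {w \<in> W. snd (\<psi> w) = snd (\<psi> z)})"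

text \<open>A foliation chart adapted to the projection: the \<open>V\<close>-coordinate is a chart \<open>c\<close> of the base
  composed with the projection, so that the fibres are the verticals of the chart. Restricted to
  plaques, these are the charts of the leafwise $C^2$ structure lifted from the base.\<close>

definition adapted_chart ::
  "('k::topological_space, 'n::finite) chart set \<Rightarrow> ('k \<times> real) set set \<Rightarrow> ('k, 'n) chart \<Rightarrow>
   ('k \<times> real) set \<Rightarrow> (real^'n) set \<Rightarrow> real set \<Rightarrow>
   ('k \<times> real \<Rightarrow> (real^'n) \<times> real) \<Rightarrow> ((real^'n) \<times> real \<Rightarrow> 'k \<times> real) \<Rightarrow> bool" where
  "adapted_chart \<A> \<L> c W V J \<psi> \<theta> \<longleftrightarrow>
     foliation_chart \<L> W V J \<psi> \<theta> \<and> c \<in> \<A> \<and>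
     fst ` W \<subseteq> fst c \<and> (\<forall>z\<in>W. fst (\<psi> z) = snd c (fst z))"

text \<open>Leaves are path connected for the subspace topology; together with the condition on
  plaques this makes them path connected for the leaf topology.\<close>

definition transverse_foliation ::
  "('k::topological_space, 'n::finite) chart set \<Rightarrow> ('k \<times> real) set set \<Rightarrow> bool" where
  "transverse_foliation \<A> \<L> \<longleftrightarrow>
     partition_on total_space \<L> \<and> (\<forall>L\<in>\<L>. path_connected L) \<and>
     (\<forall>z\<in>total_space. \<exists>c W V J \<psi> \<theta>. adapted_chart \<A> \<L> c W V J \<psi> \<theta> \<and> z \<in> W)"

definition leaf_topology ::
  "('k::topological_space, 'n::finite) chart set \<Rightarrow> ('k \<times> real) set set \<Rightarrow>
   ('k \<times> real) topology" where
  "leaf_topology \<A> \<L> = topology_generated_by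
     {P. \<exists>c W V J \<psi> \<theta> s. adapted_chart \<A> \<L> c W V J \<psi> \<theta> \<and> s \<in> J \<and> P = \<theta> ` (V \<times> {s})}"

definition foliated_I_bundle ::
  "('k::t2_space, 'n::finite) chart set \<Rightarrow> (('k, 'n) chart \<Rightarrow> real^'n \<Rightarrow> real^'n^'n) \<Rightarrow>
   ('k \<times> real) set set \<Rightarrow> bool" where
  "foliated_I_bundle \<A> G \<L> \<longleftrightarrow>
     closed_C2_manifold \<A> \<and> CARD('n) \<ge> 2 \<and> C2_riemannian_metric \<A> G \<and>
     transverse_foliation \<A> \<L> \<and>
     (\<forall>L\<in>\<L>. covering_map (subtopology (leaf_topology \<A> \<L>) L) euclidean fst)"


subsection \<open>Leafwise harmonic functions\<close>

definition continuous_leafwise_C2 ::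
  "('k::t2_space, 'n::finite) chart set \<Rightarrow> ('k \<times> real) set set \<Rightarrow> ('k \<times> real \<Rightarrow> real) \<Rightarrow> bool" where
  "continuous_leafwise_C2 \<A> \<L> h \<longleftrightarrow>
     continuous_on total_space h \<and>
     (\<forall>c W V J \<psi> \<theta>. adapted_chart \<A> \<L> c W V J \<psi> \<theta> \<longrightarrow>
        (\<forall>s\<in>J. C2_on V (\<lambda>x. h (\<theta> (x, s)))) \<and>
        (\<forall>i. continuous_on (V \<times> J) (\<lambda>(x, s). pd i (\<lambda>y. h (\<theta> (y, s))) x)) \<and>
        (\<forall>i j. continuous_on (V \<times> J) (\<lambda>(x, s). pd i (pd j (\<lambda>y. h (\<theta> (y, s)))) x)))"

text \<open>In the leafwise coordinates of an adapted chart over \<open>c\<close>, the projection is the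
  identity, so the lifted leafwise metric has the coefficient matrix \<open>G c\<close>.\<close>

definition leafwise_harmonic ::
  "('k::t2_space, 'n::finite) chart set \<Rightarrow> (('k, 'n) chart \<Rightarrow> real^'n \<Rightarrow> real^'n^'n) \<Rightarrow>
   ('k \<times> real) set set \<Rightarrow> ('k \<times> real \<Rightarrow> real) \<Rightarrow> bool" where
  "leafwise_harmonic \<A> G \<L> h \<longleftrightarrow>
     continuous_leafwise_C2 \<A> \<L> h \<and>
     (\<forall>c W V J \<psi> \<theta>. adapted_chart \<A> \<L> c W V J \<psi> \<theta> \<longrightarrow>
        (\<forall>x\<in>V. \<forall>s\<in>J. laplacian (G c) (\<lambda>y. h (\<theta> (y, s))) x = 0))"

end

theory Submission
  imports Defs
begin

text \<open>
  The argument rests on two facts about a continuous leafwise harmonic function \<open>h\<close>.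

  \<^emph>\<open>The maximum principle.\<close> Holonomy preserves the order of the fibres. Hence, if a closed union
  of leaves meets the interior, its topmost points over the points of \<open>K\<close> again form a single leaf,
  which is the graph of a continuous function on \<open>K\<close> and therefore compact. In the absence of
  compact interior leaves this leaf is \<open>K \<times> {1}\<close>; this is \<open>saturated_contains_top\<close>. By the strong
  maximum principle (\<open>strong_maximum_principle\<close>) the set where \<open>h\<close> attains its maximum is closed
  and saturated, so the maximum is attained on the boundary, where \<open>h\<close> takes constant values \<open>\<alpha>\<close>
  on \<open>K \<times> {0}\<close> and \<open>\<beta>\<close> on \<open>K \<times> {1}\<close>. Applied to \<open>h\<close> and \<open>- h\<close> this settles the case \<open>\<alpha> = \<beta>\<close>, and
  by symmetry it remains to refute \<open>\<alpha> < \<beta>\<close>. The same principle applied to pairs of leaves, that is,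
  to the maximum of \<open>h (y, s) - h (y, t)\<close> over all \<open>s \<le> t\<close>, shows that \<open>h\<close> is nondecreasing on each
  fibre (\<open>h_monotone\<close>).

  \<^emph>\<open>An energy identity.\<close> If \<open>\<alpha> < \<beta>\<close>, the Stieltjes measures \<open>d\<^sub>t h (y, t)\<close> on the fibres, together
  with the Riemannian volume of \<open>K\<close>, form a harmonic measure of the foliation which gives no mass to
  the boundary. Integrating \<open>\<Delta> h\<^sup>2 = 2 \<bar>\<nabla>h\<bar>\<^sup>2\<close> against it yields \<open>\<nabla>h = 0\<close> on its support. Concretely,
  let \<open>v (y, u)\<close> be the leafwise gradient of \<open>h\<close> at a point over \<open>y\<close> where \<open>h\<close> has the value \<open>u\<close>. The
  vector field \<open>\<integral> 2 u v (y, u) du\<close> on \<open>K\<close> has the weak divergence \<open>\<integral> \<bar>v (y, u)\<bar>\<^sup>2 du\<close>, with \<open>u\<close> running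
  through \<open>[\<alpha>, \<beta>]\<close> (\<open>box_energy_identity\<close>), and the integral of a divergence over the closed manifold
  \<open>K\<close> vanishes. As \<open>h\<close> is merely continuous across the leaves, the divergence is computed for
  Riemann sums over finite chains of neighbouring plaques (\<open>weak_chain\<close>) before passing to the
  limit. The identity makes \<open>h\<close> constant along the leaves (\<open>energy_contradiction\<close>). Then the level
  set \<open>h = (\<alpha> + \<beta>) / 2\<close> is closed and saturated and meets the interior, but it misses \<open>K \<times> {1}\<close>, a
  contradiction.

  All local work takes place in boxes \<open>B \<times> [0, 1]\<close> over a coordinate ball \<open>B\<close> which contain whole
  fibres and in which the leaves are the slices \<open>B \<times> {s}\<close> (\<open>full_box_exists\<close>). The maximum
  principle holds for operators with a drift as well; it is the energy identity that exploits the
  symmetry of the Laplacian with respect to the volume.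
\<close>

section \<open>Functions of class C1 and their gradients\<close>

definition grad :: "(real^'n::finite \<Rightarrow> real) \<Rightarrow> real^'n \<Rightarrow> real^'n" where
  "grad f x = (\<chi> i. pd i f x)"

lemma grad_nth [simp]: "grad f x $ i = pd i f x"
  by (simp add: grad_def)

lemma C1_on_DERIV_line:
  fixes f :: "real^'n::finite \<Rightarrow> real"
  assumes "C1_on S f" and "y + t *\<^sub>R axis k 1 \<in> S"
  shows "((\<lambda>t. f (y + t *\<^sub>R axis k 1)) has_real_derivative pd k f (y + t *\<^sub>R axis k 1)) (at t)"
proof -
  let ?z = "y + t *\<^sub>R axis k 1"
  have "(\<lambda>r. f (?z + r *\<^sub>R axis k 1)) differentiable (at 0)"
    using assms by (auto simp: C1_on_def)
  then have "((\<lambda>r. f (?z + r *\<^sub>R axis k 1)) has_real_derivative pd k f ?z) (at 0)"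
    unfolding pd_def using DERIV_deriv_iff_real_differentiable by blast
  moreover have "(\<lambda>r. f (?z + r *\<^sub>R axis k 1)) = (\<lambda>r. f (y + (r + t) *\<^sub>R axis k 1))"
    by (simp add: algebra_simps)
  ultimately show ?thesis
    using DERIV_shift[of "\<lambda>t. f (y + t *\<^sub>R axis k 1)" "pd k f ?z" 0 t] by simp
qed

text \<open>The coordinates in \<open>I\<close> are changed one at a time, and the mean value theorem is applied on each
  of the resulting segments.\<close>

lemma C1_on_increment:
  fixes f :: "real^'n::finite \<Rightarrow> real"
  assumes f: "C1_on S f" and S: "open S" and x: "x \<in> S" and e: "e > 0"
  shows "\<exists>d>0. \<forall>h. norm h < d \<longrightarrow>
    \<bar>f (x + (\<chi> i. if i \<in> I then h $ i else 0)) - f x - (\<Sum>i\<in>I. h $ i * pd i f x)\<bar>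
      \<le> real (card I) * e * norm h"
proof (induction I rule: finite_induct[OF finite])
  case 1
  have "(\<chi> i. 0) = (0::real^'n)" by (simp add: vec_eq_iff)
  then show ?case by (intro exI[of _ 1]) auto
next
  case (2 k I)
  then obtain d1 where d1: "d1 > 0" and IH: "\<And>h. norm h < d1 \<Longrightarrow>
    \<bar>f (x + (\<chi> i. if i \<in> I then h $ i else 0)) - f x - (\<Sum>i\<in>I. h $ i * pd i f x)\<bar>
      \<le> real (card I) * e * norm h" by blast
  have "continuous_on S (pd k f)" using f by (simp add: C1_on_def)
  then have "isCont (pd k f) x" using S x continuous_on_eq_continuous_at by blast
  then obtain d2 where d2: "d2 > 0" "\<And>y. dist y x < d2 \<Longrightarrow> \<bar>pd k f y - pd k f x\<bar> < e"
    unfolding continuous_at_eps_delta using e by (metis dist_real_def)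
  obtain d3 where d3: "d3 > 0" "ball x d3 \<subseteq> S" using S x openE by blast
  show ?case
  proof (intro exI[of _ "min d1 (min d2 d3)"] conjI allI impI)
    show "0 < min d1 (min d2 d3)" using d1 d2 d3 by auto
    fix h :: "real^'n" assume h: "norm h < min d1 (min d2 d3)"
    define hI where "hI = (\<chi> i. if i \<in> I then h $ i else 0)"
    define p where "p t = x + hI + t *\<^sub>R axis k 1" for t
    have pt: "norm (p (t * h $ k) - x) \<le> norm h" if "0 \<le> t" "t \<le> 1" for t
    proof -
      have "\<bar>t * h $ k\<bar> \<le> \<bar>h $ k\<bar>"
        using that by (simp add: abs_mult mult_left_le_one_le)
      then show ?thesis
        using \<open>k \<notin> I\<close> unfolding p_def hI_def
        by (intro norm_le_componentwise_cart) (auto simp: axis_def)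
    qed
    have pS: "p (t * h $ k) \<in> S" if "0 \<le> t" "t \<le> 1" for t
      using pt[OF that] h d3(2) by (auto simp: subset_iff dist_norm norm_minus_commute)
    have "((\<lambda>t. f (p (t * h $ k))) has_real_derivative (pd k f (p (t * h $ k)) * h $ k)) (at t)"
      if "0 \<le> t" "t \<le> 1" for t
    proof -
      have "((\<lambda>t. f (p t)) has_real_derivative pd k f (p (t * h $ k))) (at (t * h $ k))"
        unfolding p_def by (rule C1_on_DERIV_line[OF f]) (use pS[OF that] in \<open>simp add: p_def\<close>)
      then show ?thesis
        by (rule DERIV_chain2) (auto intro!: derivative_eq_intros)
    qed
    then obtain t where t: "0 < t" "t < 1"
      "f (p (1 * h $ k)) - f (p (0 * h $ k)) = (1 - 0) * (pd k f (p (t * h $ k)) * h $ k)"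
      using MVT2[of 0 1 "\<lambda>t. f (p (t * h $ k))" "\<lambda>t. pd k f (p (t * h $ k)) * h $ k"] by auto
    have "\<bar>pd k f (p (t * h $ k)) - pd k f x\<bar> < e"
      using pt[of t] t h by (intro d2(2)) (auto simp: dist_norm)
    then have B: "\<bar>(pd k f (p (t * h $ k)) - pd k f x) * h $ k\<bar> \<le> e * norm h"
      unfolding abs_mult using component_le_norm_cart[of h k] by (intro mult_mono) auto
    have pe: "x + (\<chi> i. if i \<in> insert k I then h $ i else 0) = p (1 * h $ k)"
      using \<open>k \<notin> I\<close> by (auto simp: p_def hI_def vec_eq_iff axis_def)
    have p0: "p (0 * h $ k) = x + hI" by (simp add: p_def)
    have A: "\<bar>f (x + hI) - f x - (\<Sum>i\<in>I. h $ i * pd i f x)\<bar> \<le> real (card I) * e * norm h"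
      using IH[of h] h by (simp add: hI_def)
    have "f (p (1 * h $ k)) - f x - (\<Sum>i\<in>insert k I. h $ i * pd i f x)
       = (f (x + hI) - f x - (\<Sum>i\<in>I. h $ i * pd i f x)) + (pd k f (p (t * h $ k)) - pd k f x) * h $ k"
      using t(3) \<open>finite I\<close> \<open>k \<notin> I\<close> p0 by (simp add: algebra_simps)
    then have "\<bar>f (p (1 * h $ k)) - f x - (\<Sum>i\<in>insert k I. h $ i * pd i f x)\<bar>
       \<le> real (card I) * e * norm h + e * norm h" using A B by linarith
    then show "\<bar>f (x + (\<chi> i. if i \<in> insert k I then h $ i else 0)) - f x - (\<Sum>i\<in>insert k I. h $ i * pd i f x)\<bar>
      \<le> real (card (insert k I)) * e * norm h"
      unfolding pe using \<open>finite I\<close> \<open>k \<notin> I\<close> by (simp add: algebra_simps)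
  qed
qed

lemma C1_on_GDERIV:
  fixes f :: "real^'n::finite \<Rightarrow> real"
  assumes f: "C1_on S f" and S: "open S" and x: "x \<in> S"
  shows "GDERIV f x :> grad f x"
  unfolding gderiv_def has_derivative_at_alt
proof (intro conjI allI impI)
  show "bounded_linear (\<lambda>h. h \<bullet> grad f x)" by (rule bounded_linear_inner_left)
  fix e :: real assume "0 < e"
  then have "e / CARD('n) > 0" by simp
  from C1_on_increment[OF f S x this, of UNIV] obtain d where d: "d > 0" "\<And>h. norm h < d \<Longrightarrow>
    \<bar>f (x + (\<chi> i. h $ i)) - f x - (\<Sum>i\<in>UNIV. h $ i * pd i f x)\<bar> \<le> real CARD('n) * (e / CARD('n)) * norm h"
    by auto
  show "\<exists>d>0. \<forall>y. norm (y - x) < d \<longrightarrow> norm (f y - f x - (y - x) \<bullet> grad f x) \<le> e * norm (y - x)"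
  proof (intro exI[of _ d] conjI d allI impI)
    fix y assume "norm (y - x) < d"
    have "x + (\<chi> i. (y - x) $ i) = y" by (simp add: vec_eq_iff)
    with d(2)[OF \<open>norm (y - x) < d\<close>] show "norm (f y - f x - (y - x) \<bullet> grad f x) \<le> e * norm (y - x)"
      by (simp add: inner_vec_def)
  qed
qed

lemma GDERIV_DERIV_line:
  fixes f :: "real^'n::finite \<Rightarrow> real"
  assumes "GDERIV f (x + t *\<^sub>R v) :> D"
  shows "((\<lambda>t. f (x + t *\<^sub>R v)) has_real_derivative (v \<bullet> D)) (at t)"
proof -
  have "((\<lambda>t. x + t *\<^sub>R v) has_derivative (\<lambda>r. r *\<^sub>R v)) (at t)"
    by (auto intro!: derivative_eq_intros)
  from has_derivative_compose[OF this, of f "\<lambda>h. h \<bullet> D"] assms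
  have "((\<lambda>t. f (x + t *\<^sub>R v)) has_derivative (\<lambda>r. (r *\<^sub>R v) \<bullet> D)) (at t)"
    by (simp add: gderiv_def)
  then show ?thesis
    by (simp add: has_field_derivative_def mult_commute_abs)
qed

lemma GDERIV_pd:
  fixes f :: "real^'n::finite \<Rightarrow> real"
  assumes "GDERIV f x :> D"
  shows "((\<lambda>t. f (x + t *\<^sub>R axis i 1)) has_real_derivative D $ i) (at 0)" "pd i f x = D $ i"
proof -
  show "((\<lambda>t. f (x + t *\<^sub>R axis i 1)) has_real_derivative D $ i) (at 0)"
    using GDERIV_DERIV_line[of f x 0 "axis i 1" D] assms by (simp add: inner_axis inner_commute)
  then show "pd i f x = D $ i" unfolding pd_def by (rule DERIV_imp_deriv)
qed

lemma GDERIV_grad: "GDERIV f x :> D \<Longrightarrow> grad f x = D"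
  by (simp add: vec_eq_iff GDERIV_pd(2))

lemma GDERIV_transform:
  assumes "GDERIV f x :> D" "open S" "x \<in> S" "\<And>y. y \<in> S \<Longrightarrow> f y = g y"
  shows "GDERIV g x :> D"
  using has_derivative_transform_within_open[of f _ x UNIV S g] assms by (simp add: gderiv_def)

text \<open>Continuous partial derivatives give total differentiability, so \<^const>\<open>C1_on\<close> can be handled by
  the calculus of gradients.\<close>

lemma C1_on_iff:
  fixes f :: "real^'n::finite \<Rightarrow> real"
  assumes "open S"
  shows "C1_on S f \<longleftrightarrow> (\<forall>x\<in>S. GDERIV f x :> grad f x) \<and> continuous_on S (grad f)"
proof
  assume "C1_on S f"
  then show "(\<forall>x\<in>S. GDERIV f x :> grad f x) \<and> continuous_on S (grad f)"
    using C1_on_GDERIV[OF _ assms] unfolding grad_def C1_on_def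
    by (auto intro: continuous_on_vec_lambda)
next
  assume R: "(\<forall>x\<in>S. GDERIV f x :> grad f x) \<and> continuous_on S (grad f)"
  have "continuous_on S f"
    using R unfolding gderiv_def
    by (meson continuous_at_imp_continuous_on has_derivative_continuous)
  moreover have "(\<lambda>t. f (x + t *\<^sub>R axis i 1)) differentiable at 0" if "x \<in> S" for x i
    using R GDERIV_pd(1) that real_differentiable_def by blast
  moreover have "continuous_on S (pd i f)" for i
    using continuous_on_component[of S "grad f" i] R by simp
  ultimately show "C1_on S f" by (auto simp: C1_on_def)
qed

lemma C1_onI:
  fixes f :: "real^'n::finite \<Rightarrow> real"
  assumes "open S" "\<And>x. x \<in> S \<Longrightarrow> GDERIV f x :> D x" "continuous_on S D"
  shows "C1_on S f"
proof -
  have "\<And>x. x \<in> S \<Longrightarrow> grad f x = D x" using assms(2) by (rule GDERIV_grad)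
  then show ?thesis
    unfolding C1_on_iff[OF assms(1)] using assms(2,3) by (auto cong: continuous_on_cong)
qed

lemma C1_on_grad_continuous: "C1_on S f \<Longrightarrow> continuous_on S (grad f)"
  unfolding grad_def C1_on_def by (auto intro: continuous_on_vec_lambda)

lemma C1_on_continuous: "C1_on S f \<Longrightarrow> continuous_on S f"
  by (simp add: C1_on_def)

lemma C2_on_C1: "C2_on S f \<Longrightarrow> C1_on S f" "C2_on S f \<Longrightarrow> C1_on S (pd i f)"
  by (auto simp: C2_on_def)

lemma pd_cong_open:
  fixes f :: "real^'n::finite \<Rightarrow> real"
  assumes S: "open S" "x \<in> S" and eq: "\<And>y. y \<in> S \<Longrightarrow> f y = g y"
  shows "pd i f x = pd i g x"
proof -
  have "((\<lambda>t. x + t *\<^sub>R axis i 1) \<longlongrightarrow> x) (nhds 0)"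
    by (rule tendsto_eq_intros filterlim_ident | simp)+
  then have "\<forall>\<^sub>F t in nhds 0. x + t *\<^sub>R axis i 1 \<in> S"
    using S topological_tendstoD by blast
  then have "\<forall>\<^sub>F t in nhds 0. f (x + t *\<^sub>R axis i 1) = g (x + t *\<^sub>R axis i 1)"
    by eventually_elim (use eq in auto)
  then show ?thesis unfolding pd_def by (rule deriv_cong_ev) simp
qed

lemma grad_cong_open:
  fixes f :: "real^'n::finite \<Rightarrow> real"
  assumes "open S" "x \<in> S" "\<And>y. y \<in> S \<Longrightarrow> f y = g y"
  shows "grad f x = grad g x"
  using pd_cong_open[OF assms] by (simp add: grad_def)

lemma C1_on_cong:
  fixes f :: "real^'n::finite \<Rightarrow> real"
  assumes S: "open S" and eq: "\<And>y. y \<in> S \<Longrightarrow> f y = g y" and f: "C1_on S f"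
  shows "C1_on S g"
  by (rule C1_onI[OF S _ C1_on_grad_continuous[OF f]])
    (rule GDERIV_transform[OF C1_on_GDERIV[OF f S] S _ eq])

lemma C1_on_subset: "C1_on S f \<Longrightarrow> T \<subseteq> S \<Longrightarrow> C1_on T f"
  unfolding C1_on_def by (meson continuous_on_subset subsetD)

lemma C1_on_local:
  fixes f :: "real^'n::finite \<Rightarrow> real"
  assumes S: "open S" and loc: "\<And>x. x \<in> S \<Longrightarrow> \<exists>T. open T \<and> x \<in> T \<and> C1_on T f"
  shows "C1_on S f"
proof -
  have "GDERIV f x :> grad f x \<and> isCont (grad f) x" if x: "x \<in> S" for x
  proof -
    obtain T where T: "open T" "x \<in> T" "C1_on T f" using loc[OF x] by blast
    then show ?thesis
      using C1_on_GDERIV C1_on_grad_continuous continuous_on_eq_continuous_at by blast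
  qed
  then show ?thesis
    unfolding C1_on_iff[OF S] by (simp add: continuous_at_imp_continuous_on)
qed

lemma C1_on_const: "open S \<Longrightarrow> C1_on S (\<lambda>x::real^'n::finite. k)"
  by (rule C1_onI[OF _ GDERIV_const]) auto

lemma C1_on_component: "open S \<Longrightarrow> C1_on S (\<lambda>x::real^'n::finite. x $ i)"
proof (rule C1_onI[where D = "\<lambda>x. axis i 1"])
  fix x :: "real^'n"
  show "GDERIV (\<lambda>x. x $ i) x :> axis i 1"
    unfolding gderiv_def by (auto simp: inner_axis intro!: derivative_eq_intros bounded_linear_imp_has_derivative bounded_linear_vec_nth)
qed auto

lemma C1_on_add:
  assumes "open S" "C1_on S f" "C1_on S g" shows "C1_on S (\<lambda>x. f x + g x)"
  by (rule C1_onI[OF assms(1) GDERIV_add[OF C1_on_GDERIV C1_on_GDERIV]])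
    (use assms in \<open>auto intro!: continuous_intros C1_on_grad_continuous\<close>)

lemma C1_on_minus:
  assumes "open S" "C1_on S f" shows "C1_on S (\<lambda>x. - f x)"
  by (rule C1_onI[OF assms(1) GDERIV_minus[OF C1_on_GDERIV]])
    (use assms in \<open>auto intro!: continuous_intros C1_on_grad_continuous\<close>)

lemma C1_on_diff:
  assumes "open S" "C1_on S f" "C1_on S g" shows "C1_on S (\<lambda>x. f x - g x)"
  by (rule C1_onI[OF assms(1) GDERIV_diff[OF C1_on_GDERIV C1_on_GDERIV]])
    (use assms in \<open>auto intro!: continuous_intros C1_on_grad_continuous\<close>)

lemma C1_on_mult:
  assumes "open S" "C1_on S f" "C1_on S g" shows "C1_on S (\<lambda>x. f x * g x)"
  by (rule C1_onI[OF assms(1) GDERIV_mult[OF C1_on_GDERIV C1_on_GDERIV]])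
    (use assms in \<open>auto intro!: continuous_intros C1_on_grad_continuous C1_on_continuous\<close>)

lemma C1_on_sum:
  assumes S: "open S" and f: "\<And>i. i \<in> I \<Longrightarrow> C1_on S (f i)"
  shows "C1_on S (\<lambda>x. \<Sum>i\<in>I. f i x)"
  using f by (induction I rule: infinite_finite_induct) (auto intro!: C1_on_const[OF S] C1_on_add[OF S])

lemma C1_on_prod:
  assumes S: "open S" and f: "\<And>i. i \<in> I \<Longrightarrow> C1_on S (f i)"
  shows "C1_on S (\<lambda>x. \<Prod>i\<in>I. f i x)"
  using f by (induction I rule: infinite_finite_induct) (auto intro!: C1_on_const[OF S] C1_on_mult[OF S])

lemma C1_on_compose_real:
  assumes S: "open S" and f: "C1_on S f"
    and g: "\<And>x. x \<in> S \<Longrightarrow> DERIV g (f x) :> g' (f x)" and g': "continuous_on (f ` S) g'"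
  shows "C1_on S (\<lambda>x. g (f x))"
proof (rule C1_onI[OF S])
  show "GDERIV (\<lambda>x. g (f x)) x :> g' (f x) *\<^sub>R grad f x" if "x \<in> S" for x
    by (rule GDERIV_DERIV_compose[OF C1_on_GDERIV[OF f S that] g[OF that]])
  show "continuous_on S (\<lambda>x. g' (f x) *\<^sub>R grad f x)"
    by (intro continuous_intros C1_on_grad_continuous[OF f] continuous_on_compose2[OF g'] C1_on_continuous[OF f]) auto
qed

lemma C1_on_divide:
  assumes S: "open S" and f: "C1_on S f" and g: "C1_on S g" and nz: "\<And>x. x \<in> S \<Longrightarrow> g x \<noteq> 0"
  shows "C1_on S (\<lambda>x. f x / g x)"
proof -
  have "C1_on S (\<lambda>x. inverse (g x))"
    by (rule C1_on_compose_real[OF S g, where g' = "\<lambda>t. - inverse t * inverse t"])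
      (use nz in \<open>auto intro!: derivative_eq_intros continuous_intros\<close>)
  from C1_on_mult[OF S f this] show ?thesis by (simp add: divide_inverse)
qed

lemma C1_on_sqrt:
  assumes S: "open S" and f: "C1_on S f" and pos: "\<And>x. x \<in> S \<Longrightarrow> f x > 0"
  shows "C1_on S (\<lambda>x. sqrt (f x))"
  by (rule C1_on_compose_real[OF S f, where g' = "\<lambda>t. inverse (sqrt t) / 2"])
    (use pos in \<open>auto intro!: DERIV_real_sqrt continuous_intros dest: less_imp_neq[THEN not_sym, OF pos]\<close>)

lemma C1_on_det:
  fixes A :: "real^'n::finite \<Rightarrow> real^'m^'m::finite"
  assumes "open S" "\<And>i j. C1_on S (\<lambda>x. A x $ i $ j)"
  shows "C1_on S (\<lambda>x. det (A x))"
  unfolding det_def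
  by (intro C1_on_sum C1_on_mult C1_on_prod C1_on_const assms)

lemmas C1_on_intros = C1_on_const C1_on_component C1_on_add C1_on_minus C1_on_diff C1_on_mult C1_on_sum

lemma grad_rules:
  fixes f g :: "real^'n::finite \<Rightarrow> real"
  assumes "open S" "x \<in> S" "C1_on S f" "C1_on S g"
  shows "grad (\<lambda>x. f x + g x) x = grad f x + grad g x"
    "grad (\<lambda>x. f x - g x) x = grad f x - grad g x"
    "grad (\<lambda>x. f x * g x) x = f x *\<^sub>R grad g x + g x *\<^sub>R grad f x"
  using C1_on_GDERIV[OF assms(3,1,2)] C1_on_GDERIV[OF assms(4,1,2)]
  by (blast intro: GDERIV_grad GDERIV_add GDERIV_diff GDERIV_mult)+

lemma grad_const: "grad (\<lambda>x. k) x = 0"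
  by (rule GDERIV_grad[OF GDERIV_const])

section \<open>The strong maximum principle\<close>

text \<open>A second order operator in nondivergence form, evaluated at one point with coefficients frozen
  there.\<close>

definition ell :: "(real^'n^'n) \<Rightarrow> (real^'n) \<Rightarrow> (real^'n::finite \<Rightarrow> real) \<Rightarrow> real^'n \<Rightarrow> real" where
  "ell A b u x = (\<Sum>i\<in>UNIV. \<Sum>j\<in>UNIV. A $ i $ j * pd i (pd j u) x) + b \<bullet> grad u x"

text \<open>Eliminating the coordinate \<open>k\<close> from a positive semidefinite \<open>A\<close> leaves a Schur complement, which
  is again positive semidefinite, plus a rank one matrix \<open>w w\<^sup>T / a\<close>, whose contribution to the trace
  is the quadratic form of \<open>M\<close> at \<open>w\<close>. The induction is over the set of coordinates that carry \<open>A\<close>.\<close>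

lemma trace_product_nonpos:
  fixes A M :: "real^'n::finite^'n"
  assumes sym: "\<And>i j. A $ i $ j = A $ j $ i"
    and psd: "\<And>v. v \<bullet> (A *v v) \<ge> 0"
    and M: "\<And>v. v \<bullet> (M *v v) \<le> 0"
  shows "(\<Sum>i\<in>UNIV. \<Sum>j\<in>UNIV. A $ i $ j * M $ i $ j) \<le> 0"
proof -
  have "(\<Sum>i\<in>UNIV. \<Sum>j\<in>UNIV. A $ i $ j * M $ i $ j) \<le> 0"
    if "\<And>i j. A $ i $ j = A $ j $ i" "\<And>v. v \<bullet> (A *v v) \<ge> 0"
      "\<And>i j. i \<notin> S \<Longrightarrow> A $ i $ j = 0" for S and A :: "real^'n^'n"
    using finite[of S] that
  proof (induction S arbitrary: A rule: finite_induct)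
    case empty
    then show ?case by simp
  next
    case (insert k S)
    define a where "a = A $ k $ k"
    define w where "w = A $ k"
    have quad: "v \<bullet> (A *v v) = (\<Sum>i\<in>UNIV. \<Sum>j\<in>UNIV. A $ i $ j * v $ i * v $ j)" for v
      by (simp add: inner_vec_def matrix_vector_mult_def sum_distrib_left algebra_simps)
    have Aax: "A *v axis k 1 = w"
      using insert.prems(1) by (simp add: vec_eq_iff matrix_vector_mul_component w_def inner_axis)
    have line: "(v + t *\<^sub>R axis k 1) \<bullet> (A *v (v + t *\<^sub>R axis k 1))
        = v \<bullet> (A *v v) + 2 * t * (v \<bullet> w) + t\<^sup>2 * a" for v t
    proof -
      have "axis k 1 \<bullet> (A *v v) = v \<bullet> w"
        by (simp add: inner_axis' matrix_vector_mul_component w_def inner_commute)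
      then show ?thesis
        by (simp add: matrix_vector_right_distrib matrix_vector_mult_scaleR Aax inner_add
          inner_axis' a_def w_def power2_eq_square algebra_simps)
    qed
    have a0: "a \<ge> 0"
      using line[of 0 1] insert.prems(2)[of "0 + 1 *\<^sub>R axis k 1"] by simp
    show ?case
    proof (cases "a = 0")
      case True
      have "v \<bullet> w = 0" for v
      proof (rule ccontr)
        assume nz: "v \<bullet> w \<noteq> 0"
        \<comment> \<open>for this \<open>t\<close> the quadratic form would take the value \<open>- 1\<close>\<close>
        define t where "t = - (v \<bullet> (A *v v) + 1) / (2 * (v \<bullet> w))"
        have "2 * t * (v \<bullet> w) = - (v \<bullet> (A *v v) + 1)" using nz by (simp add: t_def)
        then show False
          using line[of v t] insert.prems(2)[of "v + t *\<^sub>R axis k 1"] True by simp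
      qed
      then have "w = 0" by (metis inner_eq_zero_iff)
      then have "A $ i $ j = 0" if "i \<notin> S" for i j
        using insert.prems(3)[of i j] that by (cases "i = k") (auto simp: w_def)
      then show ?thesis using insert.IH[of A] insert.prems by blast
    next
      case False
      then have apos: "a > 0" using a0 by simp
      \<comment> \<open>the Schur complement of the entry \<open>a\<close>\<close>
      define A' where "A' = (\<chi> i j. A $ i $ j - w $ i * w $ j / a)"
      have A': "A' $ i $ j = A $ i $ j - w $ i * w $ j / a" for i j by (simp add: A'_def)
      have "(\<Sum>i\<in>UNIV. \<Sum>j\<in>UNIV. A' $ i $ j * M $ i $ j) \<le> 0"
      proof (rule insert.IH)
        show "A' $ i $ j = A' $ j $ i" for i j
          using insert.prems(1)[of i j] by (simp add: A' mult.commute)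
        show "A' $ i $ j = 0" if "i \<notin> S" for i j
        proof (cases "i = k")
          case True
          then show ?thesis using apos by (simp add: A' w_def a_def)
        next
          case False
          then have "w $ i = 0" "A $ i $ j = 0"
            using insert.prems(1)[of k i] insert.prems(3)[of i] that by (auto simp: w_def)
          then show ?thesis by (simp add: A')
        qed
        show "0 \<le> v \<bullet> (A' *v v)" for v
        proof -
          have "v \<bullet> (A' *v v) = v \<bullet> (A *v v) - (v \<bullet> w)\<^sup>2 / a"
          proof -
            have "(A' *v v) $ i = (A *v v) $ i - w $ i * (v \<bullet> w) / a" for i
              by (simp add: matrix_vector_mult_def A' inner_vec_def sum_subtractf sum_distrib_left
                sum_divide_distrib algebra_simps)
            then have "A' *v v = A *v v - ((v \<bullet> w) / a) *\<^sub>R w"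
              by (simp add: vec_eq_iff)
            then show ?thesis by (simp add: inner_diff_right power2_eq_square)
          qed
          also have "\<dots> = (v + (- (v \<bullet> w) / a) *\<^sub>R axis k 1) \<bullet> (A *v (v + (- (v \<bullet> w) / a) *\<^sub>R axis k 1))"
            unfolding line using apos by (simp add: field_simps power2_eq_square)
          also have "\<dots> \<ge> 0" by (rule insert.prems(2))
          finally show ?thesis .
        qed
      qed
      moreover have "(\<Sum>i\<in>UNIV. \<Sum>j\<in>UNIV. w $ i * w $ j * M $ i $ j) \<le> 0"
        using M[of w]
        by (simp add: inner_vec_def matrix_vector_mult_def sum_distrib_left algebra_simps)
      moreover have "(\<Sum>i\<in>UNIV. \<Sum>j\<in>UNIV. A $ i $ j * M $ i $ j)
        = (\<Sum>i\<in>UNIV. \<Sum>j\<in>UNIV. A' $ i $ j * M $ i $ j)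
          + (\<Sum>i\<in>UNIV. \<Sum>j\<in>UNIV. w $ i * w $ j * M $ i $ j) / a"
        by (simp add: A' sum_divide_distrib sum.distrib[symmetric] algebra_simps)
      ultimately show ?thesis using apos by (smt (verit) divide_nonpos_pos)
    qed
  qed
  from this[of A UNIV] show ?thesis using sym psd by simp
qed

lemma second_derivative_local_max:
  fixes f f' :: "real \<Rightarrow> real"
  assumes d: "d > 0" and f: "\<And>t. \<bar>t\<bar> < d \<Longrightarrow> DERIV f t :> f' t"
    and f'': "DERIV f' 0 :> l" and max: "\<And>t. \<bar>t\<bar> < d \<Longrightarrow> f t \<le> f 0"
  shows "l \<le> 0"
proof (rule ccontr)
  assume "\<not> l \<le> 0"
  have f'0: "f' 0 = 0"
    using DERIV_local_max[OF f[of 0] d] d max by auto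
  obtain e where e: "e > 0" "\<And>h. 0 < h \<Longrightarrow> h < e \<Longrightarrow> f' 0 < f' (0 + h)"
    using DERIV_pos_inc_right[OF f''] \<open>\<not> l \<le> 0\<close> by auto
  define r where "r = min d e / 2"
  have r: "0 < r" "r < d" "r < e" using d e by (auto simp: r_def)
  have "\<exists>z>0. z < r \<and> f r - f 0 = (r - 0) * f' z"
    by (rule MVT2) (use r f in auto)
  then obtain z where z: "0 < z" "z < r" "f r - f 0 = r * f' z" by auto
  have "f' z > 0" using e(2)[of z] z r f'0 by simp
  then have "f r > f 0" using z r by (smt (verit) mult_pos_pos)
  then show False using max[of r] r by simp
qed

lemma ell_local_max:
  fixes u :: "real^'n::finite \<Rightarrow> real" and A :: "real^'n^'n"
  assumes V: "open V" "x \<in> V" and u: "C2_on V u" and max: "\<And>y. y \<in> V \<Longrightarrow> u y \<le> u x"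
    and A: "\<And>i j. A $ i $ j = A $ j $ i" "\<And>v. v \<bullet> (A *v v) \<ge> 0"
  shows "ell A b u x \<le> 0"
proof -
  obtain r where r: "r > 0" "ball x r \<subseteq> V" using V openE by blast
  have inV: "x + t *\<^sub>R v \<in> V" if "\<bar>t\<bar> < r / (norm v + 1)" for t v
  proof -
    have "norm (t *\<^sub>R v) \<le> \<bar>t\<bar> * (norm v + 1)" by (simp add: algebra_simps)
    also have "\<dots> < r" using that by (simp add: pos_less_divide_eq add_nonneg_pos)
    finally show ?thesis using r by (auto simp: dist_norm subset_iff)
  qed
  have D1: "((\<lambda>t. u (x + t *\<^sub>R v)) has_real_derivative (v \<bullet> grad u (x + t *\<^sub>R v))) (at t)"
    if "\<bar>t\<bar> < r / (norm v + 1)" for t v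
    by (rule GDERIV_DERIV_line[OF C1_on_GDERIV[OF C2_on_C1(1)[OF u] V(1) inV[OF that]]])
  have D2: "((\<lambda>t. v \<bullet> grad u (x + t *\<^sub>R v)) has_real_derivative
      (\<Sum>j\<in>UNIV. v $ j * (v \<bullet> grad (pd j u) x))) (at 0)" for v
  proof -
    have "((\<lambda>t. pd j u (x + t *\<^sub>R v)) has_real_derivative (v \<bullet> grad (pd j u) x)) (at 0)" for j
      using GDERIV_DERIV_line[of "pd j u" x 0 v] C1_on_GDERIV[OF C2_on_C1(2)[OF u] V] by simp
    then show ?thesis
      unfolding inner_vec_def[of v "grad u _"]
      by (auto intro!: derivative_eq_intros simp: mult.commute)
  qed
  have rp: "r / (norm v + 1) > 0" for v :: "real^'n" using r by (simp add: add_nonneg_pos)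
  have g0: "v \<bullet> grad u x = 0" for v
    using DERIV_local_max[OF D1[of 0 v] rp[of v]] rp[of v] max inV[of _ v] by force
  then have "grad u x = 0" by (metis inner_eq_zero_iff)
  moreover have "(\<Sum>i\<in>UNIV. \<Sum>j\<in>UNIV. A $ i $ j * (\<chi> i j. pd i (pd j u) x) $ i $ j) \<le> 0"
  proof (rule trace_product_nonpos[OF A])
    fix v :: "real^'n"
    have "(\<Sum>j\<in>UNIV. v $ j * (v \<bullet> grad (pd j u) x)) \<le> 0"
      by (rule second_derivative_local_max[OF rp[of v] D1 D2]) (use max inV in auto)
    moreover have "(\<Sum>j\<in>UNIV. v $ j * (v \<bullet> grad (pd j u) x)) = v \<bullet> ((\<chi> i j. pd i (pd j u) x) *v v)"
      by (simp add: inner_vec_def matrix_vector_mult_def sum_distrib_left algebra_simps)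
        (subst sum.swap, simp add: mult_ac)
    ultimately show "v \<bullet> ((\<chi> i j. pd i (pd j u) x) *v v) \<le> 0" by simp
  qed
  ultimately show ?thesis by (simp add: ell_def)
qed

lemma pd_rules:
  fixes f g :: "real^'n::finite \<Rightarrow> real"
  assumes "open S" "x \<in> S" "C1_on S f" "C1_on S g"
  shows "pd i (\<lambda>x. f x + g x) x = pd i f x + pd i g x"
    "pd i (\<lambda>x. f x - g x) x = pd i f x - pd i g x"
    "pd i (\<lambda>x. f x * g x) x = f x * pd i g x + g x * pd i f x"
  using grad_rules[OF assms] by (simp_all add: vec_eq_iff)

lemma pd_const: "pd i (\<lambda>x. k) x = 0"
  using grad_const[of k x] by (simp add: vec_eq_iff)

lemma C2_on_add_scaled:
  fixes f g :: "real^'n::finite \<Rightarrow> real"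
  assumes S: "open S" and f: "C2_on S f" and g: "C2_on S g"
  shows "C2_on S (\<lambda>x. f x + k * g x)"
    "x \<in> S \<Longrightarrow> ell A b (\<lambda>x. f x + k * g x) x = ell A b f x + k * ell A b g x"
proof -
  note c = C1_on_const[OF S]
  have pd1: "pd i (\<lambda>x. f x + k * g x) y = pd i f y + k * pd i g y"
    if "y \<in> S" "C1_on S f" "C1_on S g" for f g :: "real^'n \<Rightarrow> real" and y i
    using that by (simp add: pd_rules[OF S _ _ C1_on_mult[OF S c]] pd_rules[OF S _ c] pd_const)
  note f1 = C2_on_C1[OF f] and g1 = C2_on_C1[OF g]
  show "C2_on S (\<lambda>x. f x + k * g x)"
    unfolding C2_on_def
  proof (intro conjI allI)
    show "C1_on S (\<lambda>x. f x + k * g x)" by (intro C1_on_intros S f1 g1)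
    have "C1_on S (\<lambda>x. pd i f x + k * pd i g x)" for i by (intro C1_on_intros S f1 g1)
    then show "C1_on S (pd i (\<lambda>x. f x + k * g x))" for i
      by (rule C1_on_cong[OF S, rotated]) (simp add: pd1 f1 g1)
  qed
  assume x: "x \<in> S"
  have "pd i (pd j (\<lambda>x. f x + k * g x)) x = pd i (pd j f) x + k * pd i (pd j g) x" for i j
  proof -
    have "pd i (pd j (\<lambda>x. f x + k * g x)) x = pd i (\<lambda>y. pd j f y + k * pd j g y) x"
      by (rule pd_cong_open[OF S x pd1[OF _ f1(1) g1(1)]])
    then show ?thesis using pd1[OF x f1(2) g1(2)] by simp
  qed
  moreover have "grad (\<lambda>x. f x + k * g x) x = grad f x + k *\<^sub>R grad g x"
    by (simp add: vec_eq_iff pd1 x f1 g1)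
  ultimately show "ell A b (\<lambda>x. f x + k * g x) x = ell A b f x + k * ell A b g x"
    by (simp add: ell_def inner_add_right sum.distrib[symmetric] sum_distrib_left algebra_simps)
qed

text \<open>The Gaussian barrier of Hopf's lemma: for large \<open>k\<close> the term quadratic in \<open>k\<close> dominates away
  from the centre \<open>p\<close>.\<close>

lemma hopf_barrier:
  fixes p :: "real^'n::finite" and k :: real
  defines "E \<equiv> \<lambda>x. exp (- k * ((x - p) \<bullet> (x - p)))"
  shows "C2_on UNIV E"
    "ell A b E x = E x * (4 * k\<^sup>2 * ((x - p) \<bullet> (A *v (x - p)))
       - 2 * k * ((\<Sum>i\<in>UNIV. A $ i $ i) + b \<bullet> (x - p)))"
proof -
  have gE: "GDERIV E x :> (- 2 * k * E x) *\<^sub>R (x - p)" for x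
    unfolding gderiv_def E_def
    by (auto intro!: derivative_eq_intros simp: fun_eq_iff inner_commute algebra_simps)
  have C1E: "C1_on UNIV E"
    by (rule C1_onI[OF _ gE]) (auto simp: E_def intro!: continuous_intros)
  have pdE: "pd j E = (\<lambda>x. (- 2 * k) * (E x * (x $ j - p $ j)))" for j
    using GDERIV_pd(2)[OF gE] by (simp add: fun_eq_iff)
  have C1pd: "C1_on UNIV (pd j E)" for j
    unfolding pdE by (intro C1_on_intros C1E) auto
  then show "C2_on UNIV E" using C1E by (simp add: C2_on_def)
  have pd2: "pd i (pd j E) x = E x * (4 * k\<^sup>2 * (x $ i - p $ i) * (x $ j - p $ j) - (if i = j then 2 * k else 0))"
    for i j
  proof -
    have "GDERIV (\<lambda>x. x $ j - p $ j) x :> axis j 1"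
      unfolding gderiv_def
      by (auto simp: inner_axis fun_eq_iff intro!: derivative_eq_intros bounded_linear_imp_has_derivative bounded_linear_vec_nth)
    from GDERIV_mult[OF GDERIV_const GDERIV_mult[OF gE this], of "- 2 * k"]
    show ?thesis
      unfolding pdE
      by (subst GDERIV_pd(2)) (auto simp: axis_def power2_eq_square algebra_simps)
  qed
  have "(\<Sum>i\<in>UNIV. \<Sum>j\<in>UNIV. A $ i $ j * pd i (pd j E) x)
     = E x * (4 * k\<^sup>2 * ((x - p) \<bullet> (A *v (x - p)))) - E x * (2 * k * (\<Sum>i\<in>UNIV. A $ i $ i))"
  proof -
    have "(\<Sum>i\<in>UNIV. \<Sum>j\<in>UNIV. A $ i $ j * pd i (pd j E) x)
      = (\<Sum>i\<in>UNIV. \<Sum>j\<in>UNIV. E x * (4 * k\<^sup>2 * (A $ i $ j * (x $ i - p $ i) * (x $ j - p $ j))))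
        - (\<Sum>i\<in>UNIV. \<Sum>j\<in>UNIV. E x * (2 * k * (if i = j then A $ i $ j else 0)))"
      by (auto simp: pd2 sum_subtractf[symmetric] algebra_simps intro!: sum.cong)
    also have "(\<Sum>i\<in>UNIV. \<Sum>j\<in>UNIV. E x * (4 * k\<^sup>2 * (A $ i $ j * (x $ i - p $ i) * (x $ j - p $ j))))
      = E x * (4 * k\<^sup>2 * ((x - p) \<bullet> (A *v (x - p))))"
      by (simp add: inner_vec_def matrix_vector_mult_def sum_distrib_left mult_ac)
    also have "(\<Sum>i\<in>UNIV. \<Sum>j\<in>UNIV. E x * (2 * k * (if i = j then A $ i $ j else 0)))
      = E x * (2 * k * (\<Sum>i\<in>UNIV. A $ i $ i))"
      by (simp add: sum_distrib_left[symmetric])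
    finally show ?thesis .
  qed
  moreover have "grad E x = (- 2 * k * E x) *\<^sub>R (x - p)" by (rule GDERIV_grad[OF gE])
  ultimately show "ell A b E x = E x * (4 * k\<^sup>2 * ((x - p) \<bullet> (A *v (x - p)))
       - 2 * k * ((\<Sum>i\<in>UNIV. A $ i $ i) + b \<bullet> (x - p)))"
    unfolding ell_def inner_scaleR_right by (simp only:) (simp add: algebra_simps)
qed

lemma continuous_on_matrix_vector_mult:
  fixes A :: "'a::topological_space \<Rightarrow> real^'n::finite^'m::finite"
  assumes "continuous_on S A" "continuous_on S f"
  shows "continuous_on S (\<lambda>x. A x *v f x)"
  unfolding matrix_vector_mult_def
  by (intro continuous_on_vec_lambda continuous_intros assms)

text \<open>A ball of half the radius which is internally tangent to a ball touches its boundary in the point of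
  tangency only.\<close>

lemma strict_ball_touch:
  fixes a y q :: "'a::real_inner"
  assumes "norm y \<le> norm a / 2" "y \<noteq> a /\<^sub>R 2"
  shows "norm (a /\<^sub>R 2 + y) < norm a"
proof -
  have "0 < (norm (y - a /\<^sub>R 2))\<^sup>2" using assms(2) by simp
  moreover have "(norm y)\<^sup>2 \<le> (norm a)\<^sup>2 / 4"
    using power_mono[OF assms(1), of 2] by (simp add: power_divide)
  moreover have "(norm (a /\<^sub>R 2 + y))\<^sup>2 + (norm (y - a /\<^sub>R 2))\<^sup>2 = (norm a)\<^sup>2 / 2 + 2 * (norm y)\<^sup>2"
    by (simp add: power2_norm_eq_inner inner_add inner_diff inner_commute algebra_simps)
  ultimately have "(norm (a /\<^sub>R 2 + y))\<^sup>2 < (norm a)\<^sup>2"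
    by linarith
  then show ?thesis by (rule power_less_imp_less_base) simp
qed

text \<open>If \<open>u\<close> were not constant, there would be a ball that avoids the set \<open>u = M\<close> of maximum points and
  has a single point \<open>q\<close> of this set on its boundary. Adding a small multiple of the barrier centred
  at \<open>p\<close>, the centre of this ball, keeps the value \<open>M\<close> at \<open>q\<close> and pushes the values on a small
  sphere about \<open>q\<close> below \<open>M\<close>. The sum then has an interior maximum, where the operator would have
  to be nonpositive although it is positive on \<open>u\<close> plus barrier.\<close>

theorem strong_maximum_principle:
  fixes u :: "real^'n::finite \<Rightarrow> real" and A :: "real^'n \<Rightarrow> real^'n^'n" and b :: "real^'n \<Rightarrow> real^'n"
  assumes V: "open V" "connected V" and u: "C2_on V u"
    and A: "continuous_on V A" "\<And>x i j. x \<in> V \<Longrightarrow> A x $ i $ j = A x $ j $ i"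
      "\<And>x v. x \<in> V \<Longrightarrow> v \<noteq> 0 \<Longrightarrow> v \<bullet> (A x *v v) > 0"
    and b: "continuous_on V b"
    and Lu: "\<And>x. x \<in> V \<Longrightarrow> ell (A x) (b x) u x \<ge> 0"
    and x0: "x0 \<in> V" and max: "\<And>x. x \<in> V \<Longrightarrow> u x \<le> u x0"
    and x: "x \<in> V"
  shows "u x = u x0"
proof (rule ccontr)
  assume neq: "u x \<noteq> u x0"
  define M where "M = u x0"
  have contu: "continuous_on V u" using C1_on_continuous[OF C2_on_C1(1)[OF u]] .
  define Z where "Z = {y \<in> V. u y = M}"
  have "\<not> open Z"
  proof
    assume "open Z"
    moreover have "open {y \<in> V. u y < M}"
    proof -
      have "open (V \<inter> u -` {..<M})" by (rule continuous_open_preimage[OF contu V(1)]) auto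
      then show ?thesis by (simp add: vimage_def Int_def)
    qed
    moreover have "V \<subseteq> Z \<union> {y \<in> V. u y < M}"
    proof
      fix y assume "y \<in> V"
      then have "u y \<le> M" using max[of y] by (simp add: M_def)
      with \<open>y \<in> V\<close> show "y \<in> Z \<union> {y \<in> V. u y < M}" by (simp add: Z_def) linarith
    qed
    moreover have "Z \<inter> {y \<in> V. u y < M} \<inter> V = {}" by (auto simp: Z_def)
    ultimately have "Z \<inter> V = {} \<or> {y \<in> V. u y < M} \<inter> V = {}"
      using connectedD[OF V(2)] by blast
    moreover have "x0 \<in> Z \<inter> V" using x0 by (simp add: Z_def M_def)
    moreover have "x \<in> {y \<in> V. u y < M} \<inter> V" using x neq max[OF x] by (simp add: M_def)
    ultimately show False by blast
  qed
  then obtain z where z: "z \<in> Z" "\<And>r. r > 0 \<Longrightarrow> \<not> ball z r \<subseteq> Z"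
    using open_contains_ball[of Z] by blast
  have "z \<in> V" using z by (simp add: Z_def)
  then obtain r0 where r0: "r0 > 0" "cball z r0 \<subseteq> V" using V(1) open_contains_cball by blast
  \<comment> \<open>room for the point \<open>q\<close> within \<open>2 e\<close> of \<open>z\<close> and for a small ball about \<open>q\<close>\<close>
  define e where "e = r0 / 3"
  have e: "e > 0" "cball z (3 * e) \<subseteq> V" using r0 by (auto simp: e_def)
  obtain p0 where p0: "dist z p0 < e" "p0 \<notin> Z"
    using z(2)[OF e(1)] by (meson mem_ball subsetI)
  have sub2: "cball z (2 * e) \<subseteq> V" using e by (auto simp: subset_iff)
  define Z' where "Z' = {y \<in> cball z (2 * e). u y = M}"
  have "closed Z'"
    unfolding Z'_def using continuous_on_subset[OF contu sub2]
    by (intro continuous_closed_preimage_constant) auto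
  moreover have "z \<in> Z'" using z e by (auto simp: Z'_def Z_def)
  ultimately obtain q where q: "q \<in> Z'" "\<And>y. y \<in> Z' \<Longrightarrow> dist p0 q \<le> dist p0 y"
    using distance_attains_inf[of Z' p0] by blast
  have qV: "q \<in> V" "u q = M" using q(1) sub2 by (auto simp: Z'_def)
  define R where "R = dist p0 q"
  have "p0 \<noteq> q" using p0 qV by (auto simp: Z_def)
  then have R: "R > 0" "R < e"
    using q(2)[OF \<open>z \<in> Z'\<close>] p0 by (auto simp: R_def dist_commute)
  have inner: "y \<in> V \<and> u y < M" if "dist p0 y < R" for y
  proof -
    have "dist z y < 2 * e" using dist_triangle[of z y p0] that p0 R by simp
    then have y: "y \<in> cball z (2 * e)" by simp
    then have "y \<in> V" using sub2 by auto
    moreover have "u y \<noteq> M" using q(2)[of y] y that by (auto simp: Z'_def R_def)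
    ultimately show ?thesis using max[of y] by (auto simp: M_def)
  qed
  \<comment> \<open>the ball with diameter from \<open>p0\<close> to \<open>q\<close> touches the set of maximum points in \<open>q\<close> only\<close>
  define a where "a = q - p0"
  define p where "p = p0 + a /\<^sub>R 2"
  have na: "norm a = R" by (simp add: a_def R_def dist_norm norm_minus_commute)
  have pq: "q - p = a /\<^sub>R 2" by (simp add: p_def a_def vec_eq_iff field_simps)
  have touch: "u y < M" if "norm (y - p) \<le> R / 2" "y \<noteq> q" for y
  proof -
    have "norm (a /\<^sub>R 2 + (y - p)) < norm a"
      using that pq na by (intro strict_ball_touch) (auto simp: algebra_simps)
    then have "dist p0 y < R" by (simp add: p_def na dist_norm norm_minus_commute algebra_simps)
    then show ?thesis using inner by blast
  qed
  \<comment> \<open>the centre \<open>p\<close> of the barrier has the distance \<open>R / 2\<close> from \<open>q\<close>, so it is not in \<open>D\<close>\<close>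
  define D where "D = cball q (R / 4)"
  have DV: "D \<subseteq> V"
  proof
    fix y assume "y \<in> D"
    then have "dist z y \<le> dist z p0 + (dist p0 q + dist q y)"
      by (meson dist_triangle add_left_mono order_trans)
    also have "\<dots> \<le> e + (R + R / 4)" using p0 \<open>y \<in> D\<close> by (auto simp: R_def D_def)
    finally have "dist z y \<le> 3 * e" using R by simp
    then show "y \<in> V" using e(2) by auto
  qed
  have qD: "q \<in> D" using R by (simp add: D_def)
  have pD: "y \<noteq> p" if "y \<in> D" for y
  proof
    assume "y = p"
    then have "norm (q - p) \<le> R / 4" using that by (simp add: D_def dist_norm)
    then show False using R na by (simp add: pq)
  qed
  have "compact D" by (simp add: D_def)
  have cA: "continuous_on D (\<lambda>x. (x - p) \<bullet> (A x *v (x - p)))"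
  proof -
    have "continuous_on D A" using A(1) DV continuous_on_subset by blast
    then show ?thesis
      by (intro continuous_intros continuous_on_matrix_vector_mult) auto
  qed
  have cb: "continuous_on D (\<lambda>x. \<bar>(\<Sum>i\<in>UNIV. A x $ i $ i) + b x \<bullet> (x - p)\<bar>)"
    using continuous_on_subset[OF A(1) DV] continuous_on_subset[OF b DV]
    by (intro continuous_intros) auto
  obtain m where m: "m > 0" "\<And>x. x \<in> D \<Longrightarrow> m \<le> (x - p) \<bullet> (A x *v (x - p))"
  proof -
    obtain y where "y \<in> D" "\<forall>x\<in>D. (y - p) \<bullet> (A y *v (y - p)) \<le> (x - p) \<bullet> (A x *v (x - p))"
      using continuous_attains_inf[OF \<open>compact D\<close> _ cA] qD by blast
    then show ?thesis
      using A(3)[of y "y - p"] pD[of y] DV by (intro that[of "(y - p) \<bullet> (A y *v (y - p))"]) auto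
  qed
  obtain C where C: "C \<ge> 0" "\<And>x. x \<in> D \<Longrightarrow> \<bar>(\<Sum>i\<in>UNIV. A x $ i $ i) + b x \<bullet> (x - p)\<bar> \<le> C"
  proof -
    obtain y where "y \<in> D" "\<forall>x\<in>D. \<bar>(\<Sum>i\<in>UNIV. A x $ i $ i) + b x \<bullet> (x - p)\<bar>
        \<le> \<bar>(\<Sum>i\<in>UNIV. A y $ i $ i) + b y \<bullet> (y - p)\<bar>"
      using continuous_attains_sup[OF \<open>compact D\<close> _ cb] qD by blast
    then show ?thesis by (intro that[of "\<bar>(\<Sum>i\<in>UNIV. A y $ i $ i) + b y \<bullet> (y - p)\<bar>"]) auto
  qed
  \<comment> \<open>the quadratic term \<open>4 k\<^sup>2 m\<close> of the barrier exceeds the linear term \<open>2 k C\<close>\<close>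
  define k where "k = (C + 1) / m"
  have k: "k > 0" "k * m = C + 1" using C m by (auto simp: k_def)
  define E where "E = (\<lambda>x. exp (- k * ((x - p) \<bullet> (x - p))))"
  note E_rules = hopf_barrier[where k = k and p = p, folded E_def]
  have ellE: "ell (A x) (b x) E x > 0" if "x \<in> D" for x
  proof -
    have "2 * k * \<bar>(\<Sum>i\<in>UNIV. A x $ i $ i) + b x \<bullet> (x - p)\<bar> \<le> 2 * k * C"
      using C(2)[OF that] k by (intro mult_left_mono) auto
    moreover have "4 * k\<^sup>2 * m \<le> 4 * k\<^sup>2 * ((x - p) \<bullet> (A x *v (x - p)))"
      using m(2)[OF that] by (intro mult_left_mono) auto
    moreover have "4 * k\<^sup>2 * m = 4 * k * (C + 1)" using k by (simp add: power2_eq_square)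
    moreover have "2 * k * C < 4 * k * (C + 1)"
    proof -
      have "k * C \<ge> 0" using k C by simp
      then show ?thesis using k by (simp add: algebra_simps)
    qed
    moreover have "2 * k * ((\<Sum>i\<in>UNIV. A x $ i $ i) + b x \<bullet> (x - p))
        \<le> 2 * k * \<bar>(\<Sum>i\<in>UNIV. A x $ i $ i) + b x \<bullet> (x - p)\<bar>" using k by (intro mult_left_mono) auto
    ultimately have "4 * k\<^sup>2 * ((x - p) \<bullet> (A x *v (x - p)))
       - 2 * k * ((\<Sum>i\<in>UNIV. A x $ i $ i) + b x \<bullet> (x - p)) > 0" by linarith
    then show ?thesis unfolding E_rules(2) by (simp add: E_def)
  qed
  have E_le1: "E y \<le> 1" for y using k by (simp add: E_def)
  have Eq: "norm (y - p) \<le> R / 2" if "E y \<ge> E q" for y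
  proof -
    have "(y - p) \<bullet> (y - p) \<le> (q - p) \<bullet> (q - p)" using that k by (simp add: E_def)
    then have "norm (y - p) \<le> norm (q - p)" by (simp add: norm_le)
    then show ?thesis using na by (simp add: pq)
  qed
  \<comment> \<open>where the barrier is not below its value at \<open>q\<close>, there is a margin between \<open>u\<close> and \<open>M\<close>\<close>
  obtain d where d: "d > 0" "\<And>y. y \<in> sphere q (R / 4) \<Longrightarrow> norm (y - p) \<le> R / 2 \<Longrightarrow> u y + d < M"
  proof (cases "sphere q (R / 4) \<inter> cball p (R / 2) = {}")
    case True
    have "u y + 1 < M" if "y \<in> sphere q (R / 4)" "norm (y - p) \<le> R / 2" for y
    proof -
      have "y \<in> sphere q (R / 4) \<inter> cball p (R / 2)"
        using that by (simp add: dist_norm norm_minus_commute)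
      then show ?thesis using True by blast
    qed
    then show ?thesis using that[of 1] by simp
  next
    case False
    have sub: "sphere q (R / 4) \<inter> cball p (R / 2) \<subseteq> V" using DV by (auto simp: D_def)
    obtain y where y: "y \<in> sphere q (R / 4) \<inter> cball p (R / 2)"
       "\<forall>x\<in>sphere q (R / 4) \<inter> cball p (R / 2). u x \<le> u y"
      using continuous_attains_sup[OF compact_Int_closed[OF compact_sphere closed_cball] False
        continuous_on_subset[OF contu sub]] by blast
    have "u y < M" using touch[of y] y R by (auto simp: dist_norm norm_minus_commute)
    moreover have "u w \<le> u y" if "w \<in> sphere q (R / 4)" "norm (w - p) \<le> R / 2" for w
    proof -
      have "w \<in> sphere q (R / 4) \<inter> cball p (R / 2)"
        using that by (simp add: dist_norm norm_minus_commute)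
      then show ?thesis using y(2) by blast
    qed
    ultimately show ?thesis
      by (intro that[of "(M - u y) / 2"]) (fastforce simp: field_simps)+
  qed
  define v where "v = (\<lambda>x. u x + d * (E x - E q))"
  define v' where "v' = (\<lambda>x. u x + d * E x)"
  have EV: "C2_on V E"
    using E_rules(1) by (auto simp: C2_on_def intro: C1_on_subset)
  have v': "C2_on V v'" "\<And>x. x \<in> V \<Longrightarrow> ell (A x) (b x) v' x = ell (A x) (b x) u x + d * ell (A x) (b x) E x"
    unfolding v'_def using C2_on_add_scaled[OF V(1) u EV] by auto
  have sph: "v y < M" if y: "y \<in> sphere q (R / 4)" for y
  proof (cases "norm (y - p) \<le> R / 2")
    case True
    have "E q > 0" by (simp add: E_def)
    then have "d * (E y - E q) \<le> d * 1"
      using E_le1[of y] d(1) by (intro mult_left_mono) auto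
    then show ?thesis using d(2)[OF y True] by (simp add: v_def)
  next
    case False
    then have "E y < E q" using Eq[of y] by force
    then have "d * (E y - E q) < 0" using d by (simp add: mult_pos_neg)
    moreover have "u y \<le> M" using max[of y] y DV by (auto simp: M_def D_def)
    ultimately show ?thesis by (simp add: v_def)
  qed
  have "continuous_on D v'"
    using C1_on_continuous[OF C2_on_C1(1)[OF v'(1)]] DV continuous_on_subset by blast
  then obtain y where y: "y \<in> D" "\<And>x. x \<in> D \<Longrightarrow> v' x \<le> v' y"
    using continuous_attains_sup[OF \<open>compact D\<close>, of v'] qD by blast
  have vv': "v x = v' x - d * E q" for x by (simp add: v_def v'_def algebra_simps)
  have "v y \<ge> M" using y(2)[OF qD] qV by (simp add: vv') (simp add: v'_def)
  then have "y \<notin> sphere q (R / 4)" using sph[of y] by auto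
  then have yb: "y \<in> ball q (R / 4)" using y(1) by (auto simp: D_def)
  have "ell (A y) (b y) v' y \<le> 0"
  proof (rule ell_local_max[OF open_ball yb])
    show "C2_on (ball q (R / 4)) v'"
      using v'(1) DV ball_subset_cball[of q "R / 4"] unfolding C2_on_def D_def
      by (meson C1_on_subset order_trans)
    show "v' w \<le> v' y" if "w \<in> ball q (R / 4)" for w using y(2)[of w] that by (auto simp: D_def)
    have "y \<in> V" using y DV by auto
    then show "A y $ i $ j = A y $ j $ i" for i j using A(2) by blast
    show "0 \<le> v \<bullet> (A y *v v)" for v using A(3)[OF \<open>y \<in> V\<close>, of v] by (cases "v = 0") auto
  qed
  moreover have "ell (A y) (b y) v' y > 0"
    using v'(2)[of y] Lu[of y] ellE[of y] y(1) DV d by (smt (verit) mult_pos_pos subsetD)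
  ultimately show False by simp
qed

section \<open>The Laplacian in coordinates\<close>

definition posdef :: "real^'n::finite^'n \<Rightarrow> bool" where
  "posdef g \<longleftrightarrow> transpose g = g \<and> (\<forall>v. v \<noteq> 0 \<longrightarrow> v \<bullet> (g *v v) > 0)"

lemma
  assumes "invertible A"
  shows matrix_inv_right: "A ** matrix_inv A = mat 1" and matrix_inv_left: "matrix_inv A ** A = mat 1"
  using someI_ex[OF assms[unfolded invertible_def]] by (auto simp: matrix_inv_def)

lemma posdef_sym: "posdef g \<Longrightarrow> g $ i $ j = g $ j $ i"
  unfolding posdef_def transpose_def vec_eq_iff by simp

lemma posdef_invertible:
  assumes "posdef g" shows "invertible g"
proof -
  have "inj ((*v) g)"
  proof (rule injI)
    fix x y assume "g *v x = g *v y"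
    then have "g *v (x - y) = 0" by (simp add: matrix_vector_mult_diff_distrib)
    then show "x = y" using assms unfolding posdef_def by (metis eq_iff_diff_eq_0 inner_zero_right less_irrefl)
  qed
  then show ?thesis by (simp add: invertible_left_inverse matrix_left_invertible_injective)
qed

text \<open>The determinant does not vanish on the segment from the identity to \<open>g\<close>.\<close>

lemma posdef_det_pos:
  fixes g :: "real^'n::finite^'n"
  assumes "posdef g" shows "det g > 0"
proof (rule ccontr)
  assume "\<not> det g > 0"
  define f where "f t = det ((1 - t) *\<^sub>R mat 1 + t *\<^sub>R g)" for t :: real
  have f: "f 0 = 1" "f 1 \<le> 0" using \<open>\<not> det g > 0\<close> by (simp_all add: f_def)
  have "continuous_on {0..1} f"
    unfolding f_def det_def by (intro continuous_intros)
  then obtain t where t: "0 \<le> t" "t \<le> 1" "f t = 0"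
    using IVT2'[of f 1 0 0] f by auto
  have "posdef ((1 - t) *\<^sub>R mat 1 + t *\<^sub>R g)"
    unfolding posdef_def
  proof (intro conjI allI impI)
    show "transpose ((1 - t) *\<^sub>R mat 1 + t *\<^sub>R g) = (1 - t) *\<^sub>R mat 1 + t *\<^sub>R g"
      using assms by (simp add: posdef_def transpose_def vec_eq_iff mat_def)
    fix v :: "real^'n" assume v: "v \<noteq> 0"
    have "v \<bullet> (((1 - t) *\<^sub>R mat 1 + t *\<^sub>R g) *v v) = (1 - t) * (v \<bullet> v) + t * (v \<bullet> (g *v v))"
      by (simp add: matrix_vector_mult_add_rdistrib scaleR_matrix_vector_assoc[symmetric] inner_add_right)
    moreover have "v \<bullet> v > 0" "v \<bullet> (g *v v) > 0" using v assms by (auto simp: posdef_def)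
    ultimately show "v \<bullet> (((1 - t) *\<^sub>R mat 1 + t *\<^sub>R g) *v v) > 0"
      using t by (cases "t = 0") (auto intro!: add_nonneg_pos)
  qed
  then show False using posdef_invertible invertible_det_nz t(3) unfolding f_def by blast
qed

lemma posdef_inverse:
  assumes "posdef g" shows "posdef (matrix_inv g)"
proof -
  let ?h = "matrix_inv g"
  have inv: "g ** ?h = mat 1" "?h ** g = mat 1"
    using posdef_invertible[OF assms] by (simp_all add: matrix_inv_right matrix_inv_left)
  have "transpose ?h = ?h"
  proof -
    have "transpose ?h ** g = mat 1"
      using arg_cong[OF inv(1), of transpose] assms by (simp add: matrix_transpose_mul posdef_def)
    then have "transpose ?h ** g ** ?h = ?h" by simp
    then show ?thesis by (simp add: matrix_mul_assoc[symmetric] inv)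
  qed
  moreover have "v \<bullet> (?h *v v) > 0" if "v \<noteq> 0" for v
  proof -
    have v: "g *v (?h *v v) = v" by (simp add: matrix_vector_mul_assoc inv)
    then have "?h *v v \<noteq> 0" using that by auto
    then have "(?h *v v) \<bullet> (g *v (?h *v v)) > 0" using assms by (simp add: posdef_def)
    then show ?thesis by (simp add: v inner_commute)
  qed
  ultimately show ?thesis by (simp add: posdef_def)
qed

text \<open>By Cramer's rule the entries of the inverse are quotients of determinants.\<close>

lemma C1_on_matrix_inv:
  fixes g :: "real^'n::finite \<Rightarrow> real^'m::finite^'m"
  assumes S: "open S" and g: "\<And>i j. C1_on S (\<lambda>x. g x $ i $ j)" and inv: "\<And>x. x \<in> S \<Longrightarrow> invertible (g x)"
  shows "C1_on S (\<lambda>x. matrix_inv (g x) $ i $ j)"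
proof -
  have C: "C1_on S (\<lambda>x. det (\<chi> r s. if s = i then axis j 1 $ r else g x $ r $ s) / det (g x))"
  proof (intro C1_on_divide C1_on_det S g)
    show "C1_on S (\<lambda>x. (\<chi> r s. if s = i then axis j 1 $ r else g x $ r $ s) $ r $ s)" for r s
      using g[of r s] C1_on_const[OF S, of "axis j 1 $ r"] by (cases "s = i") auto
    show "det (g x) \<noteq> 0" if "x \<in> S" for x using inv[OF that] by (simp add: invertible_det_nz)
  qed
  have "det (\<chi> r s. if s = i then axis j 1 $ r else g x $ r $ s) / det (g x) = matrix_inv (g x) $ i $ j"
    if "x \<in> S" for x
  proof -
    have nz: "det (g x) \<noteq> 0" using inv[OF that] by (simp add: invertible_det_nz)
    have "g x *v (matrix_inv (g x) *v axis j 1) = axis j 1"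
      using inv[OF that] by (simp add: matrix_vector_mul_assoc matrix_inv_right)
    then have "matrix_inv (g x) *v axis j 1
       = (\<chi> k. det (\<chi> r s. if s = k then axis j 1 $ r else g x $ r $ s) / det (g x))"
      using cramer[OF nz] by blast
    then have "(matrix_inv (g x) *v axis j 1) $ i
       = det (\<chi> r s. if s = i then axis j 1 $ r else g x $ r $ s) / det (g x)"
      by simp
    then show ?thesis
      by (simp add: matrix_vector_mult_basis column_def)
  qed
  then show ?thesis by (rule C1_on_cong[OF S _ C])
qed

text \<open>The matrix \<open>A = \<surd>(det g) g\<^sup>-\<^sup>1\<close>, for which \<open>\<surd>(det g) \<Delta>u = div (A \<nabla>u)\<close>.\<close>

definition lapA :: "real^'n::finite^'n \<Rightarrow> real^'n^'n" where
  "lapA g = sqrt (det g) *\<^sub>R matrix_inv g"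

definition metric_on :: "(real^'n::finite) set \<Rightarrow> (real^'n \<Rightarrow> real^'n^'n) \<Rightarrow> bool" where
  "metric_on V g \<longleftrightarrow> open V \<and> (\<forall>x\<in>V. posdef (g x)) \<and> (\<forall>i j. C1_on V (\<lambda>x. g x $ i $ j))"

lemma metric_on_subset: "metric_on V g \<Longrightarrow> W \<subseteq> V \<Longrightarrow> open W \<Longrightarrow> metric_on W g"
  by (auto simp: metric_on_def intro!: C1_on_subset[of V _ W])

lemma metric_on_lapA:
  assumes "metric_on V g"
  shows "C1_on V (\<lambda>x. lapA (g x) $ i $ j)" "x \<in> V \<Longrightarrow> posdef (lapA (g x))"
    "continuous_on V (\<lambda>x. lapA (g x))" "continuous_on V (\<lambda>x. sqrt (det (g x)))"
proof -
  have V: "open V" and pd: "\<And>x. x \<in> V \<Longrightarrow> posdef (g x)" and g: "\<And>i j. C1_on V (\<lambda>x. g x $ i $ j)"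
    using assms by (auto simp: metric_on_def)
  have sq: "C1_on V (\<lambda>x. sqrt (det (g x)))"
    by (intro C1_on_sqrt C1_on_det V g posdef_det_pos pd)
  then show "continuous_on V (\<lambda>x. sqrt (det (g x)))" by (rule C1_on_continuous)
  show C: "C1_on V (\<lambda>x. lapA (g x) $ i $ j)" for i j
    unfolding lapA_def using C1_on_mult[OF V sq C1_on_matrix_inv[OF V g posdef_invertible[OF pd]]]
    by simp
  have "continuous_on V (\<lambda>x. \<chi> i j. lapA (g x) $ i $ j)"
    by (intro continuous_on_vec_lambda C1_on_continuous[OF C])
  then show "continuous_on V (\<lambda>x. lapA (g x))" by simp
  assume x: "x \<in> V"
  have d: "sqrt (det (g x)) > 0" using posdef_det_pos[OF pd[OF x]] by simp
  from posdef_inverse[OF pd[OF x]] show "posdef (lapA (g x))"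
    unfolding posdef_def lapA_def using d
    by (simp add: scaleR_matrix_vector_assoc[symmetric] transpose_def vec_eq_iff)
qed

lemma laplacian_eq_div:
  "laplacian g u x = (1 / sqrt (det (g x))) * (\<Sum>i\<in>UNIV. pd i (\<lambda>y. (lapA (g y) *v grad u y) $ i) x)"
  unfolding laplacian_def lapA_def
  by (simp add: matrix_vector_mult_def sum_distrib_left mult.assoc)

lemma laplacian_eq_ell:
  fixes u :: "real^'n::finite \<Rightarrow> real"
  assumes g: "metric_on V g" and u: "C2_on V u" and x: "x \<in> V"
  shows "laplacian g u x = (1 / sqrt (det (g x))) *
     ell (lapA (g x)) (\<chi> j. \<Sum>i\<in>UNIV. pd i (\<lambda>y. lapA (g y) $ i $ j) x) u x"
proof -
  have V: "open V" using g by (simp add: metric_on_def)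
  note A = metric_on_lapA(1)[OF g] and u1 = C2_on_C1(2)[OF u]
  have "pd i (\<lambda>y. (lapA (g y) *v grad u y) $ i) x
    = (\<Sum>j\<in>UNIV. lapA (g x) $ i $ j * pd i (pd j u) x + pd j u x * pd i (\<lambda>y. lapA (g y) $ i $ j) x)" for i
  proof -
    have 1: "(\<lambda>y. (lapA (g y) *v grad u y) $ i) = (\<lambda>y. \<Sum>j\<in>UNIV. lapA (g y) $ i $ j * pd j u y)"
      by (simp add: matrix_vector_mult_def fun_eq_iff)
    have "GDERIV (\<lambda>y. \<Sum>j\<in>J. lapA (g y) $ i $ j * pd j u y) x :>
       (\<Sum>j\<in>J. lapA (g x) $ i $ j *\<^sub>R grad (pd j u) x + pd j u x *\<^sub>R grad (\<lambda>y. lapA (g y) $ i $ j) x)"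
      if "finite J" for J :: "'n set"
      using that
      by (induction J rule: finite_induct)
        (auto intro!: GDERIV_const GDERIV_add GDERIV_mult C1_on_GDERIV[OF A V x] C1_on_GDERIV[OF u1 V x])
    from GDERIV_pd(2)[OF this[OF finite], of i] show ?thesis unfolding 1 by simp
  qed
  then show ?thesis
    unfolding laplacian_eq_div ell_def
    by (simp add: sum.distrib inner_vec_def sum_distrib_right) (subst (2) sum.swap, simp add: mult.commute)
qed

lemma continuous_on_lap_drift:
  assumes "metric_on V g"
  shows "continuous_on V (\<lambda>x. \<chi> j. \<Sum>i\<in>UNIV. pd i (\<lambda>y. lapA (g y) $ i $ j) x)"
  using metric_on_lapA(1)[OF assms]
  by (intro continuous_on_vec_lambda continuous_intros) (auto simp: C1_on_def)

text \<open>Differences are what is needed to compare the values of a function on two leaves over the same ball.\<close>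

theorem harmonic_difference_max:
  fixes u v :: "real^'n::finite \<Rightarrow> real"
  assumes g: "metric_on V g" and V: "connected V"
    and u: "C2_on V u" "\<And>x. x \<in> V \<Longrightarrow> laplacian g u x = 0"
    and v: "C2_on V v" "\<And>x. x \<in> V \<Longrightarrow> laplacian g v x = 0"
    and x0: "x0 \<in> V" "\<And>x. x \<in> V \<Longrightarrow> u x - v x \<le> u x0 - v x0" and x: "x \<in> V"
  shows "u x - v x = u x0 - v x0"
proof -
  have oV: "open V" using g by (simp add: metric_on_def)
  let ?b = "\<lambda>x. \<chi> j. \<Sum>i\<in>UNIV. pd i (\<lambda>y. lapA (g y) $ i $ j) x"
  have z: "ell (lapA (g y)) (?b y) w y = 0"
    if "y \<in> V" "C2_on V w" "laplacian g w y = 0" for w y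
  proof -
    have "det (g y) > 0" using g that(1) by (simp add: metric_on_def posdef_det_pos)
    then show ?thesis using laplacian_eq_ell[OF g that(2,1)] that(3) by simp
  qed
  have "u x + (- 1) * v x = u x0 + (- 1) * v x0"
  proof (rule strong_maximum_principle[OF oV V _ metric_on_lapA(3)[OF g] _ _ continuous_on_lap_drift[OF g] _ x0(1) _ x])
    show "C2_on V (\<lambda>x. u x + (- 1) * v x)" by (rule C2_on_add_scaled(1)[OF oV u(1) v(1)])
    show "lapA (g y) $ i $ j = lapA (g y) $ j $ i" if "y \<in> V" for y i j
      by (rule posdef_sym[OF metric_on_lapA(2)[OF g that]])
    show "0 < w \<bullet> (lapA (g y) *v w)" if "y \<in> V" "w \<noteq> 0" for y w
      using metric_on_lapA(2)[OF g that(1)] that(2) by (simp add: posdef_def)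
    show "0 \<le> ell (lapA (g y)) (?b y) (\<lambda>x. u x + (- 1) * v x) y" if "y \<in> V" for y
      unfolding C2_on_add_scaled(2)[OF oV u(1) v(1) that]
      using z[OF that u(1) u(2)[OF that]] z[OF that v(1) v(2)[OF that]] by simp
    show "u y + - 1 * v y \<le> u x0 + - 1 * v x0" if "y \<in> V" for y using x0(2)[OF that] by simp
  qed
  then show ?thesis by simp
qed

section \<open>Integration by parts for compactly supported functions\<close>

text \<open>\<open>f\<close> is defined on the open set \<open>B\<close> and supported in the compact set \<open>C\<close>.\<close>

definition cs_in :: "(real^'n::finite) set \<Rightarrow> (real^'n) set \<Rightarrow> (real^'n \<Rightarrow> real) \<Rightarrow> bool" where
  "cs_in B C f \<longleftrightarrow> open B \<and> compact C \<and> C \<subseteq> B \<and> (\<forall>x\<in>B - C. f x = 0)"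

lemma cs_extend_continuous:
  fixes f :: "real^'n::finite \<Rightarrow> real"
  assumes cs: "cs_in B C f" and f: "continuous_on B f"
  shows "continuous_on UNIV (\<lambda>x. if x \<in> B then f x else 0)"
proof -
  have B: "open B" and C: "closed C" "C \<subseteq> B" and z: "\<And>x. x \<in> B - C \<Longrightarrow> f x = 0"
    using cs by (auto simp: cs_in_def compact_imp_closed)
  have "continuous_on (B \<union> - C) (\<lambda>x. if x \<in> B then f x else 0)"
  proof (rule continuous_on_open_Un)
    show "continuous_on B (\<lambda>x. if x \<in> B then f x else 0)" by (rule continuous_on_eq[OF f]) auto
    show "continuous_on (- C) (\<lambda>x. if x \<in> B then f x else 0)"
      by (rule continuous_on_eq[OF continuous_on_const[of _ 0]]) (use z in auto)
  qed (use B C in auto)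
  moreover have "B \<union> - C = UNIV" using C by auto
  ultimately show ?thesis by simp
qed

lemma cs_integrable:
  fixes f :: "real^'n::finite \<Rightarrow> real"
  assumes cs: "cs_in B C f" and f: "continuous_on B f"
  shows "f absolutely_integrable_on B"
proof -
  have int: "f integrable_on B" if cs: "cs_in B C f" and f: "continuous_on B f" for f
  proof -
    let ?F = "\<lambda>x. if x \<in> B then f x else 0"
    obtain a b where ab: "C \<subseteq> cbox a b"
      using cs bounded_subset_cbox_symmetric compact_imp_bounded unfolding cs_in_def by metis
    have "?F integrable_on cbox a b"
      by (rule integrable_continuous[OF continuous_on_subset[OF cs_extend_continuous[OF cs f]]]) simp
    moreover have "?F x = 0" if "x \<notin> cbox a b" for x using that cs ab by (auto simp: cs_in_def)
    ultimately have "?F integrable_on UNIV" by (rule integrable_on_superset) auto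
    then show ?thesis by (simp add: integrable_restrict_UNIV)
  qed
  have "cs_in B C (\<lambda>x. norm (f x))" using cs by (auto simp: cs_in_def)
  then show ?thesis
    unfolding absolutely_integrable_on_def
    using int[OF cs f] int[of "\<lambda>x. norm (f x)"] f by (auto intro!: continuous_intros)
qed

text \<open>The integrals of the difference quotients in direction \<open>i\<close> vanish by translation invariance, and
  they converge by dominated convergence.\<close>

lemma integral_pd_UNIV:
  fixes F :: "real^'n::finite \<Rightarrow> real"
  assumes F: "C1_on UNIV F" and C: "compact C" and z: "\<And>x. x \<notin> C \<Longrightarrow> F x = 0"
  shows "(pd i F has_integral 0) UNIV"
proof -
  define e where "e = (axis i 1 :: real^'n)"
  have ne: "norm e = 1" by (simp add: e_def)
  obtain a0 where a0: "C \<subseteq> cbox (- a0) a0" using bounded_subset_cbox_symmetric[OF compact_imp_bounded[OF C]] by metis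
  \<comment> \<open>room for translations by at most \<open>1\<close>\<close>
  define a where "a = a0 + 1"
  have inQ: "x \<in> cbox (- a) a" "x \<in> cbox (- a - t *\<^sub>R e) (a - t *\<^sub>R e)" "x - t *\<^sub>R e \<in> cbox (- a) a"
    if "x \<in> C" "0 \<le> t" "t \<le> 1" for x t
  proof -
    have c: "- a0 $ j \<le> x $ j \<and> x $ j \<le> a0 $ j" for j
      using that(1) a0 by (auto simp: mem_box_cart subset_iff)
    have e1: "0 \<le> t * e $ j \<and> t * e $ j \<le> 1" for j using that by (auto simp: e_def axis_def)
    show "x \<in> cbox (- a) a" "x \<in> cbox (- a - t *\<^sub>R e) (a - t *\<^sub>R e)" "x - t *\<^sub>R e \<in> cbox (- a) a"
      unfolding mem_box_cart using c e1 by (auto simp: a_def) (smt (verit, best) c e1)+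
  qed
  have contF: "continuous_on UNIV F" by (rule C1_on_continuous[OF F])
  have pdz: "pd i F x = 0" if "x \<notin> C" for x
    using pd_cong_open[of "- C" x F "\<lambda>_. 0" i] that z C by (auto simp: pd_const compact_imp_closed open_Compl)
  have contpd: "continuous_on UNIV (pd i F)" using F by (simp add: C1_on_def)
  obtain M where M: "\<And>x. \<bar>pd i F x\<bar> \<le> M"
  proof -
    have "bounded (pd i F ` C)" using C contpd by (meson compact_continuous_image compact_imp_bounded continuous_on_subset subset_UNIV)
    then obtain M where "\<And>x. x \<in> C \<Longrightarrow> \<bar>pd i F x\<bar> \<le> M" "M > 0" unfolding bounded_pos by auto
    then show ?thesis using pdz by (intro that[of M]) (metis abs_zero less_imp_le)
  qed
  define Q where "Q = cbox (- a) a"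
  define f where "f n x = (F (x + (1 / real (Suc n)) *\<^sub>R e) - F x) / (1 / real (Suc n))" for n x
  have FQ: "(F has_integral integral UNIV F) UNIV" "F integrable_on UNIV"
  proof -
    have "F integrable_on Q" unfolding Q_def by (rule integrable_continuous[OF continuous_on_subset[OF contF]]) simp
    then show "F integrable_on UNIV" by (rule integrable_on_superset) (use z inQ[of _ 0] in \<open>auto simp: Q_def\<close>)
    then show "(F has_integral integral UNIV F) UNIV" by (rule integrable_integral)
  qed
  have fint: "(f n has_integral 0) Q" for n
  proof -
    define t where "t = 1 / real (Suc n)"
    have t: "0 \<le> t" "t \<le> 1" "t > 0" by (auto simp: t_def)
    have "(F has_integral integral UNIV F) (cbox (- a + t *\<^sub>R e) (a + t *\<^sub>R e))"
    proof (rule has_integral_restrict_UNIV[THEN iffD1])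
      have "x \<in> cbox (- a + t *\<^sub>R e) (a + t *\<^sub>R e)" if "x \<in> C" for x
        using inQ(3)[OF that t(1,2)] by (auto simp: mem_box_cart algebra_simps)
      then have "(\<lambda>x. if x \<in> cbox (- a + t *\<^sub>R e) (a + t *\<^sub>R e) then F x else 0) = F" using z by fastforce
      then show "((\<lambda>x. if x \<in> cbox (- a + t *\<^sub>R e) (a + t *\<^sub>R e) then F x else 0) has_integral integral UNIV F) UNIV"
        using FQ by simp
    qed
    then have "((F \<circ> (+) (t *\<^sub>R e)) has_integral integral UNIV F) (cbox (- a) a)"
      by (subst has_integral_shift_cbox_iff)
    moreover have "(F has_integral integral UNIV F) (cbox (- a) a)"
    proof (rule has_integral_restrict_UNIV[THEN iffD1])
      have "(\<lambda>x. if x \<in> cbox (- a) a then F x else 0) = F" using z inQ(1)[of _ 0] by fastforce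
      then show "((\<lambda>x. if x \<in> cbox (- a) a then F x else 0) has_integral integral UNIV F) UNIV" using FQ by simp
    qed
    ultimately have "((\<lambda>x. ((F \<circ> (+) (t *\<^sub>R e)) x - F x) / t) has_integral (integral UNIV F - integral UNIV F) / t) Q"
      unfolding Q_def by (intro has_integral_divide has_integral_diff)
    then show ?thesis by (simp add: f_def[abs_def] t_def o_def add.commute)
  qed
  have lim: "(\<lambda>n. f n x) \<longlonglongrightarrow> pd i F x" for x
  proof -
    have "((\<lambda>t. F (x + t *\<^sub>R e)) has_real_derivative pd i F x) (at 0)"
      using C1_on_DERIV_line[OF F, of x 0 i] by (simp add: e_def)
    then have "((\<lambda>t. (F (x + t *\<^sub>R e) - F x) / t) \<longlongrightarrow> pd i F x) (at 0)"
      by (simp add: has_field_derivative_iff)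
    moreover have "filterlim (\<lambda>n. 1 / real (Suc n)) (at 0) sequentially"
      unfolding filterlim_at using LIMSEQ_inverse_real_of_nat by (auto simp: inverse_eq_divide)
    ultimately show ?thesis unfolding f_def by (rule filterlim_compose)
  qed
  have bound: "norm (f n x) \<le> M" for n x
  proof -
    define t where "t = 1 / real (Suc n)"
    have t: "t > 0" by (simp add: t_def)
    have "\<exists>z>0. z < t \<and> F (x + t *\<^sub>R e) - F (x + 0 *\<^sub>R e) = (t - 0) * pd i F (x + z *\<^sub>R e)"
      by (rule MVT2[OF t]) (use C1_on_DERIV_line[OF F] in \<open>simp add: e_def\<close>)
    then obtain z where "F (x + t *\<^sub>R e) - F x = t * pd i F (x + z *\<^sub>R e)" by auto
    moreover have "f n x = (F (x + t *\<^sub>R e) - F x) / t" by (simp only: f_def t_def)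
    ultimately have "f n x = pd i F (x + z *\<^sub>R e)" using t by simp
    then show ?thesis using M by simp
  qed
  have "(\<lambda>n. integral Q (f n)) \<longlonglongrightarrow> integral Q (pd i F)"
    by (rule dominated_convergence(2)[where h = "\<lambda>_. M"])
      (use fint bound lim in \<open>auto simp: Q_def intro: has_integral_integrable\<close>)
  then have 0: "integral Q (pd i F) = 0"
    using integral_unique[OF fint] by (simp add: LIMSEQ_const_iff)
  have "pd i F integrable_on Q"
    unfolding Q_def by (rule integrable_continuous[OF continuous_on_subset[OF contpd]]) simp
  then have "(pd i F has_integral 0) Q" using 0 by (metis integrable_integral)
  then show ?thesis
    by (rule has_integral_on_superset) (use pdz inQ(1)[of _ 0] in \<open>auto simp: Q_def\<close>)
qed

lemma cs_integral_pd:
  fixes F :: "real^'n::finite \<Rightarrow> real"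
  assumes cs: "cs_in B C F" and F: "C1_on B F"
  shows "(pd i F has_integral 0) B"
proof -
  have B: "open B" and C: "compact C" "closed C" "C \<subseteq> B" and z: "\<And>x. x \<in> B - C \<Longrightarrow> F x = 0"
    using cs by (auto simp: cs_in_def compact_imp_closed)
  define E where "E x = (if x \<in> B then F x else 0)" for x
  have EB: "C1_on B E" by (rule C1_on_cong[OF B _ F]) (simp add: E_def)
  have EC: "C1_on (- C) E"
    by (rule C1_on_cong[OF _ _ C1_on_const[of _ 0]]) (use z C in \<open>auto simp: E_def\<close>)
  have "C1_on UNIV E"
  proof (rule C1_on_local)
    fix x :: "real^'n"
    show "\<exists>T. open T \<and> x \<in> T \<and> C1_on T E"
      by (cases "x \<in> B") (use EB EC B C in \<open>auto intro: exI[of _ B] exI[of _ "- C"]\<close>)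
  qed simp
  then have E0: "(pd i E has_integral 0) UNIV"
    by (rule integral_pd_UNIV[OF _ C(1)]) (use z C in \<open>auto simp: E_def\<close>)
  have "pd i E x = (if x \<in> B then pd i F x else 0)" for x
  proof (cases "x \<in> B")
    case True
    then show ?thesis using pd_cong_open[OF B True, of E F i] by (simp add: E_def)
  next
    case False
    then have "x \<in> - C" using C by auto
    then have "pd i E x = pd i (\<lambda>_. 0) x"
      by (rule pd_cong_open[rotated]) (use z C in \<open>auto simp: E_def\<close>)
    then show ?thesis using False by (simp add: pd_const)
  qed
  then show ?thesis using E0 has_integral_restrict_UNIV[of B "pd i F" 0] by (simp add: fun_eq_iff[symmetric] cong: has_integral_cong)
qed

text \<open>In a chart with \<open>A = \<surd>(det g) g\<^sup>-\<^sup>1\<close> this is the density of \<open>\<langle>\<nabla>f, \<nabla>u\<rangle>\<close> with respect to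
  Lebesgue measure.\<close>

definition pair :: "(real^'n::finite \<Rightarrow> real^'n^'n) \<Rightarrow> (real^'n \<Rightarrow> real) \<Rightarrow> (real^'n \<Rightarrow> real) \<Rightarrow> real^'n \<Rightarrow> real" where
  "pair A f u x = grad f x \<bullet> (A x *v grad u x)"

text \<open>The integrand is the divergence of \<open>f A \<nabla>u\<close>, because \<open>div (A \<nabla>u) = 0\<close>.\<close>

lemma weakly_harmonic:
  fixes u :: "real^'n::finite \<Rightarrow> real"
  assumes g: "metric_on B g" and u: "C2_on B u" "\<And>x. x \<in> B \<Longrightarrow> laplacian g u x = 0"
    and cs: "cs_in B C f" and f: "C1_on B f"
  shows "(pair (\<lambda>x. lapA (g x)) f u has_integral 0) B"
proof -
  have B: "open B" using g by (simp add: metric_on_def)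
  define X where "X i = (\<lambda>x. (lapA (g x) *v grad u x) $ i)" for i
  have X: "C1_on B (X i)" for i
  proof -
    have "C1_on B (\<lambda>x. \<Sum>j\<in>UNIV. lapA (g x) $ i $ j * pd j u x)"
      by (intro C1_on_sum C1_on_mult B metric_on_lapA(1)[OF g] C2_on_C1(2)[OF u(1)])
    then show ?thesis by (simp add: X_def matrix_vector_mult_def)
  qed
  have int: "((\<lambda>x. \<Sum>i\<in>UNIV. pd i (\<lambda>x. f x * X i x) x) has_integral (\<Sum>i\<in>(UNIV::'n set). 0)) B"
    by (intro has_integral_sum finite cs_integral_pd C1_on_mult B f X) (use cs in \<open>auto simp: cs_in_def\<close>)
  have eq: "(\<Sum>i\<in>UNIV. pd i (\<lambda>x. f x * X i x) x) = pair (\<lambda>x. lapA (g x)) f u x" if x: "x \<in> B" for x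
  proof -
    have "det (g x) > 0" using g x by (simp add: metric_on_def posdef_det_pos)
    then have "(\<Sum>i\<in>UNIV. pd i (X i) x) = 0"
      using u(2)[OF x] unfolding laplacian_eq_div X_def by simp
    moreover have "(\<Sum>i\<in>UNIV. pd i (\<lambda>x. f x * X i x) x) = f x * (\<Sum>i\<in>UNIV. pd i (X i) x) + (\<Sum>i\<in>UNIV. X i x * pd i f x)"
      by (simp add: pd_rules(3)[OF B x f X] sum.distrib sum_distrib_left)
    ultimately show ?thesis by (simp add: pair_def inner_vec_def X_def mult.commute)
  qed
  show ?thesis using has_integral_cong[of B, OF eq] int by simp
qed

lemma pair_sym:
  assumes "posdef (A x)" shows "pair A f u x = pair A u f x"
proof -
  have "transpose (A x) = A x" using assms by (simp add: posdef_def)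
  then show ?thesis unfolding pair_def by (metis dot_lmul_matrix inner_commute transpose_matrix_vector)
qed

lemma pair_rules:
  assumes "open B" "x \<in> B" "C1_on B f" "C1_on B k"
  shows "pair A (\<lambda>x. f x * k x) u x = f x * pair A k u x + k x * pair A f u x"
    "pair A (\<lambda>x. f x - k x) u x = pair A f u x - pair A k u x"
  by (simp_all add: pair_def grad_rules[OF assms] inner_add_left inner_diff_left)

lemma pair_continuous:
  assumes "metric_on B g" "C1_on B f" "C1_on B u"
  shows "continuous_on B (pair (\<lambda>x. lapA (g x)) f u)"
  unfolding pair_def
  by (intro continuous_intros continuous_on_matrix_vector_mult metric_on_lapA(3)[OF assms(1)] C1_on_grad_continuous assms)

text \<open>Weak form of \<open>div (2 u (v - u) \<nabla>u - u\<^sup>2 \<nabla>(v - u)) = 2 (v - u) \<bar>\<nabla>u\<bar>\<^sup>2\<close>. For neighbours \<open>u\<close> and \<open>v\<close> in a chain of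
  harmonic functions the right-hand side is a term of a Riemann sum for the energy, and derivatives of
  \<open>v - u\<close> occur on the left in a form that can be summed by parts.\<close>

lemma weak_three_term:
  fixes u v :: "real^'n::finite \<Rightarrow> real"
  assumes g: "metric_on B g" and u: "C2_on B u" "\<And>x. x \<in> B \<Longrightarrow> laplacian g u x = 0"
    and v: "C2_on B v" "\<And>x. x \<in> B \<Longrightarrow> laplacian g v x = 0"
    and cs: "cs_in B C f" and f: "C1_on B f"
  defines "P \<equiv> pair (\<lambda>x. lapA (g x))"
  shows "((\<lambda>x. 2 * u x * (v x - u x) * P f u x - (u x)\<^sup>2 * (P f v x - P f u x)
     + 2 * f x * (v x - u x) * P u u x) has_integral 0) B"
proof -
  have B: "open B" using g by (simp add: metric_on_def)
  note u1 = C2_on_C1(1)[OF u(1)] and v1 = C2_on_C1(1)[OF v(1)]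
  note C = C1_on_mult[OF B] C1_on_diff[OF B]
  \<comment> \<open>\<open>k1\<close> is tested against \<open>u\<close>, and \<open>k2\<close> against \<open>v - u\<close>\<close>
  define k1 where "k1 x = f x * (u x * (v x - u x))" for x
  define k2 where "k2 x = f x * (u x * u x)" for x
  have cs1: "cs_in B C k1" "cs_in B C k2" using cs by (auto simp: cs_in_def k1_def k2_def)
  have C1: "C1_on B k1" "C1_on B k2" unfolding k1_def[abs_def] k2_def[abs_def] by (intro C f u1 v1)+
  have I: "(P k1 u has_integral 0) B" "(P k2 u has_integral 0) B" "(P k2 v has_integral 0) B"
    unfolding P_def
    using weakly_harmonic[OF g u cs1(1) C1(1)] weakly_harmonic[OF g u cs1(2) C1(2)] weakly_harmonic[OF g v cs1(2) C1(2)] by auto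
  have K: "((\<lambda>x. 2 * P k1 u x - (P k2 v x - P k2 u x)) has_integral 2 * 0 - (0 - 0)) B"
    by (intro has_integral_diff has_integral_mult_right I)
  have eq: "2 * P k1 u x - (P k2 v x - P k2 u x) = 2 * u x * (v x - u x) * P f u x - (u x)\<^sup>2 * (P f v x - P f u x)
     + 2 * f x * (v x - u x) * P u u x" if x: "x \<in> B" for x
  proof -
    have s: "P v u x = P u v x" unfolding P_def by (rule pair_sym, rule metric_on_lapA(2)[OF g x])
    have k1: "P k1 w x = f x * (u x * (P v w x - P u w x) + (v x - u x) * P u w x) + u x * (v x - u x) * P f w x" for w
      unfolding P_def k1_def[abs_def]
      by (simp add: pair_rules(1)[OF B x f C(1)[OF u1 C(2)[OF v1 u1]]] pair_rules(1)[OF B x u1 C(2)[OF v1 u1]]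
         pair_rules(2)[OF B x v1 u1])
    have k2: "P k2 w x = f x * (u x * P u w x + u x * P u w x) + u x * u x * P f w x" for w
      unfolding P_def k2_def[abs_def]
      by (simp add: pair_rules(1)[OF B x f C(1)[OF u1 u1]] pair_rules(1)[OF B x u1 u1])
    show ?thesis unfolding k1 k2 s by (simp add: power2_eq_square algebra_simps)
  qed
  show ?thesis by (rule has_integral_eq[OF eq]) (use K in simp_all)
qed

text \<open>The identities for consecutive members of the chain are added. Summation by parts turns
  \<open>- (a i)\<^sup>2 \<nabla>(a (i + 1) - a i)\<close> into Riemann sums, up to a term quadratic in the increments; there are no
  boundary terms because the gradients vanish at both ends.\<close>

lemma weak_chain:
  fixes a :: "nat \<Rightarrow> real^'n::finite \<Rightarrow> real"
  assumes g: "metric_on B g" and a: "\<And>i. i \<le> N \<Longrightarrow> C2_on B (a i)"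
      "\<And>i x. i \<le> N \<Longrightarrow> x \<in> B \<Longrightarrow> laplacian g (a i) x = 0"
    and ends: "\<And>x. x \<in> B \<Longrightarrow> grad (a 0) x = 0" "\<And>x. x \<in> B \<Longrightarrow> grad (a N) x = 0"
    and cs: "cs_in B C f" and f: "C1_on B f"
  defines "P \<equiv> pair (\<lambda>x. lapA (g x))"
  shows "((\<lambda>x. 2 * (\<Sum>i<N. a i x * P f (a i) x * (a (Suc i) x - a i x))
      + 2 * (\<Sum>i<N. a (Suc i) x * P f (a (Suc i)) x * (a (Suc i) x - a i x))
      - (\<Sum>i<N. P f (a (Suc i)) x * (a (Suc i) x - a i x)\<^sup>2)
      + 2 * f x * (\<Sum>i<N. P (a i) (a i) x * (a (Suc i) x - a i x))) has_integral 0) B"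
proof -
  have I: "((\<lambda>x. \<Sum>i<N. 2 * a i x * (a (Suc i) x - a i x) * P f (a i) x - (a i x)\<^sup>2 * (P f (a (Suc i)) x - P f (a i) x)
     + 2 * f x * (a (Suc i) x - a i x) * P (a i) (a i) x) has_integral (\<Sum>i<N. 0)) B"
    unfolding P_def
    by (intro has_integral_sum finite_lessThan weak_three_term[OF g _ _ _ _ cs f] a) auto
  have eq: "(\<Sum>i<N. 2 * a i x * (a (Suc i) x - a i x) * P f (a i) x - (a i x)\<^sup>2 * (P f (a (Suc i)) x - P f (a i) x)
     + 2 * f x * (a (Suc i) x - a i x) * P (a i) (a i) x)
    = 2 * (\<Sum>i<N. a i x * P f (a i) x * (a (Suc i) x - a i x))
      + 2 * (\<Sum>i<N. a (Suc i) x * P f (a (Suc i)) x * (a (Suc i) x - a i x))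
      - (\<Sum>i<N. P f (a (Suc i)) x * (a (Suc i) x - a i x)\<^sup>2)
      + 2 * f x * (\<Sum>i<N. P (a i) (a i) x * (a (Suc i) x - a i x))" if x: "x \<in> B" for x
  proof -
    define p where "p i = P f (a i) x" for i
    define q where "q i = a i x" for i
    have p0: "p 0 = 0" "p N = 0" using ends x by (auto simp: p_def P_def pair_def)
    have abel: "(\<Sum>i<M. (q i)\<^sup>2 * (p (Suc i) - p i)) = (q M)\<^sup>2 * p M - (q 0)\<^sup>2 * p 0
       - (\<Sum>i<M. ((q (Suc i))\<^sup>2 - (q i)\<^sup>2) * p (Suc i))" for M
      by (induction M) (auto simp: algebra_simps)
    have sq: "((q (Suc i))\<^sup>2 - (q i)\<^sup>2) * p (Suc i)
      = 2 * (q (Suc i) * p (Suc i) * (q (Suc i) - q i)) - p (Suc i) * (q (Suc i) - q i)\<^sup>2" for i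
      by (simp add: power2_eq_square algebra_simps)
    have "(\<Sum>i<N. (q i)\<^sup>2 * (p (Suc i) - p i)) = - (2 * (\<Sum>i<N. q (Suc i) * p (Suc i) * (q (Suc i) - q i))
        - (\<Sum>i<N. p (Suc i) * (q (Suc i) - q i)\<^sup>2))"
      unfolding abel sq using p0 by (simp add: sum_subtractf sum_distrib_left)
    moreover have "(\<Sum>i<N. 2 * q i * (q (Suc i) - q i) * p i - (q i)\<^sup>2 * (p (Suc i) - p i)
       + 2 * f x * (q (Suc i) - q i) * P (a i) (a i) x)
      = 2 * (\<Sum>i<N. q i * p i * (q (Suc i) - q i)) - (\<Sum>i<N. (q i)\<^sup>2 * (p (Suc i) - p i))
        + 2 * f x * (\<Sum>i<N. P (a i) (a i) x * (q (Suc i) - q i))"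
      unfolding sum.distrib sum_subtractf sum_distrib_left by (simp only: mult_ac)
    ultimately show ?thesis by (simp add: p_def q_def)
  qed
  show ?thesis by (rule has_integral_eq[OF eq]) (use I in simp_all)
qed

section \<open>Change of variables over an arbitrary finite index type\<close>

lemma has_integral_reindex:
  fixes r :: "'a::finite \<Rightarrow> 'b::finite" and f :: "real^'a \<Rightarrow> real"
  assumes r: "bij r" and S: "bounded S" and f: "(f has_integral i) S"
  shows "((\<lambda>y. f (\<chi> i. y $ r i)) has_integral i) ((\<lambda>x. \<chi> j. x $ inv r j) ` S)"
proof -
  define g where "g = (\<lambda>y::real^'b. (\<chi> i. y $ r i) :: real^'a)"
  define k where "k = (\<lambda>x::real^'a. (\<chi> j. x $ inv r j) :: real^'b)"
  have r1: "r (inv r j) = j" "inv r (r i) = i" for i j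
    using r by (simp_all add: bij_is_surj surj_f_inv_f bij_is_inj inv_f_f)
  have kg: "k (g x) = x" and gk: "g (k y) = y" for x y
    by (simp_all add: g_def k_def vec_eq_iff r1)
  have gimg: "g ` cbox u v = cbox (g u) (g v)" for u v
  proof
    show "g ` cbox u v \<subseteq> cbox (g u) (g v)" by (auto simp: g_def mem_box_cart)
    show "cbox (g u) (g v) \<subseteq> g ` cbox u v"
    proof
      fix x assume x: "x \<in> cbox (g u) (g v)"
      have "k x \<in> cbox u v"
        unfolding mem_box_cart
      proof
        fix j
        show "u $ j \<le> k x $ j \<and> k x $ j \<le> v $ j"
          using x[unfolded mem_box_cart, rule_format, of "inv r j"] by (simp add: g_def k_def r1)
      qed
      then show "x \<in> g ` cbox u v" using gk by (metis imageI)
    qed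
  qed
  have kimg: "k ` cbox u v = cbox (k u) (k v)" for u v
  proof -
    have "cbox (k u) (k v) = k ` (g ` cbox (k u) (k v))" by (simp add: image_image kg)
    also have "\<dots> = k ` cbox u v" unfolding gimg gk ..
    finally show ?thesis by simp
  qed
  have cont: "measure lborel (g ` cbox u v) = 1 * measure lborel (cbox u v)" for u v
  proof (cases "cbox u v = {}")
    case False
    then have "cbox (g u) (g v) \<noteq> {}" using gimg[of u v] by blast
    then have "measure lborel (cbox (g u) (g v)) = (\<Prod>i\<in>UNIV. v $ r i - u $ r i)"
      by (simp add: content_cbox_cart g_def)
    also have "\<dots> = (\<Prod>j\<in>UNIV. v $ j - u $ j)" by (rule prod.reindex_bij_betw[OF r])
    finally show ?thesis using False by (simp add: gimg content_cbox_cart)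
  qed simp
  obtain a b where ab: "S \<subseteq> cbox a b" using bounded_subset_cbox_symmetric[OF S] by metis
  have "((\<lambda>x. if x \<in> S then f x else 0) has_integral i) (cbox a b)"
    using f has_integral_restrict[OF ab, of f i] by simp
  then have "((\<lambda>y. if g y \<in> S then f (g y) else 0) has_integral (1 / 1) *\<^sub>R i) (k ` cbox a b)"
  proof (rule has_integral_twiddle[of 1 k g, rotated -1])
    show "continuous (at x) g" for x
      unfolding g_def
      by (intro linear_continuous_at linear_conv_bounded_linear[THEN iffD1] linearI) (auto simp: vec_eq_iff)
  qed (use kg gk gimg kimg cont in auto)
  moreover have "(\<lambda>y. if g y \<in> S then f (g y) else 0) = (\<lambda>y. if y \<in> k ` S then f (g y) else 0)"
    using kg gk by (metis image_iff)
  ultimately have "((\<lambda>y. if y \<in> k ` S then f (g y) else 0) has_integral i) (k ` cbox a b)" by simp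
  then have "((\<lambda>y. f (g y)) has_integral i) (k ` S)" unfolding has_integral_restrict[OF image_mono[OF ab]] .
  then show ?thesis unfolding g_def k_def .
qed

lemma absolutely_integrable_reindex:
  fixes r :: "'a::finite \<Rightarrow> 'b::finite" and f :: "real^'a \<Rightarrow> real"
  assumes r: "bij r" and S: "bounded S" and f: "f absolutely_integrable_on S"
  shows "(\<lambda>y. f (\<chi> i. y $ r i)) absolutely_integrable_on ((\<lambda>x. \<chi> j. x $ inv r j) ` S)"
    "integral ((\<lambda>x. \<chi> j. x $ inv r j) ` S) (\<lambda>y. f (\<chi> i. y $ r i)) = integral S f"
proof -
  have "(f has_integral integral S f) S" "((\<lambda>x. norm (f x)) has_integral integral S (\<lambda>x. norm (f x))) S"
    using f by (auto simp: absolutely_integrable_on_def integrable_integral)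
  from this[THEN has_integral_reindex[OF r S]]
  show "(\<lambda>y. f (\<chi> i. y $ r i)) absolutely_integrable_on ((\<lambda>x. \<chi> j. x $ inv r j) ` S)"
    "integral ((\<lambda>x. \<chi> j. x $ inv r j) ` S) (\<lambda>y. f (\<chi> i. y $ r i)) = integral S f"
    unfolding absolutely_integrable_on_def by (auto intro: has_integral_integrable integral_unique)
qed

text \<open>Conjugation by \<open>r\<close> matches the permutations of the two index types and preserves their signs.\<close>

lemma det_reindex:
  fixes A :: "real^'b::finite^'b" and r :: "'a::finite \<Rightarrow> 'b"
  assumes r: "bij r"
  shows "det (\<chi> i j. A $ r i $ r j) = det A"
proof -
  have r1: "r (inv r j) = j" "inv r (r i) = i" for i j
    using r by (simp_all add: bij_is_surj surj_f_inv_f bij_is_inj inv_f_f)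
  have mp: "map_permutation UNIV r p = r \<circ> p \<circ> inv r" for p
    using r by (auto simp: map_permutation_def restrict_id_def bij_def fun_eq_iff)
  have perm: "(r \<circ> p \<circ> inv r) permutes UNIV" if "p permutes UNIV" for p
    using that r by (auto simp: permutes_bij bij_comp bij_imp_bij_inv intro!: bij_imp_permutes)
  have perm': "(inv r \<circ> q \<circ> r) permutes UNIV" if "q permutes UNIV" for q
    using that r by (auto simp: permutes_bij bij_comp bij_imp_bij_inv intro!: bij_imp_permutes)
  have "(\<Sum>p\<in>{p. p permutes (UNIV :: 'a set)}. of_int (sign p) * (\<Prod>i\<in>UNIV. A $ r i $ r (p i)))
     = (\<Sum>q\<in>{q. q permutes (UNIV :: 'b set)}. of_int (sign q) * (\<Prod>j\<in>UNIV. A $ j $ q j))"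
  proof (rule sum.reindex_bij_witness[of _ "\<lambda>q. inv r \<circ> q \<circ> r" "\<lambda>p. r \<circ> p \<circ> inv r"])
    fix p :: "'a \<Rightarrow> 'a" assume p: "p \<in> {p. p permutes UNIV}"
    have "sign (map_permutation UNIV r p) = sign p"
      by (rule sign_map_permutation) (use p r in \<open>auto simp: bij_is_inj\<close>)
    moreover have "(\<Prod>i\<in>UNIV. A $ r i $ (r \<circ> p \<circ> inv r) (r i)) = (\<Prod>j\<in>UNIV. A $ j $ (r \<circ> p \<circ> inv r) j)"
      by (rule prod.reindex_bij_betw[OF r])
    ultimately show "of_int (sign (r \<circ> p \<circ> inv r)) * (\<Prod>j\<in>UNIV. A $ j $ (r \<circ> p \<circ> inv r) j)
       = of_int (sign p) * (\<Prod>i\<in>UNIV. A $ r i $ r (p i))"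
      by (simp add: mp r1)
  qed (use perm perm' in \<open>auto simp: fun_eq_iff r1\<close>)
  then show ?thesis by (simp add: det_def)
qed

text \<open>A copy of a finite index type with some well-order, because the change of variables formula is
  stated for well-ordered index types; all notions involved are invariant under renaming the indices.\<close>

typedef 'n wo = "UNIV :: 'n set" morphisms un_wo mk_wo by simp

definition wo_index :: "'n::finite \<Rightarrow> nat" where "wo_index = (SOME f. inj f)"

lemma inj_wo_index: "inj (wo_index :: 'n::finite \<Rightarrow> nat)"
proof -
  have "\<exists>f :: 'n \<Rightarrow> nat. inj f"
    using finite_imp_inj_to_nat_seg[of "UNIV :: 'n set"] by auto
  then show ?thesis unfolding wo_index_def by (rule someI_ex)
qed

instantiation wo :: (finite) wellorder
begin

definition "x \<le> y \<longleftrightarrow> wo_index (un_wo x) \<le> wo_index (un_wo y)"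
definition "x < y \<longleftrightarrow> wo_index (un_wo x) < wo_index (un_wo y)"

instance
proof
  fix x y z :: "'a wo" and P :: "'a wo \<Rightarrow> bool"
  show "x = y" if "x \<le> y" "y \<le> x"
    using that inj_wo_index unfolding less_eq_wo_def by (metis injD order_antisym un_wo_inject)
  show "P x" if "\<And>x. (\<And>y. y < x \<Longrightarrow> P y) \<Longrightarrow> P x"
    using that unfolding less_wo_def by (rule measure_induct_rule[of "\<lambda>x. wo_index (un_wo x)" P x])
qed (auto simp: less_eq_wo_def less_wo_def)

end

instance wo :: (finite) finite
proof
  have "(UNIV :: 'a wo set) = mk_wo ` UNIV" by (metis UNIV_eq_I rangeI un_wo_inverse)
  then show "finite (UNIV :: 'a wo set)" by (metis finite finite_imageI)
qed

lemma bij_mk_wo: "bij mk_wo" and inv_mk_wo: "inv mk_wo = un_wo" and bij_un_wo: "bij un_wo" and inv_un_wo: "inv un_wo = mk_wo"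
proof -
  show 1: "bij mk_wo" by (rule o_bij[of un_wo]) (auto simp: fun_eq_iff mk_wo_inverse un_wo_inverse)
  show "inv mk_wo = un_wo" by (rule inv_unique_comp) (auto simp: fun_eq_iff mk_wo_inverse un_wo_inverse)
  show "bij un_wo" by (rule o_bij[of mk_wo]) (auto simp: fun_eq_iff mk_wo_inverse un_wo_inverse)
  show "inv un_wo = mk_wo" by (rule inv_unique_comp) (auto simp: fun_eq_iff mk_wo_inverse un_wo_inverse)
qed

text \<open>Both sides are transported to the well-ordered copy of the index type.\<close>

theorem change_of_variables_cart:
  fixes f :: "real^'n::finite \<Rightarrow> real" and g :: "real^'n \<Rightarrow> real^'n"
  assumes S: "open S" "bounded S" "bounded (g ` S)"
    and g: "\<And>x. x \<in> S \<Longrightarrow> (g has_derivative g' x) (at x)" and inj: "inj_on g S"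
    and int: "(\<lambda>x. \<bar>det (matrix (g' x))\<bar> * f (g x)) absolutely_integrable_on S"
  shows "f absolutely_integrable_on (g ` S)"
    "integral (g ` S) f = integral S (\<lambda>x. \<bar>det (matrix (g' x))\<bar> * f (g x))"
proof -
  define F where "F = (\<lambda>x::real^'n. (\<chi> j. x $ un_wo j) :: real^'n wo)"
  define B where "B = (\<lambda>y::real^'n wo. (\<chi> i. y $ mk_wo i) :: real^'n)"
  have FB: "F (B y) = y" "B (F x) = x" for x y
    by (simp_all add: F_def B_def vec_eq_iff un_wo_inverse mk_wo_inverse)
  have linF: "bounded_linear F" and linB: "bounded_linear B"
    unfolding F_def B_def by (auto intro!: linear_conv_bounded_linear[THEN iffD1] linearI simp: vec_eq_iff)
  define D where "D = (\<lambda>x. \<bar>det (matrix (g' x))\<bar> * f (g x))"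
  define g1 where "g1 y = F (g (B y))" for y
  define g1' where "g1' y = (\<lambda>v. F (g' (B y) (B v)))" for y
  define lift where "lift = (vec :: real \<Rightarrow> real^1)"
  have linL: "bounded_linear lift"
    unfolding lift_def by (auto intro!: linear_conv_bounded_linear[THEN iffD1] linearI simp: vec_eq_iff)
  have openS: "open (F ` S)"
  proof -
    have "F ` S = B -` S" using FB by (metis (no_types, lifting) image_iff set_eq_iff vimage_eq)
    then show ?thesis
      using linB S(1) by (simp add: linear_continuous_on continuous_on_open_vimage open_vimage)
  qed
  have der: "(g1 has_derivative g1' y) (at y within F ` S)" if y: "y \<in> F ` S" for y
  proof -
    have BS: "B y \<in> S" using y FB by auto
    have "((\<lambda>y. g (B y)) has_derivative (\<lambda>v. g' (B y) (B v))) (at y)"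
      by (rule has_derivative_compose[OF bounded_linear_imp_has_derivative[OF linB] g[OF BS]])
    from has_derivative_compose[OF this bounded_linear_imp_has_derivative[OF linF]]
    show ?thesis unfolding g1_def g1'_def by (rule has_derivative_at_withinI)
  qed
  have inj1: "inj_on g1 (F ` S)"
    using inj FB unfolding g1_def inj_on_def by (metis (no_types, lifting) image_iff)
  have dt: "det (matrix (g1' y)) = det (matrix (g' (B y)))" for y
  proof -
    have Bax: "B (axis j 1) = axis (un_wo j) 1" for j
      by (auto simp: B_def axis_def vec_eq_iff mk_wo_inverse un_wo_inverse)
    have "matrix (g1' y) $ i $ j = matrix (g' (B y)) $ un_wo i $ un_wo j" for i j
      by (simp add: matrix_def g1'_def F_def Bax)
    then have "matrix (g1' y) = (\<chi> i j. matrix (g' (B y)) $ un_wo i $ un_wo j)"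
      by (simp add: vec_eq_iff)
    then show ?thesis using det_reindex[OF bij_un_wo, of "matrix (g' (B y))"] by simp
  qed
  have img: "g1 ` (F ` S) = F ` (g ` S)" by (simp add: g1_def image_image FB)
  have "(\<lambda>y. D (B y)) absolutely_integrable_on F ` S" and iD: "integral (F ` S) (\<lambda>y. D (B y)) = integral S D"
    using absolutely_integrable_reindex[OF bij_mk_wo S(2) int[folded D_def]] unfolding inv_mk_wo F_def B_def by auto
  then have "(\<lambda>y. lift (D (B y))) absolutely_integrable_on F ` S"
    using absolutely_integrable_linear[OF _ linL] by (auto simp: o_def)
  moreover have DB: "lift (D (B y)) = \<bar>det (matrix (g1' y))\<bar> *\<^sub>R lift (f (B (g1 y)))" for y
    by (simp add: D_def dt lift_def g1_def FB vec_eq_iff)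
  ultimately have A: "(\<lambda>y. lift (f (B y))) absolutely_integrable_on F ` (g ` S)"
     and I: "integral (F ` (g ` S)) (\<lambda>y. lift (f (B y))) = integral (F ` S) (\<lambda>y. lift (D (B y)))"
    using has_absolute_integral_change_of_variables[of "F ` S" g1 g1' "\<lambda>y. lift (f (B y))"
       "integral (F ` S) (\<lambda>y. lift (D (B y)))"] der inj1 openS img by (auto simp: lebesgue_openin)
  have drop: "bounded_linear (\<lambda>v::real^1. v $ 1)" by (rule bounded_linear_vec_nth)
  have fB: "(\<lambda>y. f (B y)) absolutely_integrable_on F ` (g ` S)"
    using absolutely_integrable_linear[OF A drop] by (simp add: o_def lift_def)
  have "integral (F ` (g ` S)) (\<lambda>y. f (B y)) = integral (F ` S) (\<lambda>y. D (B y))"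
  proof -
    have "integral (F ` (g ` S)) ((\<lambda>v. v $ 1) \<circ> (\<lambda>y. lift (f (B y)))) = integral (F ` (g ` S)) (\<lambda>y. lift (f (B y))) $ 1"
      by (rule integral_linear[OF _ drop]) (use A in \<open>simp add: absolutely_integrable_on_def\<close>)
    moreover have "integral (F ` S) ((\<lambda>v. v $ 1) \<circ> (\<lambda>y. lift (D (B y)))) = integral (F ` S) (\<lambda>y. lift (D (B y))) $ 1"
      by (rule integral_linear[OF _ drop])
        (use \<open>(\<lambda>y. lift (D (B y))) absolutely_integrable_on F ` S\<close> in \<open>simp add: absolutely_integrable_on_def\<close>)
    ultimately show ?thesis using I by (simp add: o_def lift_def)
  qed
  moreover have bF: "bounded (F ` (g ` S))" by (rule bounded_linear_image[OF S(3) linF])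
  have BF: "B ` (F ` (g ` S)) = g ` S" by (simp add: image_image FB)
  from absolutely_integrable_reindex[OF bij_un_wo bF fB, unfolded inv_un_wo]
  have "f absolutely_integrable_on (g ` S)" "integral (g ` S) f = integral (F ` (g ` S)) (\<lambda>y. f (B y))"
    unfolding B_def[symmetric] BF FB(2)[unfolded F_def] by auto
  ultimately show "f absolutely_integrable_on (g ` S)"
    "integral (g ` S) f = integral S (\<lambda>x. \<bar>det (matrix (g' x))\<bar> * f (g x))"
    using iD by (auto simp: D_def)
qed

section \<open>Riemann--Stieltjes sums\<close>

text \<open>The equidistant partition of \<open>[0, 1]\<close> into \<open>n + 1\<close> cells, so that there is no empty partition.\<close>

abbreviation (input) grid :: "nat \<Rightarrow> nat \<Rightarrow> real" where
  "grid n i \<equiv> real i / real (Suc n)"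

lemma grid_01: "i \<le> Suc n \<Longrightarrow> 0 \<le> grid n i \<and> grid n i \<le> 1"
  by (simp add: divide_simps)

lemma sum_increments: "(\<Sum>i<n. (y (Suc i) - y i)) = y n - (y 0 :: real)"
  by (rule sum_lessThan_telescope)

text \<open>A continuous surjection from a compact interval is a quotient map, so continuity descends from \<open>F\<close>
  to \<open>Fh\<close>.\<close>

lemma quotient_continuous:
  fixes A F Fh :: "real \<Rightarrow> real"
  assumes A: "continuous_on {0..1} A" "\<And>s t. 0 \<le> s \<Longrightarrow> s \<le> t \<Longrightarrow> t \<le> 1 \<Longrightarrow> A s \<le> A t"
    and F: "continuous_on {0..1} F" "\<And>s. s \<in> {0..1} \<Longrightarrow> F s = Fh (A s)"
  shows "A ` {0..1} = {A 0..A 1}" "continuous_on {A 0..A 1} Fh"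
proof -
  show img: "A ` {0..1} = {A 0..A 1}"
  proof
    show "A ` {0..1} \<subseteq> {A 0..A 1}" using A(2) by auto
    show "{A 0..A 1} \<subseteq> A ` {0..1}" using IVT'[of A 0 _ 1] A(1) by (force simp: image_iff)
  qed
  show "continuous_on {A 0..A 1} Fh"
  proof (rule continuous_on_closed_vimage[THEN iffD2, rule_format])
    fix B :: "real set" assume "closed B"
    then have "compact (F -` B \<inter> {0..1})"
      using continuous_on_closed_vimage[of "{0..1}" F] F(1) by (simp add: compact_eq_bounded_closed bounded_Int)
    then have "closed (A ` (F -` B \<inter> {0..1}))"
      by (intro compact_imp_closed compact_continuous_image continuous_on_subset[OF A(1)]) auto
    moreover have "A ` (F -` B \<inter> {0..1}) = Fh -` B \<inter> A ` {0..1}" using F(2) by force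
    ultimately show "closed (Fh -` B \<inter> {A 0..A 1})" by (simp add: img)
  qed simp
qed

text \<open>Here \<open>y\<close> is a partition and \<open>tg\<close> a choice of tags; the error is estimated cell by cell.\<close>

lemma tagged_sum_error:
  fixes y tg :: "nat \<Rightarrow> real" and Fh :: "real \<Rightarrow> real"
  assumes y: "\<And>i. i < n \<Longrightarrow> y i \<le> tg i \<and> tg i \<le> y (Suc i)"
    and Fh: "continuous_on {y 0..y n} Fh"
    and e: "\<And>i u. i < n \<Longrightarrow> y i \<le> u \<Longrightarrow> u \<le> y (Suc i) \<Longrightarrow> \<bar>Fh (tg i) - Fh u\<bar> \<le> e"
  shows "\<bar>(\<Sum>i<n. Fh (tg i) * (y (Suc i) - y i)) - integral {y 0..y n} Fh\<bar> \<le> e * (y n - y 0) \<and> y 0 \<le> y n"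
  using assms
proof (induction n)
  case 0
  then show ?case by simp
next
  case (Suc n)
  have le: "y n \<le> y (Suc n)" using Suc.prems(1)[of n] by simp
  have mono0: "y 0 \<le> y m" if "m \<le> n" for m
    using that
  proof (induction m)
    case (Suc m)
    then show ?case using Suc.prems Suc(2) \<open>\<And>i. i < Suc n \<Longrightarrow> y i \<le> tg i \<and> tg i \<le> y (Suc i)\<close>[of m] by simp
  qed simp
  have IH: "\<bar>(\<Sum>i<n. Fh (tg i) * (y (Suc i) - y i)) - integral {y 0..y n} Fh\<bar> \<le> e * (y n - y 0) \<and> y 0 \<le> y n"
    by (rule Suc.IH) (use Suc.prems le mono0[of n] in \<open>auto intro: continuous_on_subset\<close>)
  have c: "continuous_on {y n..y (Suc n)} Fh" by (rule continuous_on_subset[OF Suc.prems(2)]) (use IH in auto)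
  have comb: "integral {y 0..y n} Fh + integral {y n..y (Suc n)} Fh = integral {y 0..y (Suc n)} Fh"
    by (rule Henstock_Kurzweil_Integration.integral_combine) (use IH le Suc.prems(2) integrable_continuous_interval in auto)
  have "Fh (tg n) * (y (Suc n) - y n) - integral {y n..y (Suc n)} Fh = integral {y n..y (Suc n)} (\<lambda>u. Fh (tg n) - Fh u)"
    using le c by (simp add: integral_diff integrable_continuous_interval)
  moreover have "norm (integral {y n..y (Suc n)} (\<lambda>u. Fh (tg n) - Fh u)) \<le> e * (y (Suc n) - y n)"
    by (rule integral_bound[OF le]) (use c Suc.prems(3)[of n] in \<open>auto intro!: continuous_intros\<close>)
  ultimately have "\<bar>Fh (tg n) * (y (Suc n) - y n) - integral {y n..y (Suc n)} Fh\<bar> \<le> e * (y (Suc n) - y n)" by simp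
  moreover have "(\<Sum>i<Suc n. Fh (tg i) * (y (Suc i) - y i))
      = (\<Sum>i<n. Fh (tg i) * (y (Suc i) - y i)) + Fh (tg n) * (y (Suc n) - y n)" by simp
  moreover have "e * (y (Suc n) - y 0) = e * (y (Suc n) - y n) + e * (y n - y 0)"
    by (simp add: right_diff_distrib)
  ultimately show ?case using IH le comb by linarith
qed

lemma mesh_to_zero:
  fixes A :: "real \<Rightarrow> real"
  assumes A: "continuous_on {0..1} A" and d: "d > 0"
  shows "\<forall>\<^sub>F n in sequentially. \<forall>i<Suc n. \<bar>A (grid n (Suc i)) - A (grid n i)\<bar> < d"
proof -
  have "uniformly_continuous_on {0..1} A" by (rule compact_uniformly_continuous[OF A]) simp
  then obtain e where e: "e > 0" "\<And>s t. s \<in> {0..1} \<Longrightarrow> t \<in> {0..1} \<Longrightarrow> dist t s < e \<Longrightarrow> dist (A t) (A s) < d"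
    unfolding uniformly_continuous_on_def using d by metis
  obtain N where N: "1 / real (Suc N) < e" using e(1) nat_approx_posE by blast
  show ?thesis
    unfolding eventually_sequentially
  proof (intro exI[of _ N] allI impI)
    fix n i assume n: "N \<le> n" and i: "i < Suc n"
    have "1 / real (Suc n) \<le> 1 / real (Suc N)" using n by (simp add: frac_le)
    moreover have "grid n (Suc i) - grid n i = 1 / real (Suc n)" by (simp add: field_simps)
    ultimately have "dist (grid n (Suc i)) (grid n i) < e" using N by (simp add: dist_real_def)
    then show "\<bar>A (grid n (Suc i)) - A (grid n i)\<bar> < d"
      using e(2)[of "grid n i" "grid n (Suc i)"] grid_01[of i n] grid_01[of "Suc i" n] i by (simp add: dist_real_def del: of_nat_Suc)
  qed
qed

text \<open>The Stieltjes integral \<open>\<integral> F dA\<close> becomes an ordinary integral after the substitution \<open>u = A s\<close>,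
  since \<open>F\<close> is a function of \<open>A s\<close>. Tags at either end of the cells are allowed because summation
  by parts produces both.\<close>

lemma stieltjes_sum_limit:
  fixes A F Fh :: "real \<Rightarrow> real"
  assumes A: "continuous_on {0..1} A" "\<And>s t. 0 \<le> s \<Longrightarrow> s \<le> t \<Longrightarrow> t \<le> 1 \<Longrightarrow> A s \<le> A t"
    and F: "continuous_on {0..1} F" "\<And>s. s \<in> {0..1} \<Longrightarrow> F s = Fh (A s)"
    and tg: "\<And>n i. tg n i = i \<or> tg n i = Suc i"
  shows "(\<lambda>n. \<Sum>i<Suc n. F (grid n (tg n i)) * (A (grid n (Suc i)) - A (grid n i)))
     \<longlonglongrightarrow> integral {A 0..A 1} Fh"
proof (rule LIMSEQ_I)
  fix e :: real assume e: "e > 0"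
  have A01: "A 0 \<le> A 1" by (rule A(2)) auto
  define e' where "e' = e / (2 * (A 1 - A 0 + 1))"
  have e': "e' > 0" "e' * (A 1 - A 0) < e"
  proof -
    have "A 1 - A 0 + 1 > 0" using A01 by simp
    then show "e' > 0" "e' * (A 1 - A 0) < e"
      using e A01 by (simp_all add: e'_def pos_divide_less_eq)
  qed
  note Q = quotient_continuous[OF A F]
  have "uniformly_continuous_on {A 0..A 1} Fh" by (rule compact_uniformly_continuous[OF Q(2) compact_Icc])
  then obtain d where d: "d > 0" "\<And>u v. u \<in> {A 0..A 1} \<Longrightarrow> v \<in> {A 0..A 1} \<Longrightarrow> dist v u < d \<Longrightarrow> dist (Fh v) (Fh u) < e'"
    unfolding uniformly_continuous_on_def using e'(1) by metis
  obtain N where N: "\<And>n i. n \<ge> N \<Longrightarrow> i < Suc n \<Longrightarrow> \<bar>A (grid n (Suc i)) - A (grid n i)\<bar> < d"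
    using mesh_to_zero[OF A(1) d(1)] unfolding eventually_sequentially by blast
  show "\<exists>no. \<forall>n\<ge>no. norm ((\<Sum>i<Suc n. F (grid n (tg n i)) * (A (grid n (Suc i)) - A (grid n i))) - integral {A 0..A 1} Fh) < e"
  proof (intro exI[of _ N] allI impI)
    fix n assume n: "n \<ge> N"
    define y where "y i = A (grid n i)" for i
    have gm: "y i \<le> y j" if "i \<le> j" "j \<le> Suc n" for i j
      unfolding y_def using that grid_01[of i n] grid_01[of j n] by (intro A(2)) (auto simp: divide_simps)
    have yr: "y i \<in> {A 0..A 1}" if "i \<le> Suc n" for i
      using Q(1) grid_01[OF that] unfolding y_def by (metis atLeastAtMost_iff imageI)
    have tle: "y i \<le> y (tg n i) \<and> y (tg n i) \<le> y (Suc i)" if "i < Suc n" for i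
      using tg[of n i] gm[of i "Suc i"] that by auto
    have ends: "y 0 = A 0" "y (Suc n) = A 1" by (simp_all add: y_def)
    have "\<bar>(\<Sum>i<Suc n. Fh (y (tg n i)) * (y (Suc i) - y i)) - integral {y 0..y (Suc n)} Fh\<bar> \<le> e' * (y (Suc n) - y 0) \<and> y 0 \<le> y (Suc n)"
    proof (rule tagged_sum_error)
      show "continuous_on {y 0..y (Suc n)} Fh" using Q(2) by (simp add: ends)
      fix i u assume i: "i < Suc n" and u: "y i \<le> u" "u \<le> y (Suc i)"
      have r: "y i \<in> {A 0..A 1}" "y (Suc i) \<in> {A 0..A 1}" using yr i by auto
      have "dist (y (tg n i)) u < d" using tle[OF i] u N[OF n i] by (auto simp: dist_real_def y_def)
      then have "dist (Fh (y (tg n i))) (Fh u) < e'" using tle[OF i] u r by (intro d(2)) auto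
      then show "\<bar>Fh (y (tg n i)) - Fh u\<bar> \<le> e'" by (simp add: dist_real_def)
    qed (use tle in auto)
    moreover have "F (grid n (tg n i)) = Fh (y (tg n i))" if "i < Suc n" for i
      using F(2)[of "grid n (tg n i)"] grid_01[of "tg n i" n] tg[of n i] that unfolding y_def by auto
    ultimately have "\<bar>(\<Sum>i<Suc n. F (grid n (tg n i)) * (A (grid n (Suc i)) - A (grid n i))) - integral {A 0..A 1} Fh\<bar> \<le> e' * (A 1 - A 0)"
      unfolding ends y_def[symmetric] by simp
    then show "norm ((\<Sum>i<Suc n. F (grid n (tg n i)) * (A (grid n (Suc i)) - A (grid n i))) - integral {A 0..A 1} Fh) < e"
      using e'(2) by simp
  qed
qed

lemma stieltjes_sum_bound:
  fixes A F :: "real \<Rightarrow> real"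
  assumes A: "\<And>s t. 0 \<le> s \<Longrightarrow> s \<le> t \<Longrightarrow> t \<le> 1 \<Longrightarrow> A s \<le> A t"
    and M: "\<And>s. s \<in> {0..1} \<Longrightarrow> \<bar>F s\<bar> \<le> M" and tg: "\<And>i. tg i = i \<or> tg i = Suc i"
    and D: "\<And>i. i < Suc n \<Longrightarrow> A (grid n (Suc i)) - A (grid n i) \<le> D"
  shows "\<bar>\<Sum>i<Suc n. F (grid n (tg i)) * (A (grid n (Suc i)) - A (grid n i))\<bar> \<le> M * (A 1 - A 0)"
    "\<bar>\<Sum>i<Suc n. F (grid n (tg i)) * (A (grid n (Suc i)) - A (grid n i))\<^sup>2\<bar> \<le> M * D * (A 1 - A 0)"
proof -
  define y where "y i = A (grid n i)" for i
  have tel: "(\<Sum>i<Suc n. (y (Suc i) - y i)) = A 1 - A 0"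
    unfolding sum_increments by (simp add: y_def)
  have dy: "0 \<le> y (Suc i) - y i" if "i < Suc n" for i
    using A[of "grid n i" "grid n (Suc i)"] grid_01[of i n] grid_01[of "Suc i" n] that
    by (simp add: y_def divide_right_mono del: of_nat_Suc)
  have FM: "\<bar>F (grid n (tg i))\<bar> \<le> M" if "i < Suc n" for i
    using tg[of i] that grid_01[of "tg i" n] by (intro M) auto
  have M0: "0 \<le> M" using FM[of 0] by simp
  have "\<bar>\<Sum>i<Suc n. F (grid n (tg i)) * (y (Suc i) - y i)\<bar> \<le> (\<Sum>i<Suc n. M * (y (Suc i) - y i))"
    by (rule order_trans[OF sum_abs sum_mono]) (use FM dy M0 in \<open>auto simp: abs_mult intro!: mult_mono\<close>)
  also have "\<dots> = M * (A 1 - A 0)" by (simp only: sum_distrib_left[symmetric] tel)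
  finally show "\<bar>\<Sum>i<Suc n. F (grid n (tg i)) * (A (grid n (Suc i)) - A (grid n i))\<bar> \<le> M * (A 1 - A 0)"
    by (simp only: y_def)
  have sq: "\<bar>F (grid n (tg i)) * (y (Suc i) - y i)\<^sup>2\<bar> \<le> M * D * (y (Suc i) - y i)" if i: "i < Suc n" for i
  proof -
    have "(y (Suc i) - y i)\<^sup>2 \<le> D * (y (Suc i) - y i)"
      using dy[OF i] D[OF i] unfolding power2_eq_square y_def by (rule mult_right_mono[rotated])
    then have "\<bar>F (grid n (tg i))\<bar> * (y (Suc i) - y i)\<^sup>2 \<le> M * (D * (y (Suc i) - y i))"
      using FM[OF i] M0 by (intro mult_mono) auto
    then show ?thesis by (simp add: abs_mult mult.assoc)
  qed
  have "\<bar>\<Sum>i<Suc n. F (grid n (tg i)) * (y (Suc i) - y i)\<^sup>2\<bar> \<le> (\<Sum>i<Suc n. M * D * (y (Suc i) - y i))"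
    by (rule order_trans[OF sum_abs sum_mono]) (use sq in auto)
  also have "\<dots> = M * D * (A 1 - A 0)" by (simp only: sum_distrib_left[symmetric] tel)
  finally show "\<bar>\<Sum>i<Suc n. F (grid n (tg i)) * (A (grid n (Suc i)) - A (grid n i))\<^sup>2\<bar> \<le> M * D * (A 1 - A 0)"
    by (simp only: y_def)
qed

lemma stieltjes_square_limit:
  fixes A F :: "real \<Rightarrow> real"
  assumes A: "continuous_on {0..1} A" "\<And>s t. 0 \<le> s \<Longrightarrow> s \<le> t \<Longrightarrow> t \<le> 1 \<Longrightarrow> A s \<le> A t"
    and F: "continuous_on {0..1} F"
  shows "(\<lambda>n. \<Sum>i<Suc n. F (grid n (Suc i)) * (A (grid n (Suc i)) - A (grid n i))\<^sup>2) \<longlonglongrightarrow> 0"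
proof (rule LIMSEQ_I)
  fix e :: real assume e: "e > 0"
  have "bounded (F ` {0..1})" by (intro compact_imp_bounded compact_continuous_image F) simp
  then obtain M where M: "M > 0" "\<And>s. s \<in> {0..1} \<Longrightarrow> \<bar>F s\<bar> \<le> M" unfolding bounded_pos by auto
  have A01: "A 0 \<le> A 1" by (rule A(2)) auto
  define d where "d = e / (2 * M * (A 1 - A 0 + 1))"
  have d: "d > 0" using e A01 M by (auto simp: d_def intro!: divide_pos_pos mult_pos_pos)
  have Md: "M * d * (A 1 - A 0) < e"
  proof -
    have "A 1 - A 0 + 1 \<noteq> 0" using A01 by simp
    then have "M * d * (A 1 - A 0 + 1) = e / 2" using M(1) unfolding d_def by (simp add: divide_simps)
    moreover have "M * d * (A 1 - A 0) \<le> M * d * (A 1 - A 0 + 1)" using M d by simp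
    ultimately show ?thesis using e by linarith
  qed
  obtain N where N: "\<And>n i. n \<ge> N \<Longrightarrow> i < Suc n \<Longrightarrow> \<bar>A (grid n (Suc i)) - A (grid n i)\<bar> < d"
    using mesh_to_zero[OF A(1) d] unfolding eventually_sequentially by blast
  show "\<exists>no. \<forall>n\<ge>no. norm ((\<Sum>i<Suc n. F (grid n (Suc i)) * (A (grid n (Suc i)) - A (grid n i))\<^sup>2) - 0) < e"
  proof (intro exI[of _ N] allI impI)
    fix n assume n: "n \<ge> N"
    have "\<bar>\<Sum>i<Suc n. F (grid n (Suc i)) * (A (grid n (Suc i)) - A (grid n i))\<^sup>2\<bar> \<le> M * d * (A 1 - A 0)"
      by (rule stieltjes_sum_bound(2)[where tg = Suc]) (use A(2) M N[OF n] in \<open>auto simp: abs_less_iff intro: less_imp_le\<close>)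
    then show "norm ((\<Sum>i<Suc n. F (grid n (Suc i)) * (A (grid n (Suc i)) - A (grid n i))\<^sup>2) - 0) < e"
      using Md by simp
  qed
qed

section \<open>Horizontal sections and boxes over whole fibres\<close>

definition cinv :: "('k, 'n::finite) chart \<Rightarrow> real^'n \<Rightarrow> 'k" where
  "cinv c = inv_into (fst c) (snd c)"

lemma continuous_on_local:
  assumes "\<And>x. x \<in> S \<Longrightarrow> \<exists>T. open T \<and> x \<in> T \<and> continuous_on (S \<inter> T) f"
  shows "continuous_on S f"
  unfolding continuous_on_def
proof
  fix x assume x: "x \<in> S"
  then obtain T where T: "open T" "x \<in> T" "continuous_on (S \<inter> T) f" using assms by blast
  then have "(f \<longlongrightarrow> f x) (at x within S \<inter> T)" using x by (simp add: continuous_on_def)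
  moreover have "at x within S \<inter> T = at x within S"
    by (rule at_within_nhd[OF T(2,1)]) auto
  ultimately show "(f \<longlongrightarrow> f x) (at x within S)" by simp
qed

lemma connected_locally_const:
  assumes "connected (UNIV :: 'a::topological_space set)"
    and "\<And>y. \<exists>U. open U \<and> y \<in> U \<and> (\<forall>y'\<in>U. P y' = P y)"
  shows "P a = P (b::'a)"
proof (rule connected_local_const[OF assms(1)])
  show "\<forall>a\<in>UNIV. \<forall>\<^sub>F b in at a. P a = P b"
    using assms(2) unfolding eventually_at_topological by metis
qed auto

locale foliation_setting =
  fixes \<A> :: "('k::t2_space, 'n::finite) chart set" and \<L> :: "('k \<times> real) set set"
  assumes mfd: "closed_C2_manifold \<A>" and fol: "transverse_foliation \<A> \<L>"
begin

lemma chart_facts: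
  assumes "c \<in> \<A>"
  shows "open (fst c)" "open (snd c ` fst c)" "continuous_on (fst c) (snd c)"
    "continuous_on (snd c ` fst c) (cinv c)"
    "\<And>y. y \<in> fst c \<Longrightarrow> cinv c (snd c y) = y"
    "\<And>x. x \<in> snd c ` fst c \<Longrightarrow> snd c (cinv c x) = x"
    "\<And>x. x \<in> snd c ` fst c \<Longrightarrow> cinv c x \<in> fst c"
proof -
  have "topological_chart c" using mfd assms by (simp add: closed_C2_manifold_def)
  then have *: "open (fst c)" "open (snd c ` fst c)" "homeomorphism (fst c) (snd c ` fst c) (snd c) (cinv c)"
    unfolding topological_chart_def cinv_def by (auto simp: case_prod_unfold)
  then show "open (fst c)" "open (snd c ` fst c)" "continuous_on (fst c) (snd c)"
    "continuous_on (snd c ` fst c) (cinv c)"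
    "\<And>y. y \<in> fst c \<Longrightarrow> cinv c (snd c y) = y"
    "\<And>x. x \<in> snd c ` fst c \<Longrightarrow> snd c (cinv c x) = x"
    by (auto simp: homeomorphism_def)
  show "\<And>x. x \<in> snd c ` fst c \<Longrightarrow> cinv c x \<in> fst c"
    using *(3) by (auto simp: homeomorphism_def)
qed

lemma chart_cover: "\<exists>c\<in>\<A>. y \<in> fst c"
  using mfd unfolding closed_C2_manifold_def by blast

lemma cinv_image:
  assumes c: "c \<in> \<A>" and T: "T \<subseteq> snd c ` fst c"
  shows "y \<in> cinv c ` T \<longleftrightarrow> y \<in> fst c \<and> snd c y \<in> T"
    "open T \<Longrightarrow> open (cinv c ` T)" "path_connected T \<Longrightarrow> path_connected (cinv c ` T)"
proof -
  note f = chart_facts[OF c]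
  show iff: "y \<in> cinv c ` T \<longleftrightarrow> y \<in> fst c \<and> snd c y \<in> T" for y
  proof
    assume "y \<in> cinv c ` T"
    then obtain x where x: "x \<in> T" "y = cinv c x" by blast
    then have "x \<in> snd c ` fst c" using T by blast
    then show "y \<in> fst c \<and> snd c y \<in> T" using f(6,7)[of x] x by simp
  next
    assume y: "y \<in> fst c \<and> snd c y \<in> T"
    then have "y = cinv c (snd c y)" using f(5) by simp
    then show "y \<in> cinv c ` T" using y by blast
  qed
  have "cinv c ` T = fst c \<inter> snd c -` T" using iff by auto
  then show "open T \<Longrightarrow> open (cinv c ` T)"
    using continuous_open_preimage[OF f(3,1)] by simp
  show "path_connected T \<Longrightarrow> path_connected (cinv c ` T)"
    by (rule path_connected_continuous_image[OF continuous_on_subset[OF f(4) T]])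
qed

lemma small_ball:
  assumes c: "c \<in> \<A>" and y: "y \<in> fst c" "y \<in> U" "open U"
  shows "\<exists>r>0. cball (snd c y) r \<subseteq> snd c ` fst c \<and> cinv c ` cball (snd c y) r \<subseteq> U"
proof -
  note f = chart_facts[OF c]
  have "open (snd c ` fst c \<inter> cinv c -` U)" by (rule continuous_open_preimage[OF f(4,2) y(3)])
  moreover have "snd c y \<in> snd c ` fst c \<inter> cinv c -` U" using y f(5) by auto
  ultimately obtain r where "r > 0" "cball (snd c y) r \<subseteq> snd c ` fst c \<inter> cinv c -` U"
    using open_contains_cball by blast
  then show ?thesis by (intro exI[of _ r]) auto
qed

lemma small_path_connected:
  fixes y :: 'k
  assumes "y \<in> U" "open U"
  shows "\<exists>V. open V \<and> y \<in> V \<and> V \<subseteq> U \<and> path_connected V"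
proof -
  obtain c where c: "c \<in> \<A>" "y \<in> fst c" using chart_cover by blast
  from small_ball[OF c assms] obtain r where r: "r > 0" "cball (snd c y) r \<subseteq> snd c ` fst c"
    "cinv c ` cball (snd c y) r \<subseteq> U" by blast
  have sub: "ball (snd c y) r \<subseteq> snd c ` fst c" using r by force
  have "y \<in> cinv c ` ball (snd c y) r" using cinv_image(1)[OF c(1) sub] c r by simp
  moreover have "cinv c ` ball (snd c y) r \<subseteq> U" using r(3) by force
  moreover have "open (cinv c ` ball (snd c y) r)" "path_connected (cinv c ` ball (snd c y) r)"
    by (rule cinv_image(2,3)[OF c(1) sub], simp add: convex_imp_path_connected)+
  ultimately show ?thesis by (intro exI[of _ "cinv c ` ball (snd c y) r"] conjI)
qed

text \<open>The graph of a horizontal function lies in one leaf. Plaques are graphs of horizontal functions,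
  and so is every leaf that is a section of the projection.\<close>

definition horizontal :: "'k set \<Rightarrow> ('k \<Rightarrow> real) \<Rightarrow> bool" where
  "horizontal U f \<longleftrightarrow> continuous_on U f \<and> f ` U \<subseteq> {0..1} \<and> (\<exists>L\<in>\<L>. \<forall>y\<in>U. (y, f y) \<in> L)"

lemma horizontal_subset: "horizontal U f \<Longrightarrow> V \<subseteq> U \<Longrightarrow> horizontal V f"
  unfolding horizontal_def by (auto intro: continuous_on_subset)

lemma horizontal_range: "horizontal U f \<Longrightarrow> y \<in> U \<Longrightarrow> 0 \<le> f y \<and> f y \<le> 1"
  unfolding horizontal_def by force

lemma leaf_unique: "L \<in> \<L> \<Longrightarrow> L' \<in> \<L> \<Longrightarrow> z \<in> L \<Longrightarrow> z \<in> L' \<Longrightarrow> L = L'"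
  using fol unfolding transverse_foliation_def partition_on_def disjoint_def by blast

lemma leaf_exists: "z \<in> total_space \<Longrightarrow> \<exists>L\<in>\<L>. z \<in> L"
  using fol unfolding transverse_foliation_def partition_on_def by blast

lemma leaf_total: "L \<in> \<L> \<Longrightarrow> L \<subseteq> total_space"
  using fol unfolding transverse_foliation_def partition_on_def by blast

lemma adapted_exists:
  assumes "z \<in> total_space"
  obtains c W V J \<psi> \<theta> where "adapted_chart \<A> \<L> c W V J \<psi> \<theta>" "z \<in> W"
  using fol assms unfolding transverse_foliation_def by blast

lemma adapted_facts:
  assumes "adapted_chart \<A> \<L> c W V J \<psi> \<theta>"
  shows "c \<in> \<A>" "W \<subseteq> total_space" "\<exists>O'. open O' \<and> W = total_space \<inter> O'"
    "continuous_on W \<psi>" "continuous_on (V \<times> J) \<theta>"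
    "\<And>z. z \<in> W \<Longrightarrow> fst z \<in> fst c" "\<And>z. z \<in> W \<Longrightarrow> snd c (fst z) \<in> V"
    "\<And>z. z \<in> W \<Longrightarrow> snd (\<psi> z) \<in> J" "\<And>z. z \<in> W \<Longrightarrow> \<theta> (snd c (fst z), snd (\<psi> z)) = z"
    "\<And>x s. x \<in> V \<Longrightarrow> s \<in> J \<Longrightarrow> \<theta> (x, s) \<in> W" "\<And>x s. x \<in> V \<Longrightarrow> s \<in> J \<Longrightarrow> snd (\<psi> (\<theta> (x, s))) = s"
    "\<And>x s. x \<in> V \<Longrightarrow> s \<in> J \<Longrightarrow> snd c (fst (\<theta> (x, s))) = x"
proof -
  have F: "foliation_chart \<L> W V J \<psi> \<theta>" and *: "c \<in> \<A>" "fst ` W \<subseteq> fst c" "\<And>z. z \<in> W \<Longrightarrow> fst (\<psi> z) = snd c (fst z)"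
    using assms by (auto simp: adapted_chart_def)
  have o: "openin (top_of_set total_space) W" and h: "homeomorphism W (V \<times> J) \<psi> \<theta>"
    using F by (auto simp: foliation_chart_def)
  show "c \<in> \<A>" by fact
  show "W \<subseteq> total_space" "\<exists>O'. open O' \<and> W = total_space \<inter> O'" using o by (auto simp: openin_open)
  show "continuous_on W \<psi>" "continuous_on (V \<times> J) \<theta>" using h by (auto simp: homeomorphism_def)
  show "fst z \<in> fst c" if "z \<in> W" for z using that *(2) by auto
  have pz: "\<psi> z \<in> V \<times> J" "\<theta> (\<psi> z) = z" if "z \<in> W" for z using that h by (auto simp: homeomorphism_def)
  show "snd c (fst z) \<in> V" "snd (\<psi> z) \<in> J" if "z \<in> W" for z
    using pz(1)[OF that] *(3)[OF that] by (auto simp: mem_Times_iff)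
  show "\<theta> (snd c (fst z), snd (\<psi> z)) = z" if "z \<in> W" for z
    using pz(2)[OF that] by (simp only: *(3)[OF that, symmetric] prod.collapse)
  have tz: "\<theta> (x, s) \<in> W" "\<psi> (\<theta> (x, s)) = (x, s)" if "x \<in> V" "s \<in> J" for x s
    using that h by (auto simp: homeomorphism_def)
  then show "\<theta> (x, s) \<in> W" "snd (\<psi> (\<theta> (x, s))) = s" if "x \<in> V" "s \<in> J" for x s using that by auto
  show "snd c (fst (\<theta> (x, s))) = x" if "x \<in> V" "s \<in> J" for x s
    using *(3)[OF tz(1)[OF that]] tz(2)[OF that] by simp
qed

lemma same_plaque_same_leaf:
  assumes a: "adapted_chart \<A> \<L> c W V J \<psi> \<theta>" and L: "L \<in> \<L>" "z \<in> L"
    and zw: "z \<in> W" "w \<in> W" "snd (\<psi> w) = snd (\<psi> z)"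
  shows "w \<in> L"
proof -
  have "path_component_set (L \<inter> W) z = {w \<in> W. snd (\<psi> w) = snd (\<psi> z)}"
    using a L zw by (auto simp: adapted_chart_def foliation_chart_def)
  then have "w \<in> path_component_set (L \<inter> W) z" using zw by simp
  then show ?thesis using path_component_subset[of "L \<inter> W" z] by blast
qed

lemma path_connected_same_plaque:
  assumes a: "adapted_chart \<A> \<L> c W V J \<psi> \<theta>" and L: "L \<in> \<L>"
    and S: "path_connected S" "S \<subseteq> L" "S \<subseteq> W" "z \<in> S" "w \<in> S"
  shows "snd (\<psi> w) = snd (\<psi> z)"
proof -
  have "path_component (L \<inter> W) z w"
    using S path_component_of_subset[of S "L \<inter> W" z w] unfolding path_connected_component by blast
  moreover have "path_component_set (L \<inter> W) z = {w \<in> W. snd (\<psi> w) = snd (\<psi> z)}"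
    using a L S unfolding adapted_chart_def foliation_chart_def by blast
  ultimately have "w \<in> {w \<in> W. snd (\<psi> w) = snd (\<psi> z)}" by (metis mem_Collect_eq)
  then show ?thesis by simp
qed

text \<open>A path in a leaf, continuous for the subspace topology only, cannot jump between plaques: the plaques
  are path components of the trace of the leaf on the chart.\<close>

lemma path_leaf_local:
  assumes a: "adapted_chart \<A> \<L> c W V J \<psi> \<theta>" and L: "L \<in> \<L>"
    and g: "continuous_on {0..1::real} g" "g ` {0..1} \<subseteq> L" and t: "t \<in> {0..1}" "g t \<in> W"
  shows "\<forall>\<^sub>F t' in at t within {0..1}. g t' \<in> W \<and> snd (\<psi> (g t')) = snd (\<psi> (g t))"
proof -
  obtain O' where O': "open O'" "W = total_space \<inter> O'" using adapted_facts(3)[OF a] by blast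
  have "(g \<longlongrightarrow> g t) (at t within {0..1})" using g(1) t(1) by (simp add: continuous_on)
  then have "\<forall>\<^sub>F t' in at t within {0..1}. g t' \<in> O'"
    using O' t(2) topological_tendstoD by blast
  then obtain d where d: "d > 0" "\<And>t'. t' \<in> {0..1} \<Longrightarrow> t' \<noteq> t \<Longrightarrow> dist t' t < d \<Longrightarrow> g t' \<in> O'"
    unfolding eventually_at by blast
  let ?S = "{0..1} \<inter> ball t d"
  have "path_connected ?S" by (intro convex_imp_path_connected convex_Int) auto
  then have pc: "path_connected (g ` ?S)"
    by (rule path_connected_continuous_image[OF continuous_on_subset[OF g(1)], rotated]) auto
  have sL: "g ` ?S \<subseteq> L" using g(2) by auto
  have sW: "g ` ?S \<subseteq> W"
  proof
    fix z assume "z \<in> g ` ?S"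
    then obtain t' where t': "t' \<in> {0..1}" "dist t' t < d" "z = g t'" by (auto simp: dist_commute)
    have "z \<in> L" using t' g(2) by blast
    then have "z \<in> total_space" using leaf_total[OF L] by blast
    moreover have "z \<in> O'" using d(2)[of t'] t' t(2) O'(2) by (cases "t' = t") auto
    ultimately show "z \<in> W" using O' by blast
  qed
  have "g t' \<in> W \<and> snd (\<psi> (g t')) = snd (\<psi> (g t))" if "t' \<in> {0..1}" "dist t' t < d" for t'
  proof -
    have "t' \<in> ?S" "t \<in> ?S" using that t(1) d(1) by (auto simp: dist_commute)
    then have "g t' \<in> g ` ?S" "g t \<in> g ` ?S" by blast+
    then show ?thesis using path_connected_same_plaque[OF a L pc sL sW] sW by blast
  qed
  then show ?thesis unfolding eventually_at using d(1) by blast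
qed

text \<open>Near a point where the two graphs meet, both are path connected subsets of the same leaf, hence
  they stay in one plaque of a foliation chart. So the set of agreement is open; it is also closed.\<close>

lemma horizontal_unique:
  assumes U: "open U" "connected U" and f: "horizontal U f" and g: "horizontal U g"
    and y0: "y0 \<in> U" "f y0 = g y0" and y: "y \<in> U"
  shows "f y = g y"
proof -
  have "(f y0 = g y0) = (f y = g y)"
  proof (rule connected_local_const[OF U(2) y0(1) y], rule ballI)
    fix y1 assume y1: "y1 \<in> U"
    show "\<forall>\<^sub>F y in at y1 within U. (f y1 = g y1) = (f y = g y)"
    proof (cases "f y1 = g y1")
      case False
      have "continuous_on U (\<lambda>y. f y - g y)" using f g by (auto simp: horizontal_def intro!: continuous_intros)
      then have "open (U \<inter> (\<lambda>y. f y - g y) -` (- {0}))" by (rule continuous_open_preimage[OF _ U(1)]) auto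
      then show ?thesis unfolding eventually_at_topological
        using False y1 by (intro exI[of _ "U \<inter> (\<lambda>y. f y - g y) -` (- {0})"]) auto
    next
      case True
      obtain Lf where Lf: "Lf \<in> \<L>" "\<And>y. y \<in> U \<Longrightarrow> (y, f y) \<in> Lf" using f by (auto simp: horizontal_def)
      obtain Lg where Lg: "Lg \<in> \<L>" "\<And>y. y \<in> U \<Longrightarrow> (y, g y) \<in> Lg" using g by (auto simp: horizontal_def)
      have z: "(y1, f y1) \<in> total_space" using Lf y1 leaf_total by blast
      obtain c W V J \<psi> \<theta> where a: "adapted_chart \<A> \<L> c W V J \<psi> \<theta>" "(y1, f y1) \<in> W"
        using adapted_exists[OF z] .
      obtain O' where O': "open O'" "W = total_space \<inter> O'" using adapted_facts(3)[OF a(1)] by blast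
      have cf: "continuous_on U (\<lambda>y. (y, f y))" and cg: "continuous_on U (\<lambda>y. (y, g y))"
        using f g by (auto simp: horizontal_def intro!: continuous_intros)
      define Q where "Q = (U \<inter> (\<lambda>y. (y, f y)) -` O') \<inter> (U \<inter> (\<lambda>y. (y, g y)) -` O')"
      have "open Q" unfolding Q_def
        by (intro open_Int continuous_open_preimage[OF cf U(1) O'(1)] continuous_open_preimage[OF cg U(1) O'(1)])
      moreover have "y1 \<in> Q"
        using y1 a(2) O'(2) True by (simp add: Q_def)
      ultimately obtain P where "open P" "y1 \<in> P" "P \<subseteq> Q" "path_connected P"
        using small_path_connected[of y1 Q] by blast
      then have P: "open P" "y1 \<in> P" "path_connected P" "P \<subseteq> Q" by auto
      have "f y = g y" if "y \<in> P" for y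
      proof -
        have PU: "P \<subseteq> U" and PO: "\<And>y. y \<in> P \<Longrightarrow> (y, f y) \<in> O' \<and> (y, g y) \<in> O'"
          using P(4) by (auto simp: Q_def)
        have 1: "(\<lambda>y. (y, f y)) ` P \<subseteq> Lf" "(\<lambda>y. (y, g y)) ` P \<subseteq> Lg" using PU Lf Lg by auto
        have 2: "(\<lambda>y. (y, f y)) ` P \<subseteq> W" "(\<lambda>y. (y, g y)) ` P \<subseteq> W"
          using PO O'(2) 1 leaf_total[OF Lf(1)] leaf_total[OF Lg(1)] by blast+
        have "snd (\<psi> (y, f y)) = snd (\<psi> (y1, f y1))"
          by (rule path_connected_same_plaque[OF a(1) Lf(1) path_connected_continuous_image[OF continuous_on_subset[OF cf PU] P(3)] 1(1) 2(1)])
            (use that P in auto)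
        moreover have "snd (\<psi> (y, g y)) = snd (\<psi> (y1, g y1))"
          by (rule path_connected_same_plaque[OF a(1) Lg(1) path_connected_continuous_image[OF continuous_on_subset[OF cg PU] P(3)] 1(2) 2(2)])
            (use that P in auto)
        ultimately have "snd (\<psi> (y, f y)) = snd (\<psi> (y, g y))" using True by simp
        moreover have "(y, f y) \<in> W" "(y, g y) \<in> W" using 2 that by auto
        ultimately show ?thesis using adapted_facts(9)[OF a(1)] by (metis fst_conv prod.inject)
      qed
      then show ?thesis unfolding eventually_at_topological using P True by blast
    qed
  qed
  then show ?thesis using y0 by simp
qed

text \<open>Two sections cannot exchange their order without meeting.\<close>

lemma horizontal_less:
  assumes U: "open U" "connected U" and f: "horizontal U f" and g: "horizontal U g"
    and y0: "y0 \<in> U" "f y0 < g y0" and y: "y \<in> U"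
  shows "f y < g y"
proof (rule ccontr)
  assume n: "\<not> f y < g y"
  have "connected ((\<lambda>y. g y - f y) ` U)"
    by (rule connected_continuous_image[OF _ U(2)]) (use f g in \<open>auto simp: horizontal_def intro!: continuous_intros\<close>)
  then have "0 \<in> (\<lambda>y. g y - f y) ` U"
    using connectedD_interval[of "(\<lambda>y. g y - f y) ` U" "g y - f y" "g y0 - f y0" 0] y0 y n by auto
  then obtain y1 where "y1 \<in> U" "f y1 = g y1" by auto
  then have "f y0 = g y0" using horizontal_unique[OF U f g] y0 by blast
  then show False using y0 by simp
qed

lemma plaque_horizontal:
  assumes a: "adapted_chart \<A> \<L> c W V J \<psi> \<theta>" and s: "s \<in> J" and U: "U \<subseteq> fst ` W"
  shows "horizontal U (\<lambda>y. snd (\<theta> (snd c y, s)))"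
    "y \<in> U \<Longrightarrow> \<theta> (snd c y, s) = (y, snd (\<theta> (snd c y, s)))"
    "y \<in> U \<Longrightarrow> (y, snd (\<theta> (snd c y, s))) \<in> W \<and> snd (\<psi> (y, snd (\<theta> (snd c y, s)))) = s"
proof -
  note F = adapted_facts[OF a] and cf = chart_facts[OF adapted_facts(1)[OF a]]
  have yV: "y \<in> fst c" "snd c y \<in> V" if "y \<in> U" for y using that U F(6,7) by auto
  show eq: "\<theta> (snd c y, s) = (y, snd (\<theta> (snd c y, s)))" if "y \<in> U" for y
  proof -
    have "fst (\<theta> (snd c y, s)) = y"
      using cf(5)[OF yV(1)[OF that]] cf(5)[OF F(6)[OF F(10)[OF yV(2)[OF that] s]]] F(12)[OF yV(2)[OF that] s]
      by simp
    then show ?thesis by (simp add: prod_eq_iff)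
  qed
  show W: "(y, snd (\<theta> (snd c y, s))) \<in> W \<and> snd (\<psi> (y, snd (\<theta> (snd c y, s)))) = s" if "y \<in> U" for y
    using eq[OF that] F(10,11)[OF yV(2)[OF that] s] by auto
  show "horizontal U (\<lambda>y. snd (\<theta> (snd c y, s)))"
    unfolding horizontal_def
  proof (intro conjI)
    have "continuous_on U (snd c)" using continuous_on_subset[OF cf(3)] yV by blast
    then show "continuous_on U (\<lambda>y. snd (\<theta> (snd c y, s)))"
      by (intro continuous_on_snd continuous_on_compose2[OF F(5)] continuous_intros) (use yV s in auto)
    show "(\<lambda>y. snd (\<theta> (snd c y, s))) ` U \<subseteq> {0..1}"
      using W F(2) by (force simp: total_space_def)
    show "\<exists>L\<in>\<L>. \<forall>y\<in>U. (y, snd (\<theta> (snd c y, s))) \<in> L"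
    proof (cases "U = {}")
      case True
      have "(undefined, 0) \<in> (total_space :: ('k \<times> real) set)" by (simp add: total_space_def)
      then show ?thesis using True leaf_exists by blast
    next
      case False
      then obtain y1 where y1: "y1 \<in> U" by blast
      then obtain L where L: "L \<in> \<L>" "(y1, snd (\<theta> (snd c y1, s))) \<in> L" using leaf_exists W[OF y1] F(2) by blast
      then show ?thesis using same_plaque_same_leaf[OF a L] W y1 by (metis (no_types, lifting))
    qed
  qed
qed

text \<open>A foliation chart of the form \<open>(x, s) \<mapsto> (c\<^sup>-\<^sup>1 x, \<sigma> x s)\<close> over a coordinate ball about \<open>x0\<close> that contains
  the whole fibres. The transverse coordinate \<open>s\<close> of a plaque is its height over the centre.\<close>

definition full_box :: "('k, 'n) chart \<Rightarrow> real^'n \<Rightarrow> real \<Rightarrow> (real^'n \<Rightarrow> real \<Rightarrow> real) \<Rightarrow> bool" where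
  "full_box c x0 r \<sigma> \<longleftrightarrow> c \<in> \<A> \<and> r > 0 \<and> cball x0 r \<subseteq> snd c ` fst c \<and>
     (\<exists>\<psi>. adapted_chart \<A> \<L> c (cinv c ` ball x0 r \<times> {0..1}) (ball x0 r) {0..1} \<psi> (\<lambda>(x, s). (cinv c x, \<sigma> x s))) \<and>
     (\<forall>s\<in>{0..1}. \<sigma> x0 s = s) \<and>
     (\<forall>x\<in>ball x0 r. \<sigma> x 0 = 0 \<and> \<sigma> x 1 = 1 \<and> (\<forall>s t. 0 \<le> s \<longrightarrow> s < t \<longrightarrow> t \<le> 1 \<longrightarrow> \<sigma> x s < \<sigma> x t))"

text \<open>The compact fibre over \<open>y0\<close> is covered by finitely many charts, and over a small ball \<open>U\<close> every
  point of \<open>U \<times> [0, 1]\<close> lies in one of them. The plaque through such a point extends over all of \<open>U\<close>.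
  By uniqueness of horizontal functions, plaques of different charts with the same height over \<open>y0\<close>
  agree on \<open>U\<close>. Thus the height \<open>G\<close> over \<open>y0\<close> is a transverse coordinate on \<open>U \<times> [0, 1]\<close>, and its
  continuity as well as that of its inverse can be read off in the given charts.\<close>

lemma full_box_exists:
  assumes c: "c \<in> \<A>" and y0: "y0 \<in> fst c"
  shows "\<exists>r \<sigma>. full_box c (snd c y0) r \<sigma>"
proof -
  have "\<exists>A B c' W V J \<psi> \<theta>. open A \<and> y0 \<in> A \<and> open B \<and> t \<in> B \<and> A \<times> B \<inter> total_space \<subseteq> W \<and>
      adapted_chart \<A> \<L> c' W V J \<psi> \<theta>" if t: "t \<in> {0..1}" for t
  proof -
    have z: "(y0, t) \<in> total_space" using t by (simp add: total_space_def)
    obtain c' W V J \<psi> \<theta> where a: "adapted_chart \<A> \<L> c' W V J \<psi> \<theta>" "(y0, t) \<in> W"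
      using adapted_exists[OF z] .
    obtain O' where O': "open O'" "W = total_space \<inter> O'" using adapted_facts(3)[OF a(1)] by blast
    have "(y0, t) \<in> O'" using a(2) O'(2) by blast
    from open_prod_elim[OF O'(1) this] obtain A B where "open A" "open B" "(y0, t) \<in> A \<times> B" "A \<times> B \<subseteq> O'"
      by metis
    then have "open A \<and> y0 \<in> A \<and> open B \<and> t \<in> B \<and> A \<times> B \<inter> total_space \<subseteq> W \<and> adapted_chart \<A> \<L> c' W V J \<psi> \<theta>"
      using a(1) O'(2) by auto
    then show ?thesis
      by (intro exI[of _ A] exI[of _ B] exI[of _ c'] exI[of _ W] exI[of _ V] exI[of _ J] exI[of _ \<psi>] exI[of _ \<theta>])
  qed
  then obtain A B c' W V J \<psi> \<theta> where
    A: "\<And>t. t \<in> {0..1} \<Longrightarrow> open (A t) \<and> y0 \<in> A t \<and> open (B t) \<and> t \<in> B t" and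
    AB: "\<And>t. t \<in> {0..1} \<Longrightarrow> A t \<times> B t \<inter> total_space \<subseteq> W t" and
    a: "\<And>t. t \<in> {0..1} \<Longrightarrow> adapted_chart \<A> \<L> (c' t) (W t) (V t) (J t) (\<psi> t) (\<theta> t)"
    by metis
  have "\<exists>D\<subseteq>{0..1}. finite D \<and> {0..1} \<subseteq> (\<Union>t\<in>D. B t)"
    by (rule compactE_image[of "{0..1::real}" "{0..1}" B]) (use A in auto)
  then obtain D where D: "D \<subseteq> {0..1}" "finite D" "{0..1} \<subseteq> (\<Union>t\<in>D. B t)" by blast
  have "open (\<Inter>t\<in>D. A t)" using D A by (intro open_INT) auto
  moreover have "y0 \<in> (\<Inter>t\<in>D. A t)" using D A by auto
  ultimately obtain r where r: "r > 0" "cball (snd c y0) r \<subseteq> snd c ` fst c"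
     "cinv c ` cball (snd c y0) r \<subseteq> (\<Inter>t\<in>D. A t)" using small_ball[OF c y0] by blast
  define x0 where "x0 = snd c y0"
  define U where "U = cinv c ` ball x0 r"
  have sub: "ball x0 r \<subseteq> snd c ` fst c" using r unfolding x0_def by force
  have U: "open U" "path_connected U" "connected U"
    using cinv_image(2,3)[OF c sub] convex_imp_path_connected[of "ball x0 r"]
    unfolding U_def by (auto intro: path_connected_imp_connected)
  have UA: "U \<subseteq> A d" if "d \<in> D" for d using r(3) that unfolding U_def x0_def by force
  have yU: "y \<in> U \<longleftrightarrow> y \<in> fst c \<and> snd c y \<in> ball x0 r" for y
    unfolding U_def by (rule cinv_image(1)[OF c sub])
  have y0U: "y0 \<in> U" using yU y0 r by (simp add: x0_def)
  define dd where "dd t = (SOME d. d \<in> D \<and> t \<in> B d)" for t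
  have dd: "dd t \<in> D" "t \<in> B (dd t)" if "t \<in> {0..1}" for t
    using someI_ex[of "\<lambda>d. d \<in> D \<and> t \<in> B d"] D(3) that unfolding dd_def by blast+
  have DW: "(y, t) \<in> W d" if "y \<in> U" "d \<in> D" "t \<in> B d" "t \<in> {0..1}" for y t d
  proof -
    have "(y, t) \<in> A d \<times> B d \<inter> total_space" using UA[OF that(2)] that by (auto simp: total_space_def)
    then show ?thesis using AB[of d] that(2) D(1) by blast
  qed
  have UW: "U \<subseteq> fst ` W d" if d: "d \<in> D" for d
  proof
    fix y assume "y \<in> U"
    then have "(y, d) \<in> W d" using DW[of y d d] d D(1) A by auto
    then show "y \<in> fst ` W d" by force
  qed
  \<comment> \<open>the plaque of the chart \<open>d\<close> through the point \<open>z\<close>, evaluated over \<open>y\<close>\<close>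
  define pl where "pl d z y = snd (\<theta> d (snd (c' d) y, snd (\<psi> d z)))" for d z y
  have pl: "horizontal U (pl d z)" "pl d z (fst z) = snd z" if "d \<in> D" "z \<in> W d" "fst z \<in> U" for d z
  proof -
    have ad: "adapted_chart \<A> \<L> (c' d) (W d) (V d) (J d) (\<psi> d) (\<theta> d)" using a that D by blast
    have sJ: "snd (\<psi> d z) \<in> J d" by (rule adapted_facts(8)[OF ad that(2)])
    show "horizontal U (pl d z)" unfolding pl_def by (rule plaque_horizontal(1)[OF ad sJ UW[OF that(1)]])
    show "pl d z (fst z) = snd z" unfolding pl_def adapted_facts(9)[OF ad that(2)] ..
  qed
  \<comment> \<open>\<open>F s\<close> is the plaque at height \<open>s\<close> over \<open>y0\<close>, and \<open>G z\<close> the height over \<open>y0\<close> of the plaque through \<open>z\<close>\<close>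
  define F where "F s = pl (dd s) (y0, s)" for s
  define G where "G z = pl (dd (snd z)) z y0" for z
  have FW: "(y0, s) \<in> W (dd s)" if "s \<in> {0..1}" for s using DW[OF y0U dd] that by blast
  have Fh: "horizontal U (F s)" and F0: "F s y0 = s" if "s \<in> {0..1}" for s
    using pl[OF dd(1)[OF that] FW[OF that]] y0U by (auto simp: F_def)
  have Frange: "F s y \<in> {0..1}" if "s \<in> {0..1}" "y \<in> U" for s y
    using horizontal_range[OF Fh[OF that(1)] that(2)] by simp
  have Funiq: "F (f y0) y = f y" if "horizontal U f" "y \<in> U" for f y
    using horizontal_unique[OF U(1,3) Fh that(1) y0U _ that(2)] F0 horizontal_range[OF that(1) y0U] by simp
  have Fless: "F s y < F t y" if "s \<in> {0..1}" "t \<in> {0..1}" "s < t" "y \<in> U" for s t y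
    using horizontal_less[OF U(1,3) Fh[OF that(1)] Fh[OF that(2)] y0U _ that(4)] F0 that by simp
  have Finj: "s = t" if "F s y = F t y" "s \<in> {0..1}" "t \<in> {0..1}" "y \<in> U" for s t y
    using Fless[of s t y] Fless[of t s y] that by force
  have plF: "pl d z y0 \<in> {0..1}" "F (pl d z y0) y = pl d z y" if "d \<in> D" "z \<in> W d" "fst z \<in> U" "y \<in> U" for d z y
    using pl(1)[OF that(1-3)] Funiq that(4) horizontal_range[OF pl(1)[OF that(1-3)] y0U] by auto
  have GW: "z \<in> W (dd (snd z))" if "fst z \<in> U" "snd z \<in> {0..1}" for z
    using DW[OF that(1) dd[OF that(2)] that(2)] by simp
  have G: "G z \<in> {0..1}" "F (G z) (fst z) = snd z" if "fst z \<in> U" "snd z \<in> {0..1}" for z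
    using plF[OF dd(1) GW] pl(2)[OF dd(1) GW] that unfolding G_def by auto
  have GF: "G (y, F s y) = s" if "y \<in> U" "s \<in> {0..1}" for y s
    using Finj[of "G (y, F s y)" y s] G[of "(y, F s y)"] Frange[OF that(2,1)] that by simp
  have Gpl: "G z = pl d z y0" if "fst z \<in> U" "snd z \<in> {0..1}" "d \<in> D" "z \<in> W d" for z d
  proof (rule Finj[OF _ G(1)[OF that(1,2)] plF(1)[OF that(3,4,1,1)] that(1)])
    show "F (G z) (fst z) = F (pl d z y0) (fst z)"
      using G(2)[OF that(1,2)] plF(2)[OF that(3,4,1,1)] pl(2)[OF that(3,4,1)] by simp
  qed
  have F01: "F 0 y = 0" "F 1 y = 1" if y: "y \<in> U" for y
  proof -
    have "F 0 y = 0"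
    proof (cases "G (y, 0) = 0")
      case True
      then show ?thesis using G(2)[of "(y, 0)"] y by simp
    next
      case False
      then have "F 0 y < F (G (y, 0)) y" using Fless[of 0 "G (y, 0)" y] G(1)[of "(y, 0)"] y by simp
      then show ?thesis using G(2)[of "(y, 0)"] y Frange[of 0 y] by simp
    qed
    moreover have "F 1 y = 1"
    proof (cases "G (y, 1) = 1")
      case True
      then show ?thesis using G(2)[of "(y, 1)"] y by simp
    next
      case False
      then have "F (G (y, 1)) y < F 1 y" using Fless[of "G (y, 1)" 1 y] G(1)[of "(y, 1)"] y by simp
      then show ?thesis using G(2)[of "(y, 1)"] y Frange[of 1 y] by simp
    qed
    ultimately show "F 0 y = 0" "F 1 y = 1" .
  qed
  have contF: "continuous_on (U \<times> {0..1}) (\<lambda>(y, s). F s y)"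
  proof (rule continuous_on_local)
    fix p assume "p \<in> U \<times> {0..1::real}"
    then obtain y1 s1 where p: "p = (y1, s1)" "y1 \<in> U" "s1 \<in> {0..1}" by auto
    define d where "d = dd s1"
    have d: "d \<in> D" "s1 \<in> B d" using dd[OF p(3)] by (auto simp: d_def)
    have ad: "adapted_chart \<A> \<L> (c' d) (W d) (V d) (J d) (\<psi> d) (\<theta> d)" using a d D by blast
    have oB: "open (B d)" using A d D by blast
    let ?S = "(U \<times> {0..1}) \<inter> (UNIV \<times> B d)"
    have W1: "(y0, s) \<in> W d" if "s \<in> {0..1}" "s \<in> B d" for s using DW[OF y0U d(1)] that by blast
    have eq: "F s y = pl d (y0, s) y" if "(y, s) \<in> ?S" for y s
    proof -
      have s: "s \<in> {0..1}" "s \<in> B d" "y \<in> U" using that by auto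
      then show ?thesis using plF(2)[OF d(1) W1[OF s(1,2)] _ s(3)] pl(2)[OF d(1) W1[OF s(1,2)]] y0U by simp
    qed
    have U1: "snd (c' d) y \<in> V d" "y \<in> fst (c' d)" if "y \<in> U" for y
      using adapted_facts(6,7)[OF ad] UW[OF d(1)] that by auto
    have "continuous_on ?S (\<lambda>(y, s). pl d (y0, s) y)"
      unfolding pl_def case_prod_unfold
    proof (rule continuous_on_snd, rule continuous_on_compose2[OF adapted_facts(5)[OF ad]])
      have "continuous_on ?S (\<lambda>x. snd (c' d) (fst x))"
        by (rule continuous_on_compose2[OF chart_facts(3)[OF adapted_facts(1)[OF ad]]])
          (use U1 in \<open>auto intro!: continuous_intros\<close>)
      moreover have "continuous_on ?S (\<lambda>x. \<psi> d (y0, snd x))"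
        by (rule continuous_on_compose2[OF adapted_facts(4)[OF ad]])
          (use W1 in \<open>auto intro!: continuous_intros\<close>)
      ultimately show "continuous_on ?S (\<lambda>x. (snd (c' d) (fst x), snd (\<psi> d (y0, snd x))))"
        by (intro continuous_intros)
      show "(\<lambda>x. (snd (c' d) (fst x), snd (\<psi> d (y0, snd x)))) ` ?S \<subseteq> V d \<times> J d"
        using U1 adapted_facts(8)[OF ad W1] by auto
    qed
    then have "continuous_on ?S (\<lambda>(y, s). F s y)"
      by (rule continuous_on_eq) (use eq in auto)
    then show "\<exists>T. open T \<and> p \<in> T \<and> continuous_on (U \<times> {0..1} \<inter> T) (\<lambda>(y, s). F s y)"
      using oB d(2) p(1) by (intro exI[of _ "UNIV \<times> B d"]) (auto intro: open_Times)
  qed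
  have contG: "continuous_on (U \<times> {0..1}) G"
  proof (rule continuous_on_local)
    fix p assume "p \<in> U \<times> {0..1::real}"
    then have p: "fst p \<in> U" "snd p \<in> {0..1}" by auto
    define d where "d = dd (snd p)"
    have d: "d \<in> D" "snd p \<in> B d" using dd[OF p(2)] by (auto simp: d_def)
    have ad: "adapted_chart \<A> \<L> (c' d) (W d) (V d) (J d) (\<psi> d) (\<theta> d)" using a d D by blast
    have oB: "open (B d)" using A d D by blast
    let ?S = "(U \<times> {0..1}) \<inter> (UNIV \<times> B d)"
    have W1: "z \<in> W d" if "z \<in> ?S" for z using DW[OF _ d(1), of "fst z" "snd z"] that by auto
    have eq: "G z = pl d z y0" if "z \<in> ?S" for z using Gpl[OF _ _ d(1) W1[OF that]] that by auto
    have U1: "snd (c' d) y0 \<in> V d"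
      using adapted_facts(7)[OF ad] UW[OF d(1)] y0U by auto
    have "continuous_on ?S (\<lambda>z. pl d z y0)"
      unfolding pl_def
    proof (rule continuous_on_snd, rule continuous_on_compose2[OF adapted_facts(5)[OF ad]])
      have "continuous_on ?S (\<psi> d)"
        by (rule continuous_on_subset[OF adapted_facts(4)[OF ad]]) (use W1 in auto)
      then show "continuous_on ?S (\<lambda>x. (snd (c' d) y0, snd (\<psi> d x)))"
        by (intro continuous_intros)
      show "(\<lambda>x. (snd (c' d) y0, snd (\<psi> d x))) ` ?S \<subseteq> V d \<times> J d"
        using U1 adapted_facts(8)[OF ad W1] by auto
    qed
    then have "continuous_on ?S G"
      by (rule continuous_on_eq) (use eq in auto)
    then show "\<exists>T. open T \<and> p \<in> T \<and> continuous_on (U \<times> {0..1} \<inter> T) G"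
      using oB d(2) p(1) by (intro exI[of _ "UNIV \<times> B d"]) (auto intro: open_Times simp: mem_Times_iff)
  qed
  define \<sigma> where "\<sigma> x s = F s (cinv c x)" for x s
  define \<Psi> where "\<Psi> z = (snd c (fst z), G z)" for z
  define \<Theta> where "\<Theta> = (\<lambda>(x, s). (cinv c x, \<sigma> x s))"
  note cf = chart_facts[OF c]
  have xU: "cinv c x \<in> U" "snd c (cinv c x) = x" if "x \<in> ball x0 r" for x
    using that cf(6) sub by (auto simp: U_def)
  have Uc: "cinv c (snd c y) = y" "snd c y \<in> ball x0 r" if "y \<in> U" for y
    using that cf(5) yU by auto
  have hom: "homeomorphism (U \<times> {0..1}) (ball x0 r \<times> {0..1}) \<Psi> \<Theta>"
    unfolding homeomorphism_def
  proof (intro conjI)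
    have cc: "continuous_on (ball x0 r) (cinv c)" by (rule continuous_on_subset[OF cf(4) sub])
    have TP: "\<Theta> (\<Psi> z) = z" if "z \<in> U \<times> {0..1}" for z
      using that G(2)[of z] Uc(1)[of "fst z"] by (auto simp: \<Theta>_def \<Psi>_def \<sigma>_def)
    have PT: "\<Psi> (\<Theta> p) = p" if "p \<in> ball x0 r \<times> {0..1}" for p
      using that GF xU by (auto simp: \<Theta>_def \<Psi>_def \<sigma>_def)
    have PW: "\<Psi> z \<in> ball x0 r \<times> {0..1}" if "z \<in> U \<times> {0..1}" for z
      using that G(1)[of z] Uc(2)[of "fst z"] by (auto simp: \<Psi>_def)
    have TW: "\<Theta> p \<in> U \<times> {0..1}" if "p \<in> ball x0 r \<times> {0..1}" for p
      using that Frange xU by (auto simp: \<Theta>_def \<sigma>_def)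
    show "\<forall>x\<in>U \<times> {0..1}. \<Theta> (\<Psi> x) = x" "\<forall>y\<in>ball x0 r \<times> {0..1}. \<Psi> (\<Theta> y) = y"
      using TP PT by auto
    show "\<Psi> ` (U \<times> {0..1}) = ball x0 r \<times> {0..1}"
    proof
      show "\<Psi> ` (U \<times> {0..1}) \<subseteq> ball x0 r \<times> {0..1}" using PW by blast
      show "ball x0 r \<times> {0..1} \<subseteq> \<Psi> ` (U \<times> {0..1})" using PT TW by (metis imageI subsetI)
    qed
    show "\<Theta> ` (ball x0 r \<times> {0..1}) = U \<times> {0..1}"
    proof
      show "\<Theta> ` (ball x0 r \<times> {0..1}) \<subseteq> U \<times> {0..1}" using TW by blast
      show "U \<times> {0..1} \<subseteq> \<Theta> ` (ball x0 r \<times> {0..1})" using TP PW by (metis imageI subsetI)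
    qed
    have "continuous_on (U \<times> {0..1}) (\<lambda>z. snd c (fst z))"
      by (rule continuous_on_compose2[OF cf(3)]) (use yU in \<open>auto intro!: continuous_intros\<close>)
    then show "continuous_on (U \<times> {0..1}) \<Psi>"
      unfolding \<Psi>_def by (intro continuous_intros contG)
    have 1: "continuous_on (ball x0 r \<times> {0..1}) (\<lambda>p. cinv c (fst p))"
      by (rule continuous_on_compose2[OF cc]) (auto intro!: continuous_intros)
    have "continuous_on (ball x0 r \<times> {0..1}) (\<lambda>p. (\<lambda>(y, s). F s y) (cinv c (fst p), snd p))"
      by (rule continuous_on_compose2[OF contF]) (use xU in \<open>auto intro!: continuous_intros 1\<close>)
    then show "continuous_on (ball x0 r \<times> {0..1}) \<Theta>"
      unfolding \<Theta>_def \<sigma>_def case_prod_unfold using 1 by (auto intro!: continuous_intros)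
  qed
  have comp: "path_component_set (L \<inter> (U \<times> {0..1})) z = {w \<in> U \<times> {0..1}. snd (\<Psi> w) = snd (\<Psi> z)}"
    if L: "L \<in> \<L>" and z: "z \<in> L \<inter> (U \<times> {0..1})" for L z
  proof
    have z': "fst z \<in> U" "snd z \<in> {0..1}" "z \<in> L" using z by auto
    show "path_component_set (L \<inter> (U \<times> {0..1})) z \<subseteq> {w \<in> U \<times> {0..1}. snd (\<Psi> w) = snd (\<Psi> z)}"
    proof
      fix w assume "w \<in> path_component_set (L \<inter> (U \<times> {0..1})) z"
      then obtain g where g: "path g" "path_image g \<subseteq> L \<inter> (U \<times> {0..1})" "pathstart g = z" "pathfinish g = w"
        by (auto simp: path_component_def)
      have g1: "continuous_on {0..1} g" "g ` {0..1} \<subseteq> L" using g by (auto simp: path_def path_image_def)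
      have g2: "g t \<in> U \<times> {0..1}" if "t \<in> {0..1}" for t using g(2) that by (auto simp: path_image_def)
      have "G (g 0) = G (g 1)"
      proof (rule connected_local_const[of "{0..1::real}"], simp, simp, simp, rule ballI)
        fix t :: real assume t: "t \<in> {0..1}"
        define d where "d = dd (snd (g t))"
        have gt: "fst (g t) \<in> U" "snd (g t) \<in> {0..1}" using g2[OF t] by auto
        have d: "d \<in> D" "g t \<in> W d" using dd(1)[OF gt(2)] GW[OF gt] by (auto simp: d_def)
        have ad: "adapted_chart \<A> \<L> (c' d) (W d) (V d) (J d) (\<psi> d) (\<theta> d)" using a d D by blast
        have "\<forall>\<^sub>F t' in at t within {0..1}. t' \<in> {0..1}" by (simp add: eventually_at_filter)
        with path_leaf_local[OF ad L g1 t d(2)]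
        show "\<forall>\<^sub>F t' in at t within {0..1}. G (g t) = G (g t')"
        proof eventually_elim
          case (elim t')
          then have "G (g t') = pl d (g t') y0" using Gpl[OF _ _ d(1)] g2[of t'] by auto
          also have "\<dots> = pl d (g t) y0" using elim by (simp add: pl_def)
          also have "\<dots> = G (g t)" using Gpl[OF gt d] by simp
          finally show ?case by simp
        qed
      qed
      then show "w \<in> {w \<in> U \<times> {0..1}. snd (\<Psi> w) = snd (\<Psi> z)}"
        using g2[of 1] g(3,4) by (auto simp: \<Psi>_def pathstart_def pathfinish_def)
    qed
    show "{w \<in> U \<times> {0..1}. snd (\<Psi> w) = snd (\<Psi> z)} \<subseteq> path_component_set (L \<inter> (U \<times> {0..1})) z"
    proof
      fix w assume "w \<in> {w \<in> U \<times> {0..1}. snd (\<Psi> w) = snd (\<Psi> z)}"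
      then have w: "fst w \<in> U" "snd w \<in> {0..1}" "G w = G z" by (auto simp: \<Psi>_def)
      define s where "s = G z"
      have s: "s \<in> {0..1}" using G(1)[OF z'(1,2)] by (simp add: s_def)
      have zs: "z = (fst z, F s (fst z))" "w = (fst w, F s (fst w))"
        using G(2)[OF z'(1,2)] G(2)[OF w(1,2)] w(3) by (auto simp: s_def prod_eq_iff)
      obtain L' where L': "L' \<in> \<L>" "\<And>y. y \<in> U \<Longrightarrow> (y, F s y) \<in> L'" using Fh[OF s] by (auto simp: horizontal_def)
      have "L' = L" by (rule leaf_unique[OF L'(1) L, of z]) (use L'(2)[OF z'(1)] zs z' in auto)
      have "continuous_on U (\<lambda>y. (y, F s y))" using Fh[OF s] by (auto simp: horizontal_def intro!: continuous_intros)
      then have "path_connected ((\<lambda>y. (y, F s y)) ` U)" by (rule path_connected_continuous_image[OF _ U(2)])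
      then have "path_component ((\<lambda>y. (y, F s y)) ` U) z w"
        unfolding path_connected_component using zs z'(1) w(1) by blast
      moreover have "(\<lambda>y. (y, F s y)) ` U \<subseteq> L \<inter> (U \<times> {0..1})"
        using L'(2) \<open>L' = L\<close> Frange[OF s] by auto
      ultimately have "path_component (L \<inter> (U \<times> {0..1})) z w" by (rule path_component_of_subset[rotated])
      then show "w \<in> path_component_set (L \<inter> (U \<times> {0..1})) z" by simp
    qed
  qed
  have "adapted_chart \<A> \<L> c (U \<times> {0..1}) (ball x0 r) {0..1} \<Psi> \<Theta>"
    unfolding adapted_chart_def foliation_chart_def
  proof (intro conjI ballI)
    have "U \<times> {0..1} = total_space \<inter> (U \<times> UNIV)" by (auto simp: total_space_def)
    then show "openin (top_of_set total_space) (U \<times> {0..1})"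
      using open_Times[OF U(1) open_UNIV] unfolding openin_open by blast
    show "is_interval {0..1::real}" by (rule is_interval_cc)
  qed (use comp hom c yU in \<open>auto simp: \<Psi>_def\<close>)
  then have "full_box c x0 r \<sigma>"
    unfolding full_box_def \<Theta>_def U_def[symmetric]
    using c r F0 F01 Fless xU cf(5)[OF y0] by (auto simp: \<sigma>_def x0_def)
  then show ?thesis unfolding x0_def by blast
qed

section \<open>Saturated closed sets\<close>

lemma full_box_facts:
  assumes b: "full_box c x0 r \<sigma>"
  shows "c \<in> \<A>" "r > 0" "ball x0 r \<subseteq> snd c ` fst c" "x0 \<in> ball x0 r"
    "open (cinv c ` ball x0 r)" "connected (cinv c ` ball x0 r)"
    "\<And>y. y \<in> cinv c ` ball x0 r \<longleftrightarrow> y \<in> fst c \<and> snd c y \<in> ball x0 r"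
    "\<And>x. x \<in> ball x0 r \<Longrightarrow> snd c (cinv c x) = x"
    "\<And>y. y \<in> cinv c ` ball x0 r \<Longrightarrow> cinv c (snd c y) = y"
proof -
  show c: "c \<in> \<A>" and r: "r > 0" using b by (auto simp: full_box_def)
  have cb: "cball x0 r \<subseteq> snd c ` fst c" using b by (simp add: full_box_def)
  then show sub: "ball x0 r \<subseteq> snd c ` fst c" using ball_subset_cball by blast
  show "x0 \<in> ball x0 r" using r by simp
  show "open (cinv c ` ball x0 r)" by (rule cinv_image(2)[OF c sub open_ball])
  show "connected (cinv c ` ball x0 r)"
    by (intro path_connected_imp_connected cinv_image(3)[OF c sub] convex_imp_path_connected convex_ball)
  show iff: "y \<in> cinv c ` ball x0 r \<longleftrightarrow> y \<in> fst c \<and> snd c y \<in> ball x0 r" for y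
    by (rule cinv_image(1)[OF c sub])
  show "snd c (cinv c x) = x" if "x \<in> ball x0 r" for x
    using that sub by (intro chart_facts(6)[OF c]) blast
  show "cinv c (snd c y) = y" if "y \<in> cinv c ` ball x0 r" for y
    using that iff by (intro chart_facts(5)[OF c]) blast
qed

lemma full_box_adapted:
  assumes b: "full_box c x0 r \<sigma>"
  obtains \<psi> where "adapted_chart \<A> \<L> c (cinv c ` ball x0 r \<times> {0..1}) (ball x0 r) {0..1} \<psi>
    (\<lambda>(x, s). (cinv c x, \<sigma> x s))"
  using b unfolding full_box_def by blast

lemma full_box_sigma:
  assumes b: "full_box c x0 r \<sigma>"
  shows "s \<in> {0..1} \<Longrightarrow> \<sigma> x0 s = s"
    "x \<in> ball x0 r \<Longrightarrow> \<sigma> x 0 = 0" "x \<in> ball x0 r \<Longrightarrow> \<sigma> x 1 = 1"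
    "x \<in> ball x0 r \<Longrightarrow> 0 \<le> s \<Longrightarrow> s < t \<Longrightarrow> t \<le> 1 \<Longrightarrow> \<sigma> x s < \<sigma> x t"
    "x \<in> ball x0 r \<Longrightarrow> s \<in> {0..1} \<Longrightarrow> \<sigma> x s \<in> {0..1}"
    "y \<in> cinv c ` ball x0 r \<Longrightarrow> t \<in> {0..1} \<Longrightarrow> \<exists>s\<in>{0..1}. t = \<sigma> (snd c y) s"
    "continuous_on (ball x0 r \<times> {0..1}) (\<lambda>(x, s). \<sigma> x s)"
proof -
  show "s \<in> {0..1} \<Longrightarrow> \<sigma> x0 s = s"
    "x \<in> ball x0 r \<Longrightarrow> \<sigma> x 0 = 0" "x \<in> ball x0 r \<Longrightarrow> \<sigma> x 1 = 1"
    "x \<in> ball x0 r \<Longrightarrow> 0 \<le> s \<Longrightarrow> s < t \<Longrightarrow> t \<le> 1 \<Longrightarrow> \<sigma> x s < \<sigma> x t"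
    using b unfolding full_box_def by blast+
  obtain \<psi> where a: "adapted_chart \<A> \<L> c (cinv c ` ball x0 r \<times> {0..1}) (ball x0 r) {0..1} \<psi>
    (\<lambda>(x, s). (cinv c x, \<sigma> x s))" using full_box_adapted[OF b] .
  note F = adapted_facts[OF a]
  show "\<sigma> x s \<in> {0..1}" if "x \<in> ball x0 r" "s \<in> {0..1}" using F(10)[OF that] by simp
  show "\<exists>s\<in>{0..1}. t = \<sigma> (snd c y) s" if "y \<in> cinv c ` ball x0 r" "t \<in> {0..1}"
  proof -
    have "(y, t) \<in> cinv c ` ball x0 r \<times> {0..1}" using that by simp
    from F(8)[OF this] F(9)[OF this] show ?thesis by (intro bexI[of _ "snd (\<psi> (y, t))"]) auto
  qed
  have "continuous_on (ball x0 r \<times> {0..1}) (\<lambda>p. snd ((\<lambda>(x, s). (cinv c x, \<sigma> x s)) p))"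
    by (rule continuous_on_snd[OF F(5)])
  then show "continuous_on (ball x0 r \<times> {0..1}) (\<lambda>(x, s). \<sigma> x s)"
    by (simp add: case_prod_unfold)
qed

lemma full_box_inj:
  assumes b: "full_box c x0 r \<sigma>" and "x \<in> ball x0 r" "s \<in> {0..1}" "t \<in> {0..1}" "\<sigma> x s = \<sigma> x t"
  shows "s = t"
  using full_box_sigma(4)[OF b assms(2), of s t] full_box_sigma(4)[OF b assms(2), of t s] assms(3-)
  by (cases s t rule: linorder_cases) auto

lemma full_box_horizontal:
  assumes b: "full_box c x0 r \<sigma>" and s: "s \<in> {0..1}"
  shows "horizontal (cinv c ` ball x0 r) (\<lambda>y. \<sigma> (snd c y) s)"
proof -
  obtain \<psi> where a: "adapted_chart \<A> \<L> c (cinv c ` ball x0 r \<times> {0..1}) (ball x0 r) {0..1} \<psi>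
    (\<lambda>(x, s). (cinv c x, \<sigma> x s))" using full_box_adapted[OF b] .
  have "cinv c ` ball x0 r \<subseteq> fst ` (cinv c ` ball x0 r \<times> {0..1::real})" by force
  from plaque_horizontal(1)[OF a s this] show ?thesis by simp
qed

text \<open>A path in a leaf follows one plaque of the box as long as it stays in the box.\<close>

lemma full_box_path:
  assumes b: "full_box c x0 r \<sigma>" and s: "s \<in> {0..1}" and L: "L \<in> \<L>"
    and g: "continuous_on {0..1::real} g" "g ` {0..1} \<subseteq> L"
    and t: "t \<in> {0..1}" "fst (g t) \<in> cinv c ` ball x0 r" "snd (g t) = \<sigma> (snd c (fst (g t))) s"
  shows "\<forall>\<^sub>F t' in at t within {0..1}. fst (g t') \<in> cinv c ` ball x0 r \<and> snd (g t') = \<sigma> (snd c (fst (g t'))) s"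
proof -
  obtain \<psi> where a: "adapted_chart \<A> \<L> c (cinv c ` ball x0 r \<times> {0..1}) (ball x0 r) {0..1} \<psi>
    (\<lambda>(x, s). (cinv c x, \<sigma> x s))" using full_box_adapted[OF b] .
  note F = adapted_facts[OF a] and B = full_box_facts[OF b]
  have x: "snd c (fst (g t)) \<in> ball x0 r" using B(7) t(2) by blast
  have gt: "g t \<in> cinv c ` ball x0 r \<times> {0..1}"
    using full_box_sigma(5)[OF b x s] t by (simp add: mem_Times_iff)
  have eq: "snd z = \<sigma> (snd c (fst z)) (snd (\<psi> z))" if "z \<in> cinv c ` ball x0 r \<times> {0..1}" for z
    using arg_cong[OF F(9)[OF that], of snd] by simp
  have "s = snd (\<psi> (g t))"
    by (rule full_box_inj[OF b x s F(8)[OF gt]]) (use eq[OF gt] t(3) in simp)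
  from path_leaf_local[OF a L g t(1) gt] show ?thesis
  proof eventually_elim
    case (elim t')
    then have "snd (g t') = \<sigma> (snd c (fst (g t'))) s"
      using eq[of "g t'"] \<open>s = snd (\<psi> (g t))\<close> by simp
    then show ?case using elim by (simp add: mem_Times_iff)
  qed
qed

lemma horizontal_cong:
  assumes f: "horizontal U f" and eq: "\<And>y. y \<in> U \<Longrightarrow> f y = g y"
  shows "horizontal U g"
  unfolding horizontal_def
proof (intro conjI)
  show "continuous_on U g"
    by (rule continuous_on_eq[of U f g]) (use f eq in \<open>auto simp: horizontal_def\<close>)
  show "g ` U \<subseteq> {0..1}" using horizontal_range[OF f] eq by force
  show "\<exists>L\<in>\<L>. \<forall>y\<in>U. (y, g y) \<in> L" using f eq by (auto simp: horizontal_def)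
qed

lemma full_box_at: "\<exists>c r \<sigma>. y \<in> fst c \<and> full_box c (snd c y) r \<sigma> \<and> y \<in> cinv c ` ball (snd c y) r"
proof -
  obtain c where c: "c \<in> \<A>" "y \<in> fst c" using chart_cover by blast
  from full_box_exists[OF c] obtain r \<sigma> where b: "full_box c (snd c y) r \<sigma>" by blast
  then have "y \<in> cinv c ` ball (snd c y) r" using full_box_facts(4,7)[OF b] c by blast
  then show ?thesis using b c by blast
qed

text \<open>\<open>T\<close> follows a plaque in each box. A path in the leaf that starts on the graph stays on it, since
  the condition to be on the graph is locally constant along the path; hence the graph is the whole
  leaf. It is compact for the leaf topology because \<open>y \<mapsto> (y, T y)\<close> is continuous from \<open>K\<close> to the leaf
  topology: the preimage of a plaque is open by uniqueness of horizontal functions.\<close>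

lemma section_is_compact_leaf:
  assumes conn: "connected (UNIV :: 'k set)"
    and hor: "\<And>y. \<exists>c r \<sigma> s. y \<in> cinv c ` ball (snd c y) r \<and> full_box c (snd c y) r \<sigma> \<and> s \<in> {0..1} \<and>
       (\<forall>y'\<in>cinv c ` ball (snd c y) r. T y' = \<sigma> (snd c y') s)"
  shows "range (\<lambda>y. (y, T y)) \<in> \<L>" "compactin (leaf_topology \<A> \<L>) (range (\<lambda>y. (y, T y)))"
proof -
  have horU: "\<exists>U. open U \<and> y \<in> U \<and> horizontal U T" for y
  proof -
    obtain c r \<sigma> s where b: "y \<in> cinv c ` ball (snd c y) r" "full_box c (snd c y) r \<sigma>" "s \<in> {0..1}"
       "\<forall>y'\<in>cinv c ` ball (snd c y) r. T y' = \<sigma> (snd c y') s" using hor by blast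
    have "horizontal (cinv c ` ball (snd c y) r) T"
      by (rule horizontal_cong[OF full_box_horizontal[OF b(2,3)]]) (use b(4) in metis)
    then show ?thesis using b(1) full_box_facts(5)[OF b(2)] by blast
  qed
  have contT: "continuous_on UNIV T"
  proof (rule continuous_on_local)
    fix y
    show "\<exists>U. open U \<and> y \<in> U \<and> continuous_on (UNIV \<inter> U) T"
      using horU[of y] unfolding horizontal_def by auto
  qed
  obtain z where z: "z \<in> range (\<lambda>y. (y, T y))" by blast
  have in_total: "(y, T y) \<in> total_space" for y
    using horU[of y] horizontal_range[of _ T y] by (auto simp: total_space_def)
  then obtain L where L: "L \<in> \<L>" "z \<in> L" using z leaf_exists by blast
  have memL: "(y, T y) \<in> L" for y
  proof -
    obtain y0 where y0: "z = (y0, T y0)" using z by blast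
    have "((y, T y) \<in> L) = ((y0, T y0) \<in> L)"
    proof (rule connected_locally_const[OF conn])
      fix y
      obtain U where U: "open U" "y \<in> U" "horizontal U T" using horU by blast
      then obtain L' where L': "L' \<in> \<L>" "\<And>y'. y' \<in> U \<Longrightarrow> (y', T y') \<in> L'" by (auto simp: horizontal_def)
      have "((y', T y') \<in> L) = (L = L')" if "y' \<in> U" for y'
        using leaf_unique[OF L(1) L'(1), of "(y', T y')"] L'(2)[OF that] by auto
      then show "\<exists>U. open U \<and> y \<in> U \<and> (\<forall>y'\<in>U. ((y', T y') \<in> L) = ((y, T y) \<in> L))"
        using U(1,2) by auto
    qed
    then show ?thesis using L(2) y0 by simp
  qed
  have "L \<subseteq> range (\<lambda>y. (y, T y))"
  proof
    fix w assume w: "w \<in> L"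
    have "path_connected L" using fol L(1) by (auto simp: transverse_foliation_def)
    then obtain g where g: "path g" "path_image g \<subseteq> L" "pathstart g = z" "pathfinish g = w"
      using L(2) w unfolding path_connected_def by blast
    have g1: "continuous_on {0..1} g" "g ` {0..1} \<subseteq> L" using g by (auto simp: path_def path_image_def)
    define P where "P t = (snd (g t) = T (fst (g t)))" for t
    have "P 0 = P 1"
    proof (rule connected_local_const[of "{0..1::real}"], simp, simp, simp, rule ballI)
      fix t :: real assume t: "t \<in> {0..1}"
      define y where "y = fst (g t)"
      obtain c r \<sigma> s where b: "y \<in> cinv c ` ball (snd c y) r" "full_box c (snd c y) r \<sigma>" "s \<in> {0..1}"
         "\<And>y'. y' \<in> cinv c ` ball (snd c y) r \<Longrightarrow> T y' = \<sigma> (snd c y') s" using hor[of y] by blast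
      have "g t \<in> total_space" using g1(2) t leaf_total[OF L(1)] by blast
      then have "snd (g t) \<in> {0..1}" by (auto simp: total_space_def)
      then obtain s' where s': "s' \<in> {0..1}" "snd (g t) = \<sigma> (snd c y) s'"
        using full_box_sigma(6)[OF b(2,1)] by blast
      have P: "P t' = (s' = s)"
        if "fst (g t') \<in> cinv c ` ball (snd c y) r" "snd (g t') = \<sigma> (snd c (fst (g t'))) s'" for t'
      proof -
        have "snd c (fst (g t')) \<in> ball (snd c y) r" using full_box_facts(7)[OF b(2)] that(1) by blast
        then show ?thesis
          using b(4)[OF that(1)] that(2) full_box_inj[OF b(2) _ s'(1) b(3)] unfolding P_def by auto
      qed
      have "\<forall>\<^sub>F t' in at t within {0..1}. fst (g t') \<in> cinv c ` ball (snd c y) r \<and> snd (g t') = \<sigma> (snd c (fst (g t'))) s'"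
        by (rule full_box_path[OF b(2) s'(1) L(1) g1 t]) (use b(1) s'(2) y_def in auto)
      then show "\<forall>\<^sub>F t' in at t within {0..1}. P t = P t'"
        using P[of t] P b(1) s'(2) by (auto elim!: eventually_mono simp: y_def)
    qed
    moreover have "P 0" using g(3) z by (auto simp: P_def pathstart_def)
    ultimately have "snd w = T (fst w)" using g(4) by (simp add: P_def pathfinish_def)
    then have "w = (fst w, T (fst w))" by (simp add: prod_eq_iff)
    then show "w \<in> range (\<lambda>y. (y, T y))" by blast
  qed
  then have "L = range (\<lambda>y. (y, T y))" using memL by blast
  then show "range (\<lambda>y. (y, T y)) \<in> \<L>" using L(1) by simp
  have "continuous_map euclidean (leaf_topology \<A> \<L>) (\<lambda>y. (y, T y))"
    unfolding leaf_topology_def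
  proof (rule continuous_on_generated_topo)
    fix P assume "P \<in> {P. \<exists>c W V J \<psi> \<theta> s. adapted_chart \<A> \<L> c W V J \<psi> \<theta> \<and> s \<in> J \<and> P = \<theta> ` (V \<times> {s})}"
    then obtain c W V J \<psi> \<theta> s where a: "adapted_chart \<A> \<L> c W V J \<psi> \<theta>" "s \<in> J" and P: "P = \<theta> ` (V \<times> {s})" by blast
    note F = adapted_facts[OF a(1)]
    have "\<exists>Q. open Q \<and> y \<in> Q \<and> Q \<subseteq> (\<lambda>y. (y, T y)) -` P" if y: "(y, T y) \<in> P" for y
    proof -
      obtain x where x: "x \<in> V" "(y, T y) = \<theta> (x, s)" using y P by auto
      have W: "(y, T y) \<in> W" using F(10)[OF x(1) a(2)] x(2) by simp
      have yc: "y \<in> fst c" "snd c y = x" using F(6)[OF W] F(12)[OF x(1) a(2)] x(2) by (metis fst_conv)+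
      obtain U where U: "open U" "y \<in> U" "horizontal U T" using horU by blast
      obtain O' where O': "open O'" "W = total_space \<inter> O'" using F(3) by blast
      have "(y, T y) \<in> O'" using W O' by blast
      from open_prod_elim[OF O'(1) this] obtain A B where AB: "open A" "open B" "(y, T y) \<in> A \<times> B" "A \<times> B \<subseteq> O'"
        by blast
      have TB: "T y \<in> {0..1}" using in_total[of y] by (simp add: total_space_def)
      have AW: "A \<subseteq> fst ` W"
      proof
        fix y' assume "y' \<in> A"
        then have "(y', T y) \<in> W" using AB O' TB by (auto simp: total_space_def)
        then show "y' \<in> fst ` W" by force
      qed
      have "open (U \<inter> A)" "y \<in> U \<inter> A" using U AB by auto
      from small_path_connected[OF this(2,1)] obtain Q where Q: "open Q" "y \<in> Q" "Q \<subseteq> U \<inter> A" "path_connected Q" by blast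
      have QW: "Q \<subseteq> fst ` W" using Q AW by blast
      note ph = plaque_horizontal[OF a QW]
      have "T y' = snd (\<theta> (snd c y', s))" if "y' \<in> Q" for y'
      proof (rule horizontal_unique[OF Q(1) path_connected_imp_connected[OF Q(4)] _ ph(1) Q(2) _ that])
        show "horizontal Q T" by (rule horizontal_subset[OF U(3)]) (use Q in blast)
        show "T y = snd (\<theta> (snd c y, s))" using x(2) yc(2) by (metis snd_conv)
      qed
      then have "(y', T y') \<in> P" if "y' \<in> Q" for y'
      proof -
        have "snd c y' \<in> V" using QW that F(7) by auto
        moreover have "(y', T y') = \<theta> (snd c y', s)"
          using ph(2)[OF that] \<open>\<And>y'. y' \<in> Q \<Longrightarrow> T y' = snd (\<theta> (snd c y', s))\<close>[OF that] by simp
        ultimately show ?thesis unfolding P by blast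
      qed
      then show ?thesis using Q by blast
    qed
    then have "open ((\<lambda>y. (y, T y)) -` P)" by (subst open_subopen) auto
    then show "openin euclidean ((\<lambda>y. (y, T y)) -` P \<inter> topspace euclidean)" by simp
  next
    show "(\<lambda>y. (y, T y)) ` topspace euclidean
       \<subseteq> \<Union> {P. \<exists>c W V J \<psi> \<theta> s. adapted_chart \<A> \<L> c W V J \<psi> \<theta> \<and> s \<in> J \<and> P = \<theta> ` (V \<times> {s})}"
    proof
      fix w assume "w \<in> (\<lambda>y. (y, T y)) ` topspace euclidean"
      then have w: "w \<in> total_space" using in_total by auto
      obtain c W V J \<psi> \<theta> where a: "adapted_chart \<A> \<L> c W V J \<psi> \<theta>" "w \<in> W" using adapted_exists[OF w] .
      note F = adapted_facts[OF a(1)]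
      have "w \<in> \<theta> ` (V \<times> {snd (\<psi> w)})" using F(7,9)[OF a(2)] by (metis SigmaI image_eqI singletonI)
      moreover have "\<theta> ` (V \<times> {snd (\<psi> w)}) \<in> {P. \<exists>c W V J \<psi> \<theta> s. adapted_chart \<A> \<L> c W V J \<psi> \<theta> \<and> s \<in> J \<and> P = \<theta> ` (V \<times> {s})}"
        by (intro CollectI exI conjI) (rule a(1), rule F(8)[OF a(2)], rule refl)
      ultimately show "w \<in> \<Union> {P. \<exists>c W V J \<psi> \<theta> s. adapted_chart \<A> \<L> c W V J \<psi> \<theta> \<and> s \<in> J \<and> P = \<theta> ` (V \<times> {s})}"
        by (rule UnionI[rotated])
    qed
  qed
  moreover have "compactin euclidean (UNIV :: 'k set)"
    using mfd by (simp add: closed_C2_manifold_def)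
  ultimately show "compactin (leaf_topology \<A> \<L>) (range (\<lambda>y. (y, T y)))"
    by (rule image_compactin[rotated])
qed

text \<open>It suffices to test saturation in boxes, where the plaques are slices.\<close>

definition saturated :: "('k \<times> real) set \<Rightarrow> bool" where
  "saturated X \<longleftrightarrow> (\<forall>c x0 r \<sigma> s. full_box c x0 r \<sigma> \<longrightarrow> s \<in> {0..1} \<longrightarrow>
     (\<forall>x\<in>ball x0 r. \<forall>x'\<in>ball x0 r. (cinv c x, \<sigma> x s) \<in> X \<longrightarrow> (cinv c x', \<sigma> x' s) \<in> X))"

text \<open>In a box the trace of \<open>X\<close> is \<open>B \<times> S\<close> for a compact set \<open>S\<close> of heights. So over the points of the box
  the topmost point of \<open>X\<close> follows the plaque at height \<open>Max S\<close>, and the topmost points form a compact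
  leaf. Plaques through boundary points stay in the boundary, so this leaf is \<open>K \<times> {1}\<close> or lies in
  the interior; it is not \<open>K \<times> {0}\<close> because \<open>X\<close> meets the interior.\<close>

theorem saturated_contains_top:
  assumes conn: "connected (UNIV :: 'k set)"
    and nocpt: "\<not> (\<exists>L\<in>\<L>. compactin (leaf_topology \<A> \<L>) L \<and> L \<subseteq> interior_space)"
    and X: "closed X" "X \<subseteq> total_space" "saturated X" and z: "(y1, t1) \<in> X" "0 < t1" "t1 < 1"
  shows "(y, 1) \<in> X"
proof -
  define S where "S y = {t. (y, t) \<in> X}" for y
  define T where "T y = Sup (S y)" for y
  have S01: "S y \<subseteq> {0..1}" for y using X(2) by (auto simp: S_def total_space_def)
  have Scl: "closed (S y)" for y
  proof -
    have "continuous_on UNIV (\<lambda>t::real. (y, t))" by (intro continuous_intros)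
    then have "closed ((\<lambda>t. (y, t)) -` X)" by (rule closed_vimage[OF X(1)])
    then show ?thesis unfolding S_def vimage_def .
  qed
  have Smax: "T y \<in> S y" "\<And>t. t \<in> S y \<Longrightarrow> t \<le> T y" if "S y \<noteq> {}" for y
  proof -
    have bd: "bdd_above (S y)" using S01 by (meson bdd_above_Icc bdd_above_mono)
    show "T y \<in> S y" unfolding T_def by (rule closed_contains_Sup[OF that bd Scl])
    show "\<And>t. t \<in> S y \<Longrightarrow> t \<le> T y" unfolding T_def by (rule cSup_upper[OF _ bd])
  qed
  have box: "S y' = \<sigma> (snd c y') ` S y"
    if b: "full_box c (snd c y) r \<sigma>" and y: "y \<in> cinv c ` ball (snd c y) r" and y': "y' \<in> cinv c ` ball (snd c y) r"
    for c y r \<sigma> y'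
  proof -
    note B = full_box_facts[OF b]
    have x': "snd c y' \<in> ball (snd c y) r" "cinv c (snd c y') = y'" using B(7,9) y' by auto
    \<comment> \<open>at the centre \<open>y\<close> of the box the height is the fibre coordinate\<close>
    have iff: "s \<in> S y \<longleftrightarrow> \<sigma> (snd c y') s \<in> S y'" if s: "s \<in> {0..1}" for s
    proof -
      have "(cinv c (snd c y), \<sigma> (snd c y) s) \<in> X \<longleftrightarrow> (cinv c (snd c y'), \<sigma> (snd c y') s) \<in> X"
        using X(3) b s x'(1) B(4) unfolding saturated_def by blast
      then show ?thesis unfolding x'(2) B(9)[OF y] full_box_sigma(1)[OF b s] S_def by simp
    qed
    show ?thesis
    proof (intro equalityI subsetI)
      fix t assume t: "t \<in> S y'"
      then obtain s where s: "s \<in> {0..1}" "t = \<sigma> (snd c y') s" using full_box_sigma(6)[OF b y'] S01 by blast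
      then show "t \<in> \<sigma> (snd c y') ` S y" using iff t by blast
    next
      fix t assume "t \<in> \<sigma> (snd c y') ` S y"
      then show "t \<in> S y'" using iff S01 by blast
    qed
  qed
  have ne: "S y \<noteq> {}" for y
  proof -
    have "(S y = {}) = (S y1 = {})"
    proof (rule connected_locally_const[OF conn])
      fix y
      obtain c r \<sigma> where b: "full_box c (snd c y) r \<sigma>" "y \<in> cinv c ` ball (snd c y) r" using full_box_at[of y] by blast
      have "\<forall>y'\<in>cinv c ` ball (snd c y) r. (S y' = {}) = (S y = {})" using box[OF b] by simp
      then show "\<exists>U. open U \<and> y \<in> U \<and> (\<forall>y'\<in>U. (S y' = {}) = (S y = {}))"
        using b(2) full_box_facts(5)[OF b(1)] by blast
    qed
    then show ?thesis using z(1) by (auto simp: S_def)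
  qed
  note Smax = Smax[OF ne]
  have T01: "T y \<in> {0..1}" for y using S01 Smax(1) by blast
  have boxT: "T y' = \<sigma> (snd c y') (T y)"
    if b: "full_box c (snd c y) r \<sigma>" and y: "y \<in> cinv c ` ball (snd c y) r" and y': "y' \<in> cinv c ` ball (snd c y) r"
    for c y r \<sigma> y'
  proof -
    have x': "snd c y' \<in> ball (snd c y) r" using full_box_facts(7)[OF b] y' by blast
    have le: "\<sigma> (snd c y') s \<le> \<sigma> (snd c y') (T y)" if "s \<in> S y" for s
      using full_box_sigma(4)[OF b x', of s "T y"] Smax(2)[OF that] S01[of y] that T01[of y] by (cases "s = T y") force+
    obtain s where s: "s \<in> S y" "T y' = \<sigma> (snd c y') s" using Smax(1)[of y'] box[OF b y y'] by blast
    have "\<sigma> (snd c y') (T y) \<in> S y'" using box[OF b y y'] Smax(1) by blast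
    then show ?thesis using le[OF s(1)] s(2) Smax(2)[of "\<sigma> (snd c y') (T y)" y'] by simp
  qed
  have hor: "\<exists>c r \<sigma> s. y \<in> cinv c ` ball (snd c y) r \<and> full_box c (snd c y) r \<sigma> \<and> s \<in> {0..1} \<and>
       (\<forall>y'\<in>cinv c ` ball (snd c y) r. T y' = \<sigma> (snd c y') s)" for y
  proof -
    obtain c r \<sigma> where b: "full_box c (snd c y) r \<sigma>" "y \<in> cinv c ` ball (snd c y) r" using full_box_at[of y] by blast
    show ?thesis
      by (intro exI[of _ c] exI[of _ r] exI[of _ \<sigma>] exI[of _ "T y"] conjI b T01)
        (rule ballI, rule boxT[OF b])
  qed
  have ends: "(T y = e) = (T y' = e)" if e: "e = 0 \<or> e = 1" for e y y'
  proof (rule connected_locally_const[OF conn])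
    fix y
    obtain c r \<sigma> where b: "full_box c (snd c y) r \<sigma>" "y \<in> cinv c ` ball (snd c y) r" using full_box_at[of y] by blast
    have "(T y' = e) = (T y = e)" if y': "y' \<in> cinv c ` ball (snd c y) r" for y'
    proof -
      have x': "snd c y' \<in> ball (snd c y) r" using full_box_facts(7)[OF b(1)] y' by blast
      have "\<sigma> (snd c y') e = e" using full_box_sigma(2,3)[OF b(1) x'] e by auto
      moreover have "T y = e" if "\<sigma> (snd c y') (T y) = \<sigma> (snd c y') e"
        by (rule full_box_inj[OF b(1) x' T01 _ that]) (use e in auto)
      ultimately show ?thesis unfolding boxT[OF b y'] by metis
    qed
    then show "\<exists>U. open U \<and> y \<in> U \<and> (\<forall>y'\<in>U. (T y' = e) = (T y = e))"
      using b(2) full_box_facts(5)[OF b(1)] by blast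
  qed
  show "(y, 1) \<in> X"
  proof (rule ccontr)
    assume "(y, 1) \<notin> X"
    then have "T y \<noteq> 1" using Smax(1)[of y] by (auto simp: S_def)
    then have n1: "T y' \<noteq> 1" for y' using ends[of 1 y y'] by simp
    have "T y1 > 0" using Smax(2)[of t1 y1] z by (simp add: S_def)
    then have n0: "T y' \<noteq> 0" for y' using ends[of 0 y1 y'] by simp
    have "range (\<lambda>y. (y, T y)) \<subseteq> interior_space"
      using n0 n1 T01 by (force simp: interior_space_def less_le)
    then show False using section_is_compact_leaf[OF conn hor] nocpt by blast
  qed
qed

end

section \<open>Consequences of the maximum principle\<close>

lemma pd_neg:
  assumes "C1_on V u" "open V" "x \<in> V" shows "pd i (\<lambda>x. - u x) x = - pd i u x"
  using GDERIV_pd(2)[OF GDERIV_minus[OF C1_on_GDERIV[OF assms]], of i] by simp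

lemma C2_on_minus:
  assumes V: "open V" and u: "C2_on V u" shows "C2_on V (\<lambda>x. - u x)"
  unfolding C2_on_def
proof (intro conjI allI)
  show "C1_on V (\<lambda>x. - u x)" by (intro C1_on_minus V C2_on_C1[OF u])
  show "C1_on V (pd i (\<lambda>x. - u x))" for i
    by (rule C1_on_cong[OF V _ C1_on_minus[OF V C2_on_C1(2)[OF u]]])
      (rule pd_neg[OF C2_on_C1(1)[OF u] V, symmetric])
qed

lemma pd_pd_neg:
  assumes V: "open V" "x \<in> V" and u: "C2_on V u"
  shows "pd i (pd j (\<lambda>x. - u x)) x = - pd i (pd j u) x"
proof -
  have "pd i (pd j (\<lambda>x. - u x)) x = pd i (\<lambda>x. - pd j u x) x"
    by (rule pd_cong_open[OF V pd_neg[OF C2_on_C1(1)[OF u] V(1)]])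
  then show ?thesis using pd_neg[OF C2_on_C1(2)[OF u] V] by simp
qed

locale harmonic_bundle = foliation_setting \<A> \<L>
  for \<A> :: "('k::t2_space, 'n::finite) chart set" and \<L> :: "('k \<times> real) set set" +
  fixes G :: "('k, 'n) chart \<Rightarrow> real^'n \<Rightarrow> real^'n^'n" and h :: "'k \<times> real \<Rightarrow> real"
  assumes riem: "C2_riemannian_metric \<A> G"
    and conn: "connected (UNIV :: 'k set)"
    and nocpt: "\<not> (\<exists>L\<in>\<L>. compactin (leaf_topology \<A> \<L>) L \<and> L \<subseteq> interior_space)"
    and harm: "leafwise_harmonic \<A> G \<L> h"
begin

lemma metric_on_chart: "c \<in> \<A> \<Longrightarrow> metric_on (snd c ` fst c) (G c)"
  using riem chart_facts(2) unfolding C2_riemannian_metric_def metric_on_def posdef_def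
  by (blast intro: C2_on_C1(1))

lemma metric_on_box:
  assumes "full_box c x0 r \<sigma>" shows "metric_on (ball x0 r) (G c)"
  using metric_on_subset[OF metric_on_chart full_box_facts(3)[OF assms]] full_box_facts(1)[OF assms] by simp

lemma box_C2:
  assumes b: "full_box c x0 r \<sigma>"
  shows "s \<in> {0..1} \<Longrightarrow> C2_on (ball x0 r) (\<lambda>x. h (cinv c x, \<sigma> x s))"
    "s \<in> {0..1} \<Longrightarrow> x \<in> ball x0 r \<Longrightarrow> laplacian (G c) (\<lambda>x. h (cinv c x, \<sigma> x s)) x = 0"
    "continuous_on (ball x0 r \<times> {0..1}) (\<lambda>(x, s). pd i (\<lambda>x. h (cinv c x, \<sigma> x s)) x)"
    "continuous_on (ball x0 r \<times> {0..1}) (\<lambda>(x, s). h (cinv c x, \<sigma> x s))"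
proof -
  obtain \<psi> where a: "adapted_chart \<A> \<L> c (cinv c ` ball x0 r \<times> {0..1}) (ball x0 r) {0..1} \<psi>
    (\<lambda>(x, s). (cinv c x, \<sigma> x s))" using full_box_adapted[OF b] .
  have h: "continuous_leafwise_C2 \<A> \<L> h" using harm by (simp add: leafwise_harmonic_def)
  have A: "(\<forall>s\<in>{0..1}. C2_on (ball x0 r) (\<lambda>x. h ((\<lambda>(x, s). (cinv c x, \<sigma> x s)) (x, s)))) \<and>
        (\<forall>i. continuous_on (ball x0 r \<times> {0..1}) (\<lambda>(x, s). pd i (\<lambda>y. h ((\<lambda>(x, s). (cinv c x, \<sigma> x s)) (y, s))) x))"
    using h a unfolding continuous_leafwise_C2_def by blast
  have B: "\<forall>x\<in>ball x0 r. \<forall>s\<in>{0..1}. laplacian (G c) (\<lambda>y. h ((\<lambda>(x, s). (cinv c x, \<sigma> x s)) (y, s))) x = 0"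
    using harm a unfolding leafwise_harmonic_def by blast
  show "s \<in> {0..1} \<Longrightarrow> C2_on (ball x0 r) (\<lambda>x. h (cinv c x, \<sigma> x s))"
    "s \<in> {0..1} \<Longrightarrow> x \<in> ball x0 r \<Longrightarrow> laplacian (G c) (\<lambda>x. h (cinv c x, \<sigma> x s)) x = 0"
    "continuous_on (ball x0 r \<times> {0..1}) (\<lambda>(x, s). pd i (\<lambda>x. h (cinv c x, \<sigma> x s)) x)"
    using A B by simp_all
  have "continuous_on total_space h" using h by (simp add: continuous_leafwise_C2_def)
  from continuous_on_compose2[OF this adapted_facts(5)[OF a]]
  have "continuous_on (ball x0 r \<times> {0..1}) (\<lambda>p. h ((\<lambda>(x, s). (cinv c x, \<sigma> x s)) p))"
    using adapted_facts(2)[OF a] adapted_facts(10)[OF a] by fastforce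
  then show "continuous_on (ball x0 r \<times> {0..1}) (\<lambda>(x, s). h (cinv c x, \<sigma> x s))"
    by (simp add: case_prod_unfold)
qed

text \<open>Both functions are harmonic for the same coordinate Laplacian, so values of \<open>h\<close> on two different
  leaves over the same base points can be compared.\<close>

lemma box_difference_max:
  assumes b: "full_box c x0 r \<sigma>" and s: "s \<in> {0..1}" "t \<in> {0..1}" and x: "x \<in> ball x0 r" "x' \<in> ball x0 r"
    and max: "\<And>y. y \<in> ball x0 r \<Longrightarrow> h (cinv c y, \<sigma> y s) - h (cinv c y, \<sigma> y t) \<le> h (cinv c x, \<sigma> x s) - h (cinv c x, \<sigma> x t)"
  shows "h (cinv c x', \<sigma> x' s) - h (cinv c x', \<sigma> x' t) = h (cinv c x, \<sigma> x s) - h (cinv c x, \<sigma> x t)"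
  by (rule harmonic_difference_max[OF metric_on_box[OF b] connected_ball box_C2(1,2)[OF b s(1)] box_C2(1,2)[OF b s(2)] x(1) max x(2)])

lemma box_max:
  assumes b: "full_box c x0 r \<sigma>" and s: "s \<in> {0..1}" and x: "x \<in> ball x0 r" "x' \<in> ball x0 r"
    and max: "\<And>y. y \<in> ball x0 r \<Longrightarrow> h (cinv c y, \<sigma> y s) \<le> h (cinv c x, \<sigma> x s)"
  shows "h (cinv c x', \<sigma> x' s) = h (cinv c x, \<sigma> x s)"
proof -
  have C0: "C2_on (ball x0 r) (\<lambda>x. 0)"
    unfolding C2_on_def using C1_on_const[OF open_ball, of x0 r 0] by (simp add: pd_const[abs_def])
  have "laplacian (G c) (\<lambda>x. 0) y = 0" for y by (simp add: laplacian_def pd_const)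
  then show ?thesis
    using harmonic_difference_max[OF metric_on_box[OF b] connected_ball box_C2(1,2)[OF b s] C0 _ x(1) _ x(2)] max by simp
qed

lemma h_continuous: "continuous_on total_space h"
  using harm by (simp add: leafwise_harmonic_def continuous_leafwise_C2_def)

lemma compact_total: "compact (total_space :: ('k \<times> real) set)"
  unfolding total_space_def using mfd by (intro compact_Times) (auto simp: closed_C2_manifold_def)

lemma closed_level: "closed {z \<in> total_space. h z = M}"
  using continuous_closed_preimage_constant[OF h_continuous compact_imp_closed[OF compact_total]] .

lemma saturated_max:
  assumes max: "\<And>z. z \<in> total_space \<Longrightarrow> h z \<le> M"
  shows "saturated {z \<in> total_space. h z = M}"
  unfolding saturated_def
proof (intro allI impI ballI)
  fix c x0 r \<sigma> s x x'
  assume b: "full_box c x0 r \<sigma>" and s: "s \<in> {0..1}" and x: "x \<in> ball x0 r" "x' \<in> ball x0 r"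
    and z: "(cinv c x, \<sigma> x s) \<in> {z \<in> total_space. h z = M}"
  have "h (cinv c x', \<sigma> x' s) = h (cinv c x, \<sigma> x s)"
    by (rule box_max[OF b s x]) (use max z full_box_sigma(5)[OF b _ s] in \<open>auto simp: total_space_def\<close>)
  then show "(cinv c x', \<sigma> x' s) \<in> {z \<in> total_space. h z = M}"
    using z full_box_sigma(5)[OF b x(2) s] by (simp add: total_space_def)
qed

text \<open>The maximum principle on the compact leaves \<open>K \<times> {0}\<close> and \<open>K \<times> {1}\<close>.\<close>

lemma boundary_constant:
  assumes e: "e = 0 \<or> e = (1::real)"
  shows "h (y, e) = h (y', e)"
proof -
  have "compact ((UNIV :: 'k set) \<times> {e})" using mfd by (intro compact_Times) (auto simp: closed_C2_manifold_def)
  moreover have "continuous_on ((UNIV :: 'k set) \<times> {e}) h"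
    by (rule continuous_on_subset[OF h_continuous]) (use e in \<open>auto simp: total_space_def\<close>)
  ultimately obtain y1 where y1: "\<And>y. h (y, e) \<le> h (y1, e)"
    using continuous_attains_sup[of "(UNIV :: 'k set) \<times> {e}" h] by auto
  have "(h (y, e) = h (y1, e)) = (h (y1, e) = h (y1, e))" for y
  proof (rule connected_locally_const[OF conn])
    fix y
    obtain c r \<sigma> where b: "full_box c (snd c y) r \<sigma>" "y \<in> cinv c ` ball (snd c y) r" using full_box_at[of y] by blast
    have e01: "e \<in> {0..1}" using e by auto
    have *: "h (b1, e) = h (y1, e)" if "a1 \<in> cinv c ` ball (snd c y) r" "b1 \<in> cinv c ` ball (snd c y) r" "h (a1, e) = h (y1, e)" for a1 b1
    proof -
      note B = full_box_facts[OF b(1)]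
      have ab: "snd c a1 \<in> ball (snd c y) r" "snd c b1 \<in> ball (snd c y) r" "cinv c (snd c a1) = a1" "cinv c (snd c b1) = b1"
        using B(7,9) that by auto
      have se: "\<sigma> x e = e" if "x \<in> ball (snd c y) r" for x
        using full_box_sigma(2,3)[OF b(1) that] e by auto
      have "h (cinv c (snd c b1), \<sigma> (snd c b1) e) = h (cinv c (snd c a1), \<sigma> (snd c a1) e)"
        by (rule box_max[OF b(1) e01 ab(1,2)]) (use y1 se ab that in auto)
      then show ?thesis using se ab that by simp
    qed
    show "\<exists>U. open U \<and> y \<in> U \<and> (\<forall>y'\<in>U. (h (y', e) = h (y1, e)) = (h (y, e) = h (y1, e)))"
      using full_box_facts(5)[OF b(1)] b(2) * by (intro exI[of _ "cinv c ` ball (snd c y) r"]) blast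
  qed
  then have "h (y, e) = h (y1, e)" "h (y', e) = h (y1, e)" by blast+
  then show ?thesis by simp
qed

text \<open>A maximum attained in the interior is also attained at the top, by \<open>saturated_contains_top\<close>.\<close>

lemma h_le_boundary: "z \<in> total_space \<Longrightarrow> h z \<le> max (h (y, 0)) (h (y, 1))"
proof -
  assume z: "z \<in> total_space"
  obtain w where w: "w \<in> total_space" "\<And>z. z \<in> total_space \<Longrightarrow> h z \<le> h w"
    using continuous_attains_sup[OF compact_total _ h_continuous] z by blast
  obtain y1 t1 where yt: "w = (y1, t1)" by (cases w)
  have "h w \<le> max (h (y, 0)) (h (y, 1))"
  proof (cases "t1 = 0 \<or> t1 = 1")
    case True
    then show ?thesis using boundary_constant[of t1 y1 y] yt by auto
  next
    case False
    then have "0 < t1" "t1 < 1" using w(1) yt by (auto simp: total_space_def)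
    from saturated_contains_top[OF conn nocpt closed_level _ saturated_max[OF w(2)] _ this, of y1 y]
    show ?thesis using w(1) yt by auto
  qed
  then show ?thesis using w(2)[OF z] by simp
qed

text \<open>Let \<open>M\<close> be the maximum of \<open>h (y, s) - h (y, t)\<close> over \<open>s \<le> t\<close>. If \<open>M > 0\<close>, the set \<open>X\<close> of the upper
  points \<open>(y, t)\<close> of the maximising pairs is closed and, by the maximum principle for pairs of leaves,
  saturated. It does not meet \<open>K \<times> {0}\<close>. So it contains a top point, and \<open>h\<close> exceeds its top value by
  \<open>M\<close> somewhere, which contradicts \<open>h_le_boundary\<close>.\<close>

lemma h_monotone:
  assumes le: "h (y0, 0) \<le> h (y0, 1)" and st: "0 \<le> s" "s \<le> t" "t \<le> 1"
  shows "h (y, s) \<le> h (y, t)"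
proof (rule ccontr)
  assume neg: "\<not> h (y, s) \<le> h (y, t)"
  define K where "K = {p :: 'k \<times> real \<times> real. fst (snd p) \<in> {0..1} \<and> snd (snd p) \<in> {0..1} \<and> fst (snd p) \<le> snd (snd p)}"
  define f where "f p = h (fst p, fst (snd p)) - h (fst p, snd (snd p))" for p
  have "compact K"
  proof -
    have "compact ((UNIV :: 'k set) \<times> {0..1::real} \<times> {0..1::real})"
      using mfd by (intro compact_Times) (auto simp: closed_C2_manifold_def)
    moreover have "closed {p :: 'k \<times> real \<times> real. fst (snd p) \<le> snd (snd p)}"
      by (intro closed_Collect_le continuous_intros)
    ultimately have "compact ((UNIV \<times> {0..1} \<times> {0..1}) \<inter> {p :: 'k \<times> real \<times> real. fst (snd p) \<le> snd (snd p)})"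
      by (rule compact_Int_closed)
    moreover have "(UNIV \<times> {0..1} \<times> {0..1}) \<inter> {p :: 'k \<times> real \<times> real. fst (snd p) \<le> snd (snd p)} = K"
      by (auto simp: K_def)
    ultimately show ?thesis by simp
  qed
  have fcont: "continuous_on K f"
    unfolding f_def
    by (intro continuous_intros continuous_on_compose2[OF h_continuous]) (auto simp: K_def total_space_def)
  have pK: "(y, s, t) \<in> K" using st by (simp add: K_def)
  obtain p where p: "p \<in> K" "\<And>q. q \<in> K \<Longrightarrow> f q \<le> f p"
    using continuous_attains_sup[OF \<open>compact K\<close> _ fcont] pK by blast
  define M where "M = f p"
  have M: "M > 0" using p(2)[OF pK] neg by (simp add: M_def f_def)
  define X where "X = (\<lambda>p. (fst p, snd (snd p))) ` {p \<in> K. f p = M}"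
  have Xiff: "(y, t) \<in> X \<longleftrightarrow> (\<exists>s. 0 \<le> s \<and> s \<le> t \<and> t \<le> 1 \<and> h (y, s) - h (y, t) = M)" for y t
  proof
    assume "(y, t) \<in> X"
    then show "\<exists>s. 0 \<le> s \<and> s \<le> t \<and> t \<le> 1 \<and> h (y, s) - h (y, t) = M"
      unfolding X_def K_def f_def by auto
  next
    assume "\<exists>s. 0 \<le> s \<and> s \<le> t \<and> t \<le> 1 \<and> h (y, s) - h (y, t) = M"
    then obtain s where "0 \<le> s" "s \<le> t" "t \<le> 1" "h (y, s) - h (y, t) = M" by blast
    then have "(y, s, t) \<in> {p \<in> K. f p = M}" by (simp add: K_def f_def)
    then have "(\<lambda>p. (fst p, snd (snd p))) (y, s, t) \<in> X" unfolding X_def by (rule imageI)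
    then show "(y, t) \<in> X" by simp
  qed
  have "closed {p \<in> K. f p = M}"
    by (rule continuous_closed_preimage_constant[OF fcont compact_imp_closed[OF \<open>compact K\<close>]])
  then have "compact {p \<in> K. f p = M}"
    using compact_Int_closed[OF \<open>compact K\<close>, of "{p \<in> K. f p = M}"] by (simp add: Int_absorb1 subset_iff Int_def)
  then have "compact X" unfolding X_def
    by (intro compact_continuous_image continuous_intros)
  then have clX: "closed X" by (rule compact_imp_closed)
  have Xsub: "X \<subseteq> total_space" by (auto simp: X_def K_def total_space_def)
  have Mmax: "h (y, s) - h (y, t) \<le> M" if "0 \<le> s" "s \<le> t" "t \<le> 1" for y s t
    using p(2)[of "(y, s, t)"] that by (simp add: K_def f_def M_def)
  have satX: "saturated X"
    unfolding saturated_def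
  proof (intro allI impI ballI)
    fix c x0 r \<sigma> s x x'
    assume b: "full_box c x0 r \<sigma>" and s: "s \<in> {0..1}" and x: "x \<in> ball x0 r" "x' \<in> ball x0 r"
      and z: "(cinv c x, \<sigma> x s) \<in> X"
    obtain u where u: "0 \<le> u" "u \<le> \<sigma> x s" "\<sigma> x s \<le> 1" "h (cinv c x, u) - h (cinv c x, \<sigma> x s) = M"
      using z Xiff by blast
    have "cinv c x \<in> cinv c ` ball x0 r" using x by blast
    then obtain v where v: "v \<in> {0..1}" "u = \<sigma> x v"
      using full_box_sigma(6)[OF b, of "cinv c x" u] u full_box_facts(8)[OF b x(1)] by auto
    have "v \<le> s" using full_box_sigma(4)[OF b x(1), of s v] u v s by (cases "s < v") auto
    then have le: "\<sigma> w v \<le> \<sigma> w s" if "w \<in> ball x0 r" for w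
      using full_box_sigma(4)[OF b that, of v s] v s by (cases "v = s") auto
    have "h (cinv c x', \<sigma> x' v) - h (cinv c x', \<sigma> x' s) = h (cinv c x, \<sigma> x v) - h (cinv c x, \<sigma> x s)"
    proof (rule box_difference_max[OF b v(1) s x])
      fix w assume w: "w \<in> ball x0 r"
      then show "h (cinv c w, \<sigma> w v) - h (cinv c w, \<sigma> w s) \<le> h (cinv c x, \<sigma> x v) - h (cinv c x, \<sigma> x s)"
        using Mmax[of "\<sigma> w v" "\<sigma> w s" "cinv c w"] le full_box_sigma(5)[OF b w] v s u by auto
    qed
    then show "(cinv c x', \<sigma> x' s) \<in> X"
      unfolding Xiff using u v le[OF x(2)] full_box_sigma(5)[OF b x(2)] s
      by (intro exI[of _ "\<sigma> x' v"]) auto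
  qed
  obtain y1 s1 t1 where p1: "p = (y1, s1, t1)" by (cases p)
  have z1: "(y1, t1) \<in> X" unfolding X_def using p(1) p1 M_def by force
  have t1: "0 \<le> s1" "s1 \<le> t1" "t1 \<le> 1" using p(1) p1 by (auto simp: K_def)
  have "t1 \<noteq> 0"
  proof
    assume "t1 = 0"
    then have "s1 = 0" using t1 by simp
    then show False using M p1 \<open>t1 = 0\<close> by (simp add: M_def f_def)
  qed
  have "(y1, 1) \<in> X"
  proof (cases "t1 = 1")
    case True
    then show ?thesis using z1 by simp
  next
    case False
    then show ?thesis using saturated_contains_top[OF conn nocpt clX Xsub satX z1] t1 \<open>t1 \<noteq> 0\<close> by simp
  qed
  then obtain s2 where s2: "0 \<le> s2" "s2 \<le> 1" "h (y1, s2) - h (y1, 1) = M" using Xiff by blast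
  have "h (y1, s2) \<le> max (h (y0, 0)) (h (y0, 1))"
    by (rule h_le_boundary) (use s2 in \<open>simp add: total_space_def\<close>)
  moreover have "h (y1, 1) = h (y0, 1)" by (rule boundary_constant) simp
  ultimately show False using s2(3) M le by simp
qed

text \<open>By monotonicity the difference of \<open>h\<close> on two plaques has a sign. A zero of it is an extremum, so it
  vanishes throughout.\<close>

lemma box_equal_lines:
  assumes le: "h (y0, 0) \<le> h (y0, 1)" and b: "full_box c x0 r \<sigma>" and s: "s \<in> {0..1}" "t \<in> {0..1}"
    and x: "x \<in> ball x0 r" "x' \<in> ball x0 r" and eq: "h (cinv c x, \<sigma> x s) = h (cinv c x, \<sigma> x t)"
  shows "h (cinv c x', \<sigma> x' s) = h (cinv c x', \<sigma> x' t)"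
proof -
  have main: "h (cinv c x', \<sigma> x' s) = h (cinv c x', \<sigma> x' t)"
    if s: "s \<in> {0..1}" "t \<in> {0..1}" "s \<le> t" and eq: "h (cinv c x, \<sigma> x s) = h (cinv c x, \<sigma> x t)" for s t
  proof -
    have "h (cinv c x', \<sigma> x' s) - h (cinv c x', \<sigma> x' t) = h (cinv c x, \<sigma> x s) - h (cinv c x, \<sigma> x t)"
    proof (rule box_difference_max[OF b s(1,2) x])
      fix w assume w: "w \<in> ball x0 r"
      have "\<sigma> w s \<le> \<sigma> w t" using full_box_sigma(4)[OF b w, of s t] s by (cases "s = t") auto
      then show "h (cinv c w, \<sigma> w s) - h (cinv c w, \<sigma> w t) \<le> h (cinv c x, \<sigma> x s) - h (cinv c x, \<sigma> x t)"
        using h_monotone[OF le, of "\<sigma> w s" "\<sigma> w t" "cinv c w"] eq full_box_sigma(5)[OF b w] s by auto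
    qed
    then show ?thesis using eq by simp
  qed
  show ?thesis
  proof (cases "s \<le> t")
    case True
    then show ?thesis by (rule main[OF s _ eq])
  next
    case False
    then have "t \<le> s" by simp
    from main[OF s(2,1) this eq[symmetric]] show ?thesis by (rule sym)
  qed
qed

text \<open>An intermediate level set would be closed, saturated and contain interior but no top points.\<close>

lemma leafwise_constant_imp_equal_ends:
  assumes lc: "\<And>y. \<exists>c x0 r \<sigma> U. full_box c x0 r \<sigma> \<and> open U \<and> y \<in> U \<and> U \<subseteq> cinv c ` ball x0 r \<and>
      (\<forall>s\<in>{0..1}. \<forall>y'\<in>U. h (y', \<sigma> (snd c y') s) = h (y, \<sigma> (snd c y) s))"
    and lt: "h (y0, 0) < h (y0, 1)"
  shows False
proof -
  define m where "m = (h (y0, 0) + h (y0, 1)) / 2"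
  have "continuous_on {0..1} (\<lambda>t. h (y0, t))"
    by (rule continuous_on_compose2[OF h_continuous]) (auto intro!: continuous_intros simp: total_space_def)
  then obtain t where t: "0 \<le> t" "t \<le> 1" "h (y0, t) = m"
    using IVT'[of "\<lambda>t. h (y0, t)" 0 m 1] lt by (auto simp: m_def)
  have "t \<noteq> 0" "t \<noteq> 1" using t lt by (auto simp: m_def)
  define X where "X = {z \<in> total_space. h z = m}"
  have "saturated X"
    unfolding saturated_def
  proof (intro allI impI ballI)
    fix c x0 r \<sigma> s x x'
    assume b: "full_box c x0 r \<sigma>" and s: "s \<in> {0..1}" and x: "x \<in> ball x0 r" "x' \<in> ball x0 r"
      and z: "(cinv c x, \<sigma> x s) \<in> X"
    note B = full_box_facts[OF b]
    define f where "f y = \<sigma> (snd c y) s" for y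
    have hf: "horizontal (cinv c ` ball x0 r) f" unfolding f_def by (rule full_box_horizontal[OF b s])
    have "h (cinv c x, f (cinv c x)) = h (cinv c x', f (cinv c x'))"
    proof (rule connected_local_const[OF B(6), where f = "\<lambda>y. h (y, f y)"])
      show "cinv c x \<in> cinv c ` ball x0 r" "cinv c x' \<in> cinv c ` ball x0 r" using x by auto
      show "\<forall>a\<in>cinv c ` ball x0 r. \<forall>\<^sub>F b in at a within cinv c ` ball x0 r. h (a, f a) = h (b, f b)"
      proof
        fix y assume y: "y \<in> cinv c ` ball x0 r"
        obtain c' x0' r' \<sigma>' U where b': "full_box c' x0' r' \<sigma>'" and U: "open U" "y \<in> U" "U \<subseteq> cinv c' ` ball x0' r'"
          and cst: "\<And>s y'. s \<in> {0..1} \<Longrightarrow> y' \<in> U \<Longrightarrow> h (y', \<sigma>' (snd c' y') s) = h (y, \<sigma>' (snd c' y) s)"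
          using lc[of y] by metis
        obtain s' where s': "s' \<in> {0..1}" "f y = \<sigma>' (snd c' y) s'"
        proof -
          have "y \<in> cinv c' ` ball x0' r'" using U by blast
          moreover have "f y \<in> {0..1}" using horizontal_range[OF hf y] by simp
          ultimately show ?thesis using full_box_sigma(6)[OF b'] that by blast
        qed
        have "open (U \<inter> cinv c ` ball x0 r)" "y \<in> U \<inter> cinv c ` ball x0 r" using U y B(5) by auto
        from small_path_connected[OF this(2,1)] obtain P where P: "open P" "y \<in> P" "P \<subseteq> U \<inter> cinv c ` ball x0 r" "path_connected P" by blast
        have "f y' = \<sigma>' (snd c' y') s'" if "y' \<in> P" for y'
          by (rule horizontal_unique[OF P(1) path_connected_imp_connected[OF P(4)] horizontal_subset[OF hf]
                horizontal_subset[OF full_box_horizontal[OF b' s'(1)]] P(2) s'(2) that]) (use P U in auto)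
        then have "h (y, f y) = h (y', f y')" if "y' \<in> P" for y' using cst[OF s'(1), of y'] that P s'(2) by auto
        then show "\<forall>\<^sub>F b in at y within cinv c ` ball x0 r. h (y, f y) = h (b, f b)"
          unfolding eventually_at_topological using P by blast
      qed
    qed
    then show "(cinv c x', \<sigma> x' s) \<in> X"
      using z full_box_sigma(5)[OF b x(2) s] B(8)[OF x(1)] B(8)[OF x(2)] by (simp add: f_def X_def total_space_def)
  qed
  then have "(y0, 1) \<in> X"
    using saturated_contains_top[OF conn nocpt _ _ \<open>saturated X\<close>, of y0 t y0] closed_level[of m] t \<open>t \<noteq> 0\<close> \<open>t \<noteq> 1\<close>
    by (auto simp: X_def total_space_def)
  then show False using lt by (simp add: X_def m_def field_simps)
qed

lemma leafwise_harmonic_minus: "leafwise_harmonic \<A> G \<L> (\<lambda>z. - h z)"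
proof -
  have h: "continuous_leafwise_C2 \<A> \<L> h" using harm by (simp add: leafwise_harmonic_def)
  have V: "open V" if "adapted_chart \<A> \<L> c W V J \<psi> \<theta>" for c W V J \<psi> \<theta>
    using that by (simp add: adapted_chart_def foliation_chart_def)
  note hC = h[unfolded continuous_leafwise_C2_def, THEN conjunct2, THEN spec, THEN spec, THEN spec,
    THEN spec, THEN spec, THEN spec, THEN mp]
  note hL = harm[unfolded leafwise_harmonic_def, THEN conjunct2, THEN spec, THEN spec, THEN spec,
    THEN spec, THEN spec, THEN spec, THEN mp]
  have C2: "C2_on V (\<lambda>x. h (\<theta> (x, s)))"
    if "adapted_chart \<A> \<L> c W V J \<psi> \<theta>" "s \<in> J" for c W V J \<psi> \<theta> s
    using conjunct1[OF hC[OF that(1)]] that(2) by (rule bspec)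
  have lap: "laplacian (G c) (\<lambda>y. h (\<theta> (y, s))) x = 0"
    if "adapted_chart \<A> \<L> c W V J \<psi> \<theta>" "s \<in> J" "x \<in> V" for c W V J \<psi> \<theta> s x
    by (rule bspec[OF bspec[OF hL[OF that(1)] that(3)] that(2)])
  show ?thesis
    unfolding leafwise_harmonic_def continuous_leafwise_C2_def
  proof (intro conjI allI impI ballI)
    show "continuous_on total_space (\<lambda>z. - h z)" by (intro continuous_intros h_continuous)
    fix c W V J \<psi> \<theta> assume a: "adapted_chart \<A> \<L> c W V J \<psi> \<theta>"
    note V = V[OF a]
    show "C2_on V (\<lambda>x. - h (\<theta> (x, s)))" if "s \<in> J" for s by (rule C2_on_minus[OF V C2[OF a that]])
    show "continuous_on (V \<times> J) (\<lambda>(x, s). pd i (\<lambda>y. - h (\<theta> (y, s))) x)" for i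
    proof -
      have "continuous_on (V \<times> J) (\<lambda>(x, s). pd i (\<lambda>y. h (\<theta> (y, s))) x)"
        using hC[OF a] by blast
      then have "continuous_on (V \<times> J) (\<lambda>p. - (case p of (x, s) \<Rightarrow> pd i (\<lambda>y. h (\<theta> (y, s))) x))"
        by (rule continuous_on_minus)
      then show ?thesis
        by (rule continuous_on_eq) (auto simp: pd_neg[OF C2_on_C1(1)[OF C2[OF a]] V])
    qed
    show "continuous_on (V \<times> J) (\<lambda>(x, s). pd i (pd j (\<lambda>y. - h (\<theta> (y, s)))) x)" for i j
    proof -
      have "continuous_on (V \<times> J) (\<lambda>(x, s). pd i (pd j (\<lambda>y. h (\<theta> (y, s)))) x)"
        using hC[OF a] by blast
      then have "continuous_on (V \<times> J) (\<lambda>p. - (case p of (x, s) \<Rightarrow> pd i (pd j (\<lambda>y. h (\<theta> (y, s)))) x))"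
        by (rule continuous_on_minus)
      then show ?thesis
        by (rule continuous_on_eq) (auto simp: pd_pd_neg[OF V _ C2[OF a]])
    qed
    show "laplacian (G c) (\<lambda>y. - h (\<theta> (y, s))) x = 0" if x: "x \<in> V" and s: "s \<in> J" for x s
    proof -
      let ?u = "\<lambda>y. h (\<theta> (y, s))"
      have c: "c \<in> \<A>" using a by (simp add: adapted_chart_def)
      have "V \<subseteq> snd c ` fst c"
      proof
        fix x assume "x \<in> V"
        then show "x \<in> snd c ` fst c" using adapted_facts(6,10,12)[OF a] s by (metis image_eqI)
      qed
      then have g: "metric_on V (G c)" using metric_on_subset[OF metric_on_chart[OF c]] V by blast
      have "ell A b (\<lambda>y. - ?u y) x = - ell A b ?u x" for A b
        unfolding ell_def using pd_pd_neg[OF V x C2[OF a s]] pd_neg[OF C2_on_C1(1)[OF C2[OF a s]] V x]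
        by (simp add: sum_negf inner_vec_def)
      then have "laplacian (G c) (\<lambda>y. - ?u y) x = - laplacian (G c) ?u x"
        by (simp add: laplacian_eq_ell[OF g C2[OF a s] x] laplacian_eq_ell[OF g C2_on_minus[OF V C2[OF a s]] x])
      then show ?thesis using lap[OF a s x] by simp
    qed
  qed
qed

end

section \<open>Leafwise gradients seen from the base\<close>

lemma absolutely_integrable_transfer:
  fixes f g :: "'a::euclidean_space \<Rightarrow> real"
  assumes "f absolutely_integrable_on S" "\<And>x. x \<in> S \<Longrightarrow> f x = g x"
  shows "g absolutely_integrable_on S"
proof -
  have "(\<lambda>x. if x \<in> S then f x else 0) = (\<lambda>x. if x \<in> S then g x else 0)" using assms(2) by auto
  then show ?thesis using assms(1) absolutely_integrable_restrict_UNIV by metis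
qed

lemma absolutely_integrable_support:
  fixes f :: "'a::euclidean_space \<Rightarrow> real"
  assumes "S \<subseteq> B" "\<And>x. x \<in> B - S \<Longrightarrow> f x = 0"
  shows "f absolutely_integrable_on S \<longleftrightarrow> f absolutely_integrable_on B" "integral S f = integral B f"
proof -
  have e: "(\<lambda>x. if x \<in> S then f x else 0) = (\<lambda>x. if x \<in> B then f x else 0)" using assms by force
  show "f absolutely_integrable_on S \<longleftrightarrow> f absolutely_integrable_on B"
    using absolutely_integrable_restrict_UNIV[where S = S and f = f] absolutely_integrable_restrict_UNIV[where S = B and f = f] by (simp only: e)
  show "integral S f = integral B f"
    using integral_restrict_UNIV[of S f] integral_restrict_UNIV[of B f] by (simp only: e)
qed

lemma has_derivative_cart:
  fixes T :: "'a::real_normed_vector \<Rightarrow> real^'m::finite"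
  assumes "\<And>i. ((\<lambda>x. T x $ i) has_derivative (\<lambda>v. L v $ i)) (at x)"
  shows "(T has_derivative L) (at x)"
  using has_derivative_componentwise_within[of T L x UNIV] assms
  by (auto simp: Basis_vec_def inner_axis)

lemma has_derivative_jacobian:
  fixes T :: "real^'n::finite \<Rightarrow> real^'n"
  assumes "open S" "x \<in> S" "\<And>i. C1_on S (\<lambda>x. T x $ i)"
  shows "(T has_derivative (\<lambda>v. jacobian T x *v v)) (at x)"
proof (rule has_derivative_cart)
  fix i
  have "(jacobian T x *v v) $ i = v \<bullet> grad (\<lambda>y. T y $ i) x" for v
    by (simp add: jacobian_def matrix_vector_mult_def inner_vec_def mult.commute)
  then show "((\<lambda>x. T x $ i) has_derivative (\<lambda>v. (jacobian T x *v v) $ i)) (at x)"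
    using C1_on_GDERIV[OF assms(3,1,2), of i] by (simp add: gderiv_def)
qed

lemma GDERIV_compose_map:
  fixes T :: "real^'n::finite \<Rightarrow> real^'n" and f :: "real^'n \<Rightarrow> real"
  assumes T: "(T has_derivative (\<lambda>v. J *v v)) (at x)" and f: "GDERIV f (T x) :> D"
  shows "GDERIV (\<lambda>x. f (T x)) x :> transpose J *v D"
proof -
  have "((\<lambda>x. f (T x)) has_derivative (\<lambda>v. (J *v v) \<bullet> D)) (at x)"
    using has_derivative_compose[OF T, of f "\<lambda>h. h \<bullet> D"] f by (simp add: gderiv_def)
  moreover have "(J *v v) \<bullet> D = v \<bullet> (transpose J *v D)" for v
    by (metis dot_lmul_matrix inner_commute transpose_matrix_vector transpose_transpose)
  ultimately show ?thesis by (simp add: gderiv_def)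
qed

text \<open>\<open>J\<close> is the Jacobian of a coordinate change: covectors transform with \<open>J\<^sup>T\<close>, metrics by congruence,
  and the volume density by \<open>\<bar>det J\<bar>\<close>.\<close>

lemma pairing_invariant:
  fixes J g g' :: "real^'n::finite^'n"
  assumes g: "posdef g" and g': "posdef g'" and eq: "g = transpose J ** g' ** J"
  shows "(transpose J *v p) \<bullet> (matrix_inv g *v (transpose J *v q)) = p \<bullet> (matrix_inv g' *v q)"
    "sqrt (det g) = \<bar>det J\<bar> * sqrt (det g')"
proof -
  have dg: "det g = det J * det J * det g'" unfolding eq by (simp add: det_mul det_transpose)
  then show "sqrt (det g) = \<bar>det J\<bar> * sqrt (det g')" by (simp add: real_sqrt_mult)
  have "det J \<noteq> 0" using dg posdef_det_pos[OF g] by auto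
  then have J: "J ** matrix_inv J = mat 1" by (simp add: matrix_inv_right invertible_det_nz)
  note inv = matrix_inv_right[OF posdef_invertible] matrix_inv_left[OF posdef_invertible]
  \<comment> \<open>\<open>J\<^sup>-\<^sup>1 w\<close> solves the equation that defines \<open>g\<^sup>-\<^sup>1 J\<^sup>T q\<close>\<close>
  define w where "w = matrix_inv g' *v q"
  have "g *v (matrix_inv J *v w) = transpose J *v (g' *v ((J ** matrix_inv J) *v w))"
    unfolding eq by (simp add: matrix_vector_mul_assoc matrix_mul_assoc)
  also have "\<dots> = transpose J *v q"
    unfolding J w_def using inv(1)[OF g'] by (simp add: matrix_vector_mul_assoc)
  finally have "matrix_inv g *v (transpose J *v q) = matrix_inv J *v w"
    using inv(2)[OF g] by (metis matrix_vector_mul_assoc matrix_vector_mul_lid)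
  then have "(transpose J *v p) \<bullet> (matrix_inv g *v (transpose J *v q)) = p \<bullet> (J *v (matrix_inv J *v w))"
    by (metis dot_lmul_matrix inner_commute transpose_matrix_vector transpose_transpose)
  then show "(transpose J *v p) \<bullet> (matrix_inv g *v (transpose J *v q)) = p \<bullet> (matrix_inv g' *v q)"
    by (simp only: matrix_vector_mul_assoc[of J] J matrix_vector_mul_lid w_def)
qed

context harmonic_bundle
begin

lemma transition_facts:
  assumes c: "c \<in> \<A>" "c' \<in> \<A>"
  defines "S \<equiv> snd c ` (fst c \<inter> fst c')"
  shows "open S" "\<And>i. C1_on S (\<lambda>x. transition c c' x $ i)"
    "\<And>x. x \<in> S \<Longrightarrow> transition c c' x = snd c' (cinv c x)"
    "\<And>x. x \<in> S \<Longrightarrow> G c x = transpose (jacobian (transition c c') x) ** G c' (transition c c' x) ** jacobian (transition c c') x"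
    "\<And>x. x \<in> S \<Longrightarrow> posdef (G c x)"
    "\<And>x. x \<in> S \<longleftrightarrow> x \<in> snd c ` fst c \<and> cinv c x \<in> fst c'"
    "\<And>x. x \<in> S \<Longrightarrow> (transition c c' has_derivative (\<lambda>v. jacobian (transition c c') x *v v)) (at x)"
proof -
  note f = chart_facts[OF c(1)]
  show Siff: "x \<in> S \<longleftrightarrow> x \<in> snd c ` fst c \<and> cinv c x \<in> fst c'" for x
  proof
    assume "x \<in> S"
    then obtain y where "y \<in> fst c" "y \<in> fst c'" "x = snd c y" by (auto simp: S_def)
    then show "x \<in> snd c ` fst c \<and> cinv c x \<in> fst c'" using f(5) by simp
  next
    assume x: "x \<in> snd c ` fst c \<and> cinv c x \<in> fst c'"
    then have "x = snd c (cinv c x)" "cinv c x \<in> fst c \<inter> fst c'" using f(6,7) by auto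
    then show "x \<in> S" unfolding S_def by (rule image_eqI)
  qed
  have "S = snd c ` fst c \<inter> cinv c -` fst c'" using Siff by auto
  then show oS: "open S" using continuous_open_preimage[OF f(4,2) chart_facts(1)[OF c(2)]] by simp
  show C1: "C1_on S (\<lambda>x. transition c c' x $ i)" for i
    using mfd c unfolding closed_C2_manifold_def S_def by (blast intro: C2_on_C1(1))
  show "transition c c' x = snd c' (cinv c x)" for x by (simp add: transition_def cinv_def)
  show "\<And>x. x \<in> S \<Longrightarrow> G c x = transpose (jacobian (transition c c') x) ** G c' (transition c c' x) ** jacobian (transition c c') x"
    using riem c unfolding C2_riemannian_metric_def S_def by blast
  show "\<And>x. x \<in> S \<Longrightarrow> posdef (G c x)"
    using metric_on_chart[OF c(1)] unfolding metric_on_def S_def by blast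
  show "\<And>x. x \<in> S \<Longrightarrow> (transition c c' has_derivative (\<lambda>v. jacobian (transition c c') x *v v)) (at x)"
    by (rule has_derivative_jacobian[OF oS _ C1])
qed

text \<open>The inner product of the gradients of two functions on \<open>K\<close>, computed in the chart \<open>c\<close>.\<close>

definition gip :: "('k, 'n) chart \<Rightarrow> ('k \<Rightarrow> real) \<Rightarrow> ('k \<Rightarrow> real) \<Rightarrow> 'k \<Rightarrow> real" where
  "gip c \<phi> \<xi> y = grad (\<lambda>x. \<phi> (cinv c x)) (snd c y) \<bullet> (matrix_inv (G c (snd c y)) *v grad (\<lambda>x. \<xi> (cinv c x)) (snd c y))"

text \<open>Only the germs of the functions at \<open>y\<close> matter. One pair is written in the chart \<open>c'\<close>, where
  differentiability is known; it carries over to \<open>c\<close> by the chain rule.\<close>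

lemma gip_chart_change:
  assumes c: "c \<in> \<A>" "c' \<in> \<A>" and y: "y \<in> fst c" "y \<in> fst c'"
    and N: "open N" "y \<in> N" "\<And>z. z \<in> N \<Longrightarrow> \<phi> z = \<phi>' z" "\<And>z. z \<in> N \<Longrightarrow> \<xi> z = \<xi>' z"
    and D: "GDERIV (\<lambda>x. \<phi>' (cinv c' x)) (snd c' y) :> D" "GDERIV (\<lambda>x. \<xi>' (cinv c' x)) (snd c' y) :> E"
  shows "gip c \<phi> \<xi> y = gip c' \<phi>' \<xi>' y"
proof -
  note f = chart_facts[OF c(1)] and f' = chart_facts[OF c(2)]
  define S where "S = snd c ` (fst c \<inter> fst c')"
  note T = transition_facts[OF c, folded S_def]
  define x where "x = snd c y"
  have xS: "x \<in> S" using y by (auto simp: x_def S_def)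
  have Tx: "transition c c' x = snd c' y" using T(3)[OF xS] f(5)[OF y(1)] by (simp add: x_def)
  define J where "J = jacobian (transition c c') x"
  have g: "grad (\<lambda>x. \<psi> (cinv c x)) x = transpose J *v F"
    if "GDERIV (\<lambda>x. \<psi>' (cinv c' x)) (snd c' y) :> F" "\<And>z. z \<in> N \<Longrightarrow> \<psi> z = \<psi>' z" for \<psi> \<psi>' :: "'k \<Rightarrow> real" and F
  proof (rule GDERIV_grad)
    have d: "GDERIV (\<lambda>x. \<psi>' (cinv c' (transition c c' x))) x :> transpose J *v F"
      by (rule GDERIV_compose_map[OF T(7)[OF xS, folded J_def]]) (use that(1) Tx in simp)
    have o: "open (S \<inter> cinv c -` N)"
      by (rule continuous_open_preimage[OF continuous_on_subset[OF f(4)] T(1) N(1)]) (auto simp: S_def)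
    show "GDERIV (\<lambda>x. \<psi> (cinv c x)) x :> transpose J *v F"
    proof (rule GDERIV_transform[OF d o])
      show "x \<in> S \<inter> cinv c -` N" using xS f(5)[OF y(1)] N(2) by (simp add: x_def)
      fix z assume z: "z \<in> S \<inter> cinv c -` N"
      then have "cinv c' (transition c c' z) = cinv c z" using T(3,6) f'(5) by simp
      then show "\<psi>' (cinv c' (transition c c' z)) = \<psi> (cinv c z)" using that(2) z by simp
    qed
  qed
  have "x \<in> snd c ` fst c" "snd c' y \<in> snd c' ` fst c'" using y by (auto simp: x_def)
  then have pd: "posdef (G c x)" "posdef (G c' (snd c' y))" using metric_on_chart c unfolding metric_on_def by blast+
  have "gip c \<phi> \<xi> y = (transpose J *v D) \<bullet> (matrix_inv (G c x) *v (transpose J *v E))"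
    unfolding gip_def x_def[symmetric] using g[OF D(1) N(3)] g[OF D(2) N(4)] by simp
  also have "\<dots> = D \<bullet> (matrix_inv (G c' (snd c' y)) *v E)"
    by (rule pairing_invariant(1)[OF pd]) (use T(4)[OF xS] Tx in \<open>simp add: J_def\<close>)
  also have "\<dots> = gip c' \<phi>' \<xi>' y"
    unfolding gip_def using GDERIV_grad[OF D(1)] GDERIV_grad[OF D(2)] by simp
  finally show ?thesis .
qed

text \<open>The integral of \<open>F\<close> for the Riemannian volume can be computed in either chart.\<close>

lemma chart_integral_change:
  assumes c: "c \<in> \<A>" "c' \<in> \<A>" and B: "open B" "bounded B" "B \<subseteq> snd c ` fst c"
    and B': "open B'" "bounded B'" "B' \<subseteq> snd c' ` fst c'"
    and F: "\<And>y. y \<notin> cinv c ` B \<inter> cinv c' ` B' \<Longrightarrow> F y = 0"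
    and int: "(\<lambda>x. sqrt (det (G c x)) * F (cinv c x)) absolutely_integrable_on B"
  shows "(\<lambda>x. sqrt (det (G c' x)) * F (cinv c' x)) absolutely_integrable_on B'"
    "integral B' (\<lambda>x. sqrt (det (G c' x)) * F (cinv c' x)) = integral B (\<lambda>x. sqrt (det (G c x)) * F (cinv c x))"
proof -
  note f = chart_facts[OF c(1)] and f' = chart_facts[OF c(2)]
  note U = cinv_image(1,2)[OF c(1) B(3)] and U' = cinv_image(1,2)[OF c(2) B'(3)]
  define S where "S = B \<inter> cinv c -` (cinv c' ` B')"
  define T where "T = transition c c'"
  define S0 where "S0 = snd c ` (fst c \<inter> fst c')"
  note T = transition_facts[OF c, folded S0_def T_def]
  have oS: "open S"
    unfolding S_def by (rule continuous_open_preimage[OF continuous_on_subset[OF f(4) B(3)] B(1) U'(2)[OF B'(1)]])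
  have SS0: "S \<subseteq> S0" using B(3) U'(1) T(6) by (auto simp: S_def)
  have Tx: "T x = snd c' (cinv c x)" "cinv c' (T x) = cinv c x" if "x \<in> S" for x
    using T(3,6) SS0 that f'(5) by auto
  have TS: "T ` S = B' \<inter> cinv c' -` (cinv c ` B)"
  proof
    show "T ` S \<subseteq> B' \<inter> cinv c' -` (cinv c ` B)"
    proof
      fix z assume "z \<in> T ` S"
      then obtain x where x: "x \<in> S" "z = T x" by blast
      then have "cinv c x \<in> cinv c' ` B'" by (simp add: S_def)
      then have "z \<in> B'" using U'(1) Tx(1)[OF x(1)] x(2) by simp
      moreover have "cinv c' z \<in> cinv c ` B" using Tx(2)[OF x(1)] x by (auto simp: S_def)
      ultimately show "z \<in> B' \<inter> cinv c' -` (cinv c ` B)" by simp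
    qed
    show "B' \<inter> cinv c' -` (cinv c ` B) \<subseteq> T ` S"
    proof
      fix z assume z: "z \<in> B' \<inter> cinv c' -` (cinv c ` B)"
      then obtain x where x: "x \<in> B" "cinv c' z = cinv c x" by auto
      have "cinv c' z \<in> cinv c' ` B'" using z by blast
      then have xS: "x \<in> S" using x by (simp add: S_def)
      have "z \<in> snd c' ` fst c'" using z B'(3) by auto
      then have "T x = z" using Tx(1)[OF xS] x(2) f'(6)[of z] by simp
      then show "z \<in> T ` S" using xS by blast
    qed
  qed
  have inj: "inj_on T S"
  proof (rule inj_onI)
    fix x z assume a: "x \<in> S" "z \<in> S" "T x = T z"
    then have e: "cinv c x = cinv c z" using Tx(2) by metis
    have "x \<in> snd c ` fst c" "z \<in> snd c ` fst c" using a B(3) unfolding S_def by blast+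
    note xz = this[THEN f(6)]
    show "x = z" by (rule trans[OF trans[OF sym[OF xz(1)] arg_cong[where f = "snd c", OF e]] xz(2)])
  qed
  define h1 where "h1 x = sqrt (det (G c x)) * F (cinv c x)" for x
  define h2 where "h2 x = sqrt (det (G c' x)) * F (cinv c' x)" for x
  have eq: "\<bar>det (matrix (\<lambda>v. jacobian T x *v v))\<bar> * h2 (T x) = h1 x" if x: "x \<in> S" for x
  proof -
    have x0: "x \<in> S0" using SS0 x by auto
    have "T x \<in> B'" using TS x by auto
    then have pT: "posdef (G c' (T x))" using metric_on_chart[OF c(2)] B'(3) unfolding metric_on_def by blast
    from pairing_invariant(2)[OF T(5)[OF x0] pT T(4)[OF x0]]
    show ?thesis by (simp add: h1_def h2_def Tx(2)[OF x] matrix_of_matrix_vector_mul)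
  qed
  have z1: "h1 x = 0" if "x \<in> B - S" for x using that F by (auto simp: h1_def S_def)
  have z2: "h2 x = 0" if "x \<in> B' - T ` S" for x using that F unfolding TS by (auto simp: h2_def)
  have h1S: "h1 absolutely_integrable_on S" "integral S h1 = integral B h1"
  proof -
    have SB: "S \<subseteq> B" by (auto simp: S_def)
    show "h1 absolutely_integrable_on S" "integral S h1 = integral B h1"
      using absolutely_integrable_support[OF SB z1] int[folded h1_def] by simp_all
  qed
  have int': "(\<lambda>x. \<bar>det (matrix (\<lambda>v. jacobian T x *v v))\<bar> * h2 (T x)) absolutely_integrable_on S"
    by (rule absolutely_integrable_transfer[OF h1S(1)]) (rule eq[symmetric])
  have bdS: "bounded S" "bounded (T ` S)"
    using B(2) B'(2) unfolding TS by (auto simp: S_def intro: bounded_subset)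
  have cv: "h2 absolutely_integrable_on (T ` S)" "integral (T ` S) h2 = integral S (\<lambda>x. \<bar>det (matrix (\<lambda>v. jacobian T x *v v))\<bar> * h2 (T x))"
    by (rule change_of_variables_cart[OF oS bdS _ inj int'], use T(7) SS0 in blast)+
  have TB: "T ` S \<subseteq> B'" unfolding TS by blast
  note sup = absolutely_integrable_support[OF TB z2]
  show "h2 absolutely_integrable_on B'" using cv(1) sup(1) by simp
  have "integral B' h2 = integral (T ` S) h2" using sup(2) by simp
  also have "\<dots> = integral S h1" unfolding cv(2) by (rule integral_cong) (rule eq)
  finally show "integral B' h2 = integral B h1" using h1S(2) by simp
qed

end

section \<open>The leafwise energy in a box\<close>

lemma cs_sequence_limit:
  fixes S :: "nat \<Rightarrow> real^'n::finite \<Rightarrow> real"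
  assumes cs: "\<And>n. cs_in (ball x0 r) C (S n)" and cont: "\<And>n. continuous_on (ball x0 r) (S n)"
    and bd: "\<And>n x. x \<in> C \<Longrightarrow> \<bar>S n x\<bar> \<le> M" "0 \<le> M"
    and lim: "\<And>x. x \<in> ball x0 r \<Longrightarrow> (\<lambda>n. S n x) \<longlonglongrightarrow> g x"
  shows "g absolutely_integrable_on ball x0 r"
    "(\<lambda>n. integral (ball x0 r) (S n)) \<longlonglongrightarrow> integral (ball x0 r) g"
proof -
  have ai: "S n absolutely_integrable_on ball x0 r" for n by (rule cs_integrable[OF cs cont])
  then have int: "S n integrable_on ball x0 r" for n by (rule absolutely_integrable_on_def[THEN iffD1, THEN conjunct1])
  have const: "(\<lambda>x. M) integrable_on ball x0 r" by (intro integrable_on_const lmeasurable_ball)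
  have le: "norm (S n x) \<le> M" if "x \<in> ball x0 r" for n x
    using cs[of n] bd(1)[of x n] bd(2) that by (cases "x \<in> C") (auto simp: cs_in_def)
  show "(\<lambda>n. integral (ball x0 r) (S n)) \<longlonglongrightarrow> integral (ball x0 r) g"
    by (rule dominated_convergence(2)[OF int const le lim])
  have gle: "norm (g x) \<le> M" if "x \<in> ball x0 r" for x
    by (rule LIMSEQ_le_const2[OF tendsto_norm[OF lim[OF that]]]) (use le[OF that] in blast)
  show "g absolutely_integrable_on ball x0 r"
    by (rule dominated_convergence_absolutely_integrable[OF ai const gle lim])
qed

lemma joint_bound:
  fixes F :: "'a::topological_space \<Rightarrow> real \<Rightarrow> real"
  assumes F: "continuous_on (B \<times> {0..1}) (\<lambda>(x, s). F x s)" and C: "compact C" "C \<subseteq> B"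
  shows "\<exists>M\<ge>0. \<forall>x\<in>C. \<forall>s\<in>{0..1}. \<bar>F x s\<bar> \<le> M"
proof -
  have "compact (C \<times> {0..1::real})" by (intro compact_Times C) simp
  moreover have "continuous_on (C \<times> {0..1}) (\<lambda>(x, s). F x s)" by (rule continuous_on_subset[OF F]) (use C in auto)
  ultimately have "bounded ((\<lambda>(x, s). F x s) ` (C \<times> {0..1}))" by (intro compact_imp_bounded compact_continuous_image)
  then obtain M where "M > 0" "\<And>v. v \<in> (\<lambda>(x, s). F x s) ` (C \<times> {0..1}) \<Longrightarrow> norm v \<le> M" unfolding bounded_pos by blast
  then show ?thesis by (intro exI[of _ M]) force
qed

locale monotone_bundle = harmonic_bundle \<A> \<L> G h
  for \<A> :: "('k::t2_space, 'n::finite) chart set" and \<L> G h +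
  assumes ends_lt: "h (undefined, 0) < h (undefined, 1)"
begin

definition "bot_val = h (undefined, 0)"
definition "top_val = h (undefined, 1)"

lemma bot: "h (y, 0) = bot_val" and top: "h (y, 1) = top_val" and bot_lt_top: "bot_val < top_val"
  unfolding bot_val_def top_val_def using boundary_constant ends_lt by auto

lemma mono: "0 \<le> s \<Longrightarrow> s \<le> t \<Longrightarrow> t \<le> 1 \<Longrightarrow> h (y, s) \<le> h (y, t)"
  by (rule h_monotone[OF less_imp_le[OF ends_lt]])

text \<open>The values of \<open>h\<close> along the plaque at height \<open>s\<close>, as a function on the base.\<close>

definition pl :: "('k, 'n) chart \<Rightarrow> (real^'n \<Rightarrow> real \<Rightarrow> real) \<Rightarrow> real \<Rightarrow> 'k \<Rightarrow> real" where
  "pl c \<sigma> s y = h (y, \<sigma> (snd c y) s)"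

text \<open>A box centred at \<open>y\<close>, chosen once and for all. In it the transverse coordinate on the fibre over \<open>y\<close> is
  the fibre coordinate.\<close>

definition box_at :: "'k \<Rightarrow> ('k, 'n) chart \<times> real \<times> (real^'n \<Rightarrow> real \<Rightarrow> real)" where
  "box_at y = (SOME p. y \<in> fst (fst p) \<and> full_box (fst p) (snd (fst p) y) (fst (snd p)) (snd (snd p)))"

abbreviation "bc y \<equiv> fst (box_at y)"
abbreviation "br y \<equiv> fst (snd (box_at y))"
abbreviation "bs y \<equiv> snd (snd (box_at y))"

lemma box_at: "y \<in> fst (bc y)" "full_box (bc y) (snd (bc y) y) (br y) (bs y)" "y \<in> cinv (bc y) ` ball (snd (bc y) y) (br y)"
proof -
  obtain c r \<sigma> where "y \<in> fst c" "full_box c (snd c y) r \<sigma>" using full_box_at[of y] by blast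
  then have "\<exists>p. y \<in> fst (fst p) \<and> full_box (fst p) (snd (fst p) y) (fst (snd p)) (snd (snd p))"
    by (intro exI[of _ "(c, r, \<sigma>)"]) simp
  from someI_ex[OF this] show "y \<in> fst (bc y)" and b: "full_box (bc y) (snd (bc y) y) (br y) (bs y)"
    unfolding box_at_def by blast+
  then show "y \<in> cinv (bc y) ` ball (snd (bc y) y) (br y)" using full_box_facts(4,7)[OF b] by blast
qed

text \<open>\<open>\<langle>\<nabla>\<phi>, \<nabla>h\<rangle>\<close> at the point \<open>(y, t)\<close>, where \<open>\<nabla>h\<close> is the leafwise gradient.\<close>

definition dpair :: "('k \<Rightarrow> real) \<Rightarrow> 'k \<Rightarrow> real \<Rightarrow> real" where
  "dpair \<phi> y t = gip (bc y) \<phi> (pl (bc y) (bs y) t) y"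

text \<open>The squared norm of the leafwise gradient of \<open>h\<close> at \<open>(y, t)\<close>.\<close>

definition denergy :: "'k \<Rightarrow> real \<Rightarrow> real" where
  "denergy y t = gip (bc y) (pl (bc y) (bs y) t) (pl (bc y) (bs y) t) y"

lemma pl_cinv: "full_box c x0 r \<sigma> \<Longrightarrow> x \<in> ball x0 r \<Longrightarrow> pl c \<sigma> s (cinv c x) = h (cinv c x, \<sigma> x s)"
  using full_box_facts(8) by (simp add: pl_def)

lemma pl_GDERIV:
  assumes b: "full_box c x0 r \<sigma>" and x: "x \<in> ball x0 r" and s: "s \<in> {0..1}"
  shows "GDERIV (\<lambda>x. pl c \<sigma> s (cinv c x)) x :> grad (\<lambda>x. h (cinv c x, \<sigma> x s)) x"
    "grad (\<lambda>x. pl c \<sigma> s (cinv c x)) x = grad (\<lambda>x. h (cinv c x, \<sigma> x s)) x"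
proof -
  show D: "GDERIV (\<lambda>x. pl c \<sigma> s (cinv c x)) x :> grad (\<lambda>x. h (cinv c x, \<sigma> x s)) x"
    by (rule GDERIV_transform[OF C1_on_GDERIV[OF C2_on_C1(1)[OF box_C2(1)[OF b s]] open_ball x] open_ball x])
      (simp add: pl_cinv[OF b])
  show "grad (\<lambda>x. pl c \<sigma> s (cinv c x)) x = grad (\<lambda>x. h (cinv c x, \<sigma> x s)) x" by (rule GDERIV_grad[OF D])
qed

text \<open>Any box can be used to compute these quantities, because plaques of two boxes through the same point
  agree near it.\<close>

lemma dpair_box:
  assumes b: "full_box c x0 r \<sigma>" and x: "x \<in> ball x0 r" and s: "s \<in> {0..1}"
  shows "GDERIV (\<lambda>x. \<phi> (cinv c x)) x :> D \<Longrightarrow> dpair \<phi> (cinv c x) (\<sigma> x s) = gip c \<phi> (pl c \<sigma> s) (cinv c x)"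
    "denergy (cinv c x) (\<sigma> x s) = gip c (pl c \<sigma> s) (pl c \<sigma> s) (cinv c x)"
proof -
  define y where "y = cinv c x"
  note B = full_box_facts[OF b]
  have xy: "snd c y = x" using B(8)[OF x] by (simp add: y_def)
  have yU: "y \<in> cinv c ` ball x0 r" using x by (simp add: y_def)
  then have yc: "y \<in> fst c" using B(7) by blast
  note b' = box_at(2)[of y] and yU' = box_at(3)[of y]
  note B' = full_box_facts[OF b']
  define t where "t = \<sigma> x s"
  have t: "t \<in> {0..1}" unfolding t_def by (rule full_box_sigma(5)[OF b x s])
  have o: "open (cinv c ` ball x0 r \<inter> cinv (bc y) ` ball (snd (bc y) y) (br y))" using B(5) B'(5) by auto
  have m: "y \<in> cinv c ` ball x0 r \<inter> cinv (bc y) ` ball (snd (bc y) y) (br y)" using yU yU' by auto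
  from small_path_connected[OF m o] obtain N where N: "open N" "y \<in> N"
     "N \<subseteq> cinv c ` ball x0 r \<inter> cinv (bc y) ` ball (snd (bc y) y) (br y)" "path_connected N"
    by blast
  have "bs y (snd (bc y) z) t = \<sigma> (snd c z) s" if "z \<in> N" for z
  proof (rule horizontal_unique[OF N(1) path_connected_imp_connected[OF N(4)] _ _ N(2) _ that])
    show "horizontal N (\<lambda>z. bs y (snd (bc y) z) t)"
      by (rule horizontal_subset[OF full_box_horizontal[OF b' t]]) (use N in blast)
    show "horizontal N (\<lambda>z. \<sigma> (snd c z) s)"
      by (rule horizontal_subset[OF full_box_horizontal[OF b s]]) (use N in blast)
    show "bs y (snd (bc y) y) t = \<sigma> (snd c y) s" using full_box_sigma(1)[OF b' t] by (simp add: xy t_def)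
  qed
  then have eq: "pl (bc y) (bs y) t z = pl c \<sigma> s z" if "z \<in> N" for z using that by (simp add: pl_def)
  note D2 = pl_GDERIV(1)[OF b x s, folded xy]
  note ch = gip_chart_change[OF B'(1) B(1) box_at(1) yc N(1,2)]
  show "denergy (cinv c x) (\<sigma> x s) = gip c (pl c \<sigma> s) (pl c \<sigma> s) (cinv c x)"
    unfolding denergy_def y_def[symmetric] t_def[symmetric] by (rule ch[OF eq eq D2 D2])
  assume "GDERIV (\<lambda>x. \<phi> (cinv c x)) x :> D"
  then have D1: "GDERIV (\<lambda>x. \<phi> (cinv c x)) (snd c y) :> D" by (simp add: xy)
  show "dpair \<phi> (cinv c x) (\<sigma> x s) = gip c \<phi> (pl c \<sigma> s) (cinv c x)"
    unfolding dpair_def y_def[symmetric] t_def[symmetric] by (rule ch[OF refl eq D1 D2])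
qed

text \<open>Some point of the fibre over \<open>y\<close> where \<open>h\<close> has the value \<open>u\<close>.\<close>

definition tsel :: "'k \<Rightarrow> real \<Rightarrow> real" where
  "tsel y u = (SOME t. t \<in> {0..1} \<and> h (y, t) = u)"

lemma tsel_h:
  assumes "t \<in> {0..1}" shows "tsel y (h (y, t)) \<in> {0..1}" "h (y, tsel y (h (y, t))) = h (y, t)"
  using someI[of "\<lambda>t'. t' \<in> {0..1} \<and> h (y, t') = h (y, t)" t] assms unfolding tsel_def by auto

text \<open>The choice made by \<^const>\<open>tsel\<close> is immaterial: plaques on which \<open>h\<close> agrees over one point carry the
  same values of \<open>h\<close> over the whole box, by \<open>box_equal_lines\<close>.\<close>

lemma dpair_sel:
  assumes b: "full_box c x0 r \<sigma>" and x: "x \<in> ball x0 r" and s: "s \<in> {0..1}"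
  shows "GDERIV (\<lambda>x. \<phi> (cinv c x)) x :> D \<Longrightarrow>
      dpair \<phi> (cinv c x) (tsel (cinv c x) (h (cinv c x, \<sigma> x s))) = gip c \<phi> (pl c \<sigma> s) (cinv c x)"
    "denergy (cinv c x) (tsel (cinv c x) (h (cinv c x, \<sigma> x s))) = gip c (pl c \<sigma> s) (pl c \<sigma> s) (cinv c x)"
proof -
  note B = full_box_facts[OF b]
  define t where "t = tsel (cinv c x) (h (cinv c x, \<sigma> x s))"
  have t: "t \<in> {0..1}" "h (cinv c x, t) = h (cinv c x, \<sigma> x s)"
    using tsel_h[OF full_box_sigma(5)[OF b x s], of "cinv c x"] by (auto simp: t_def)
  have "cinv c x \<in> cinv c ` ball x0 r" using x by blast
  from full_box_sigma(6)[OF b this t(1)] obtain s' where s': "s' \<in> {0..1}" "t = \<sigma> x s'" using B(8)[OF x] by auto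
  have e: "h (cinv c x, \<sigma> x s') = h (cinv c x, \<sigma> x s)" using t(2) s'(2) by simp
  have "h (cinv c z, \<sigma> z s') = h (cinv c z, \<sigma> z s)" if "z \<in> ball x0 r" for z
    by (rule box_equal_lines[OF less_imp_le[OF ends_lt] b s'(1) s x that e])
  then have "grad (\<lambda>x. h (cinv c x, \<sigma> x s')) x = grad (\<lambda>x. h (cinv c x, \<sigma> x s)) x"
    by (rule grad_cong_open[OF open_ball x])
  then have g: "grad (\<lambda>x. pl c \<sigma> s' (cinv c x)) (snd c (cinv c x)) = grad (\<lambda>x. pl c \<sigma> s (cinv c x)) (snd c (cinv c x))"
    using pl_GDERIV(2)[OF b x s'(1)] pl_GDERIV(2)[OF b x s] B(8)[OF x] by simp
  have "gip c (pl c \<sigma> s') (pl c \<sigma> s') (cinv c x) = gip c (pl c \<sigma> s) (pl c \<sigma> s) (cinv c x)"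
    unfolding gip_def g ..
  then show "denergy (cinv c x) (tsel (cinv c x) (h (cinv c x, \<sigma> x s))) = gip c (pl c \<sigma> s) (pl c \<sigma> s) (cinv c x)"
    using dpair_box(2)[OF b x s'(1)] by (simp add: t_def[symmetric] s'(2)[symmetric])
  assume D: "GDERIV (\<lambda>x. \<phi> (cinv c x)) x :> D"
  have "gip c \<phi> (pl c \<sigma> s') (cinv c x) = gip c \<phi> (pl c \<sigma> s) (cinv c x)"
    unfolding gip_def g ..
  then show "dpair \<phi> (cinv c x) (tsel (cinv c x) (h (cinv c x, \<sigma> x s))) = gip c \<phi> (pl c \<sigma> s) (cinv c x)"
    using dpair_box(1)[OF b x s'(1) D] by (simp add: t_def[symmetric] s'(2)[symmetric])
qed

text \<open>The pairing of \<open>\<nabla>\<phi>\<close> with the vector field \<open>\<integral> u v (y, u) du\<close>.\<close>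

definition W :: "('k \<Rightarrow> real) \<Rightarrow> 'k \<Rightarrow> real" where
  "W \<phi> y = integral {bot_val..top_val} (\<lambda>u. u * dpair \<phi> y (tsel y u))"

text \<open>The energy \<open>\<integral> \<bar>v (y, u)\<bar>\<^sup>2 du\<close>.\<close>

definition Q :: "'k \<Rightarrow> real" where
  "Q y = integral {bot_val..top_val} (\<lambda>u. denergy y (tsel y u))"

lemma box_pair:
  assumes b: "full_box c x0 r \<sigma>" and x: "x \<in> ball x0 r" and s: "s \<in> {0..1}"
  shows "GDERIV (\<lambda>x. \<phi> (cinv c x)) x :> D \<Longrightarrow>
      pair (\<lambda>x. lapA (G c x)) (\<lambda>x. \<phi> (cinv c x)) (\<lambda>x. h (cinv c x, \<sigma> x s)) x
        = sqrt (det (G c x)) * dpair \<phi> (cinv c x) (tsel (cinv c x) (h (cinv c x, \<sigma> x s)))"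
    "pair (\<lambda>x. lapA (G c x)) (\<lambda>x. h (cinv c x, \<sigma> x s)) (\<lambda>x. h (cinv c x, \<sigma> x s)) x
        = sqrt (det (G c x)) * denergy (cinv c x) (tsel (cinv c x) (h (cinv c x, \<sigma> x s)))"
  using dpair_sel[OF b x s] full_box_facts(8)[OF b x] pl_GDERIV(2)[OF b x s]
  by (simp_all add: pair_def gip_def lapA_def scaleR_matrix_vector_assoc[symmetric])

lemma box_joint_continuous:
  assumes b: "full_box c x0 r \<sigma>" and f: "C1_on (ball x0 r) f"
  shows "continuous_on (ball x0 r \<times> {0..1}) (\<lambda>(x, s). pair (\<lambda>x. lapA (G c x)) f (\<lambda>x. h (cinv c x, \<sigma> x s)) x)"
    "continuous_on (ball x0 r \<times> {0..1}) (\<lambda>(x, s). pair (\<lambda>x. lapA (G c x)) (\<lambda>x. h (cinv c x, \<sigma> x s)) (\<lambda>x. h (cinv c x, \<sigma> x s)) x)"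
proof -
  let ?D = "ball x0 r \<times> {0..1::real}"
  have g: "continuous_on ?D (\<lambda>p. grad (\<lambda>x. h (cinv c x, \<sigma> x (snd p))) (fst p))"
    unfolding grad_def using box_C2(3)[OF b] by (intro continuous_on_vec_lambda) (simp add: case_prod_unfold)
  have A: "continuous_on ?D (\<lambda>p. lapA (G c (fst p)))"
    by (rule continuous_on_compose2[OF metric_on_lapA(3)[OF metric_on_box[OF b]]]) (auto intro!: continuous_intros)
  have f': "continuous_on ?D (\<lambda>p. grad f (fst p))"
    by (rule continuous_on_compose2[OF C1_on_grad_continuous[OF f]]) (auto intro!: continuous_intros)
  show "continuous_on ?D (\<lambda>(x, s). pair (\<lambda>x. lapA (G c x)) f (\<lambda>x. h (cinv c x, \<sigma> x s)) x)"
    "continuous_on ?D (\<lambda>(x, s). pair (\<lambda>x. lapA (G c x)) (\<lambda>x. h (cinv c x, \<sigma> x s)) (\<lambda>x. h (cinv c x, \<sigma> x s)) x)"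
    unfolding pair_def case_prod_unfold
    by (intro continuous_on_inner continuous_on_matrix_vector_mult f' A g)+
qed

lemma slice_continuous:
  assumes "continuous_on (B \<times> {0..1}) (\<lambda>(x, s). F x s)" "x \<in> B"
  shows "continuous_on {0..1::real} (\<lambda>s. F x s :: real)"
proof -
  have "continuous_on {0..1} (\<lambda>s. (\<lambda>(x, s). F x s) (x, s))"
    by (rule continuous_on_compose2[OF assms(1)]) (use assms(2) in \<open>auto intro!: continuous_intros\<close>)
  then show ?thesis by simp
qed

lemma box_line:
  assumes b: "full_box c x0 r \<sigma>" and x: "x \<in> ball x0 r"
  shows "continuous_on {0..1} (\<lambda>s. h (cinv c x, \<sigma> x s))"
    "0 \<le> s \<Longrightarrow> s \<le> t \<Longrightarrow> t \<le> 1 \<Longrightarrow> h (cinv c x, \<sigma> x s) \<le> h (cinv c x, \<sigma> x t)"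
    "h (cinv c x, \<sigma> x 0) = bot_val" "h (cinv c x, \<sigma> x 1) = top_val"
proof -
  show "continuous_on {0..1} (\<lambda>s. h (cinv c x, \<sigma> x s))" by (rule slice_continuous[OF box_C2(4)[OF b] x])
  show "h (cinv c x, \<sigma> x 0) = bot_val" "h (cinv c x, \<sigma> x 1) = top_val"
    using full_box_sigma(2,3)[OF b x] bot top by auto
  assume st: "0 \<le> s" "s \<le> t" "t \<le> 1"
  have "\<sigma> x s \<le> \<sigma> x t" using full_box_sigma(4)[OF b x, of s t] st by (cases "s = t") auto
  moreover have "\<sigma> x s \<in> {0..1}" "\<sigma> x t \<in> {0..1}" using full_box_sigma(5)[OF b x] st by auto
  ultimately show "h (cinv c x, \<sigma> x s) \<le> h (cinv c x, \<sigma> x t)" by (intro mono) auto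
qed

lemma box_weight_pos:
  assumes b: "full_box c x0 r \<sigma>" and x: "x \<in> ball x0 r" shows "sqrt (det (G c x)) > 0"
  using metric_on_box[OF b] x by (simp add: metric_on_def posdef_det_pos)

text \<open>Over a fixed base point these are Stieltjes sums for \<open>A s = h (y, \<sigma> x s)\<close>. The integrands are functions
  of the value of \<open>h\<close>, up to the factor \<open>\<surd>(det g)\<close> contained in \<^const>\<open>pair\<close>.\<close>

lemma box_limits:
  assumes b: "full_box c x0 r \<sigma>" and x: "x \<in> ball x0 r" and f: "C1_on (ball x0 r) (\<lambda>x. \<phi> (cinv c x))"
  defines "a \<equiv> \<lambda>s x. h (cinv c x, \<sigma> x s)" and "P \<equiv> pair (\<lambda>x. lapA (G c x))"
  shows "(\<lambda>n. \<Sum>i<Suc n. a (grid n i) x * P (\<lambda>x. \<phi> (cinv c x)) (a (grid n i)) x * (a (grid n (Suc i)) x - a (grid n i) x))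
      \<longlonglongrightarrow> sqrt (det (G c x)) * W \<phi> (cinv c x)"
    "(\<lambda>n. \<Sum>i<Suc n. a (grid n (Suc i)) x * P (\<lambda>x. \<phi> (cinv c x)) (a (grid n (Suc i))) x * (a (grid n (Suc i)) x - a (grid n i) x))
      \<longlonglongrightarrow> sqrt (det (G c x)) * W \<phi> (cinv c x)"
    "(\<lambda>n. \<Sum>i<Suc n. P (\<lambda>x. \<phi> (cinv c x)) (a (grid n (Suc i))) x * (a (grid n (Suc i)) x - a (grid n i) x)\<^sup>2) \<longlonglongrightarrow> 0"
    "(\<lambda>n. \<Sum>i<Suc n. P (a (grid n i)) (a (grid n i)) x * (a (grid n (Suc i)) x - a (grid n i) x))
      \<longlonglongrightarrow> sqrt (det (G c x)) * Q (cinv c x)"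
    "continuous_on {bot_val..top_val} (\<lambda>u. u * dpair \<phi> (cinv c x) (tsel (cinv c x) u))"
    "continuous_on {bot_val..top_val} (\<lambda>u. denergy (cinv c x) (tsel (cinv c x) u))"
proof -
  let ?w = "sqrt (det (G c x))" and ?y = "cinv c x" and ?f = "\<lambda>x. \<phi> (cinv c x)"
  note L = box_line[OF b x, folded a_def]
  have aC: "continuous_on {0..1} (\<lambda>s. a s x)" using L(1) by (simp add: a_def)
  have am: "a s x \<le> a t x" if "0 \<le> s" "s \<le> t" "t \<le> 1" for s t using L(2)[OF that] by (simp add: a_def)
  have ae: "a 0 x = bot_val" "a 1 x = top_val" using L(3,4) by (simp_all add: a_def)
  have fD: "GDERIV ?f x :> grad ?f x" by (rule C1_on_GDERIV[OF f open_ball x])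
  have Pc: "continuous_on {0..1} (\<lambda>s. P ?f (a s) x)" "continuous_on {0..1} (\<lambda>s. P (a s) (a s) x)"
    unfolding P_def a_def
    by (rule slice_continuous[OF box_joint_continuous(1)[OF b f] x] slice_continuous[OF box_joint_continuous(2)[OF b f] x])+
  define F1 where "F1 s = a s x * P ?f (a s) x" for s
  define H1 where "H1 u = ?w * (u * dpair \<phi> ?y (tsel ?y u))" for u
  define F2 where "F2 s = P (a s) (a s) x" for s
  define H2 where "H2 u = ?w * denergy ?y (tsel ?y u)" for u
  have F1: "continuous_on {0..1} F1" unfolding F1_def by (intro continuous_intros aC Pc)
  have F2: "continuous_on {0..1} F2" unfolding F2_def by (rule Pc(2))
  have e1: "F1 s = H1 (a s x)" if "s \<in> {0..1}" for s
    using box_pair(1)[OF b x that fD] by (simp add: F1_def H1_def P_def a_def)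
  have e2: "F2 s = H2 (a s x)" if "s \<in> {0..1}" for s
    using box_pair(2)[OF b x that] by (simp add: F2_def H2_def P_def a_def)
  have I1: "integral {a 0 x..a 1 x} H1 = ?w * W \<phi> ?y" unfolding H1_def W_def ae by (rule integral_mult_right)
  have I2: "integral {a 0 x..a 1 x} H2 = ?w * Q ?y" unfolding H2_def Q_def ae by (rule integral_mult_right)
  show "(\<lambda>n. \<Sum>i<Suc n. a (grid n i) x * P ?f (a (grid n i)) x * (a (grid n (Suc i)) x - a (grid n i) x)) \<longlonglongrightarrow> ?w * W \<phi> ?y"
    using stieltjes_sum_limit[OF aC am F1 e1, of "\<lambda>n i. i"] unfolding I1 F1_def by simp
  show "(\<lambda>n. \<Sum>i<Suc n. a (grid n (Suc i)) x * P ?f (a (grid n (Suc i))) x * (a (grid n (Suc i)) x - a (grid n i) x)) \<longlonglongrightarrow> ?w * W \<phi> ?y"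
    using stieltjes_sum_limit[OF aC am F1 e1, of "\<lambda>n i. Suc i"] unfolding I1 F1_def by simp
  show "(\<lambda>n. \<Sum>i<Suc n. P ?f (a (grid n (Suc i))) x * (a (grid n (Suc i)) x - a (grid n i) x)\<^sup>2) \<longlonglongrightarrow> 0"
    by (rule stieltjes_square_limit[OF aC am Pc(1)])
  show "(\<lambda>n. \<Sum>i<Suc n. P (a (grid n i)) (a (grid n i)) x * (a (grid n (Suc i)) x - a (grid n i) x)) \<longlonglongrightarrow> ?w * Q ?y"
    using stieltjes_sum_limit[OF aC am F2 e2, of "\<lambda>n i. i"] unfolding I2 F2_def by simp
  have w: "?w \<noteq> 0" using box_weight_pos[OF b x] by simp
  have "continuous_on {bot_val..top_val} (\<lambda>u. H1 u / ?w)" "continuous_on {bot_val..top_val} (\<lambda>u. H2 u / ?w)"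
    using quotient_continuous(2)[OF aC am F1 e1] quotient_continuous(2)[OF aC am F2 e2] w
    unfolding ae by (auto intro!: continuous_intros)
  then show "continuous_on {bot_val..top_val} (\<lambda>u. u * dpair \<phi> ?y (tsel ?y u))"
    "continuous_on {bot_val..top_val} (\<lambda>u. denergy ?y (tsel ?y u))"
    using w by (simp_all add: H1_def H2_def)
qed

text \<open>This is the limit of \<open>weak_chain\<close> for the plaques at the heights \<open>i / (n + 1)\<close>. The chain starts and
  ends with constant functions since \<open>h\<close> is constant on the boundary leaves.\<close>

theorem box_energy_identity:
  assumes b: "full_box c x0 r \<sigma>" and f: "C1_on (ball x0 r) (\<lambda>x. \<phi> (cinv c x))"
    and cs: "cs_in (ball x0 r) C (\<lambda>x. \<phi> (cinv c x))"
  shows "continuous_on (ball x0 r) \<xi> \<Longrightarrow> (\<lambda>x. sqrt (det (G c x)) * (\<xi> x * W \<phi> (cinv c x))) absolutely_integrable_on ball x0 r"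
    "(\<lambda>x. sqrt (det (G c x)) * (\<phi> (cinv c x) * Q (cinv c x))) absolutely_integrable_on ball x0 r"
    "integral (ball x0 r) (\<lambda>x. sqrt (det (G c x)) * (\<phi> (cinv c x) * Q (cinv c x)))
       = - 2 * integral (ball x0 r) (\<lambda>x. sqrt (det (G c x)) * W \<phi> (cinv c x))"
proof -
  let ?B = "ball x0 r" and ?w = "\<lambda>x. sqrt (det (G c x))" and ?f = "\<lambda>x. \<phi> (cinv c x)"
  define a where "a = (\<lambda>s x. h (cinv c x, \<sigma> x s))"
  define P where "P = pair (\<lambda>x. lapA (G c x))"
  note met = metric_on_box[OF b]
  have C: "compact C" "C \<subseteq> ?B" and zf: "\<And>x. x \<in> ?B - C \<Longrightarrow> ?f x = 0" using cs by (auto simp: cs_in_def)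
  have a2: "C2_on ?B (a s)" and al: "x \<in> ?B \<Longrightarrow> laplacian (G c) (a s) x = 0" if "s \<in> {0..1}" for s x
    unfolding a_def using box_C2(1,2)[OF b that] by auto
  have g01: "grid n i \<in> {0..1}" if "i \<le> Suc n" for n i using grid_01[OF that] by simp
  have ca: "continuous_on ?B (a s)" if "s \<in> {0..1}" for s using C1_on_continuous[OF C2_on_C1(1)[OF a2[OF that]]] .
  have cPf: "continuous_on ?B (P ?f (a s))" and cPa: "continuous_on ?B (P (a s) (a s))" if "s \<in> {0..1}" for s
    unfolding P_def by (rule pair_continuous[OF met f C2_on_C1(1)[OF a2[OF that]]]
        pair_continuous[OF met C2_on_C1(1)[OF a2[OF that]] C2_on_C1(1)[OF a2[OF that]]])+
  have zP: "P ?f u x = 0" if "x \<in> ?B - C" for u x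
  proof -
    have "grad ?f x = grad (\<lambda>x. 0) x"
      by (rule grad_cong_open[of "?B - C"]) (use that zf C in \<open>auto intro: open_Diff compact_imp_closed\<close>)
    then show ?thesis by (simp add: P_def pair_def grad_const)
  qed
  define S1 where "S1 n x = (\<Sum>i<Suc n. a (grid n i) x * P ?f (a (grid n i)) x * (a (grid n (Suc i)) x - a (grid n i) x))" for n x
  define S2 where "S2 n x = (\<Sum>i<Suc n. a (grid n (Suc i)) x * P ?f (a (grid n (Suc i))) x * (a (grid n (Suc i)) x - a (grid n i) x))" for n x
  define S3 where "S3 n x = (\<Sum>i<Suc n. P ?f (a (grid n (Suc i))) x * (a (grid n (Suc i)) x - a (grid n i) x)\<^sup>2)" for n x
  define S4 where "S4 n x = (\<Sum>i<Suc n. P (a (grid n i)) (a (grid n i)) x * (a (grid n (Suc i)) x - a (grid n i) x))" for n x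
  have lim: "(\<lambda>n. S1 n x) \<longlonglongrightarrow> ?w x * W \<phi> (cinv c x)" "(\<lambda>n. S2 n x) \<longlonglongrightarrow> ?w x * W \<phi> (cinv c x)"
     "(\<lambda>n. S3 n x) \<longlonglongrightarrow> 0" "(\<lambda>n. S4 n x) \<longlonglongrightarrow> ?w x * Q (cinv c x)" if "x \<in> ?B" for x
    using box_limits(1-4)[OF b that f] unfolding S1_def S2_def S3_def S4_def P_def a_def by auto
  have cont: "continuous_on ?B (S1 n)" "continuous_on ?B (S2 n)" "continuous_on ?B (S3 n)" "continuous_on ?B (S4 n)" for n
    unfolding S1_def[abs_def] S2_def[abs_def] S3_def[abs_def] S4_def[abs_def]
    by (intro continuous_intros ca cPf cPa g01; simp)+
  have zS: "S1 n x = 0" "S2 n x = 0" "S3 n x = 0" if "x \<in> ?B - C" for n x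
    using zP[OF that] by (simp_all add: S1_def S2_def S3_def)
  have j1: "continuous_on (?B \<times> {0..1}) (\<lambda>(x, s). a s x * P ?f (a s) x)"
  proof -
    have "continuous_on (?B \<times> {0..1}) (\<lambda>p. (case p of (x, s) \<Rightarrow> a s x) * (case p of (x, s) \<Rightarrow> P ?f (a s) x))"
      by (intro continuous_on_mult) (use box_C2(4)[OF b] box_joint_continuous(1)[OF b f] in \<open>auto simp: a_def P_def\<close>)
    then show ?thesis by (simp add: case_prod_unfold)
  qed
  obtain M1 where M1: "M1 \<ge> 0" "\<And>x s. x \<in> C \<Longrightarrow> s \<in> {0..1} \<Longrightarrow> \<bar>a s x * P ?f (a s) x\<bar> \<le> M1"
    using joint_bound[OF j1 C] by blast
  have j2: "continuous_on (?B \<times> {0..1}) (\<lambda>(x, s). P ?f (a s) x)"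
    using box_joint_continuous(1)[OF b f] by (simp add: P_def a_def)
  have j3: "continuous_on (?B \<times> {0..1}) (\<lambda>(x, s). P (a s) (a s) x)"
    using box_joint_continuous(2)[OF b f] by (simp add: P_def a_def)
  obtain M2 where M2: "M2 \<ge> 0" "\<And>x s. x \<in> C \<Longrightarrow> s \<in> {0..1} \<Longrightarrow> \<bar>P ?f (a s) x\<bar> \<le> M2"
    using joint_bound[OF j2 C] by blast
  obtain M3 where M3: "M3 \<ge> 0" "\<And>x s. x \<in> C \<Longrightarrow> s \<in> {0..1} \<Longrightarrow> \<bar>P (a s) (a s) x\<bar> \<le> M3"
    using joint_bound[OF j3 C] by blast
  have cmp: "\<exists>M\<ge>0. \<forall>x\<in>C. \<bar>k x\<bar> \<le> M" if "continuous_on ?B k" for k :: "real^'n \<Rightarrow> real"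
  proof -
    have "bounded (k ` C)" using that C by (meson compact_continuous_image compact_imp_bounded continuous_on_subset)
    then show ?thesis unfolding bounded_pos by (auto intro: less_imp_le)
  qed
  define d where "d = top_val - bot_val"
  have d: "d > 0" using bot_lt_top by (simp add: d_def)
  have bds: "\<bar>S1 n x\<bar> \<le> M1 * d \<and> \<bar>S2 n x\<bar> \<le> M1 * d \<and> \<bar>S3 n x\<bar> \<le> M2 * d * d \<and> \<bar>S4 n x\<bar> \<le> M3 * d" if x: "x \<in> C" for n x
  proof -
    have xB: "x \<in> ?B" using x C by blast
    note L = box_line[OF b xB]
    have am: "a s x \<le> a t x" if "0 \<le> s" "s \<le> t" "t \<le> 1" for s t using L(2)[OF that] by (simp add: a_def)
    have ae: "a 0 x = bot_val" "a 1 x = top_val" using L(3,4) by (simp_all add: a_def)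
    have step: "a (grid n (Suc i)) x - a (grid n i) x \<le> d" if "i < Suc n" for i
    proof -
      have "a (grid n (Suc i)) x \<le> a 1 x" "a 0 x \<le> a (grid n i) x"
        using grid_01[of "Suc i" n] grid_01[of i n] that by (intro am; simp)+
      then show ?thesis using ae by (simp add: d_def)
    qed
    note sb = stieltjes_sum_bound[of "\<lambda>s. a s x", OF am _ _ step, unfolded ae d_def[symmetric]]
    show ?thesis
      unfolding S1_def S2_def S3_def S4_def
      using sb(1)[of "\<lambda>s. a s x * P ?f (a s) x" M1 "\<lambda>i. i"] sb(1)[of "\<lambda>s. a s x * P ?f (a s) x" M1 Suc]
        sb(2)[of "\<lambda>s. P ?f (a s) x" M2 Suc] sb(1)[of "\<lambda>s. P (a s) (a s) x" M3 "\<lambda>i. i"]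
        M1(2)[OF x] M2(2)[OF x] M3(2)[OF x] by simp
  qed
  show A1: "(\<lambda>x. ?w x * (\<xi> x * W \<phi> (cinv c x))) absolutely_integrable_on ?B" if \<xi>: "continuous_on ?B \<xi>" for \<xi>
  proof -
    obtain K where K: "K \<ge> 0" "\<And>x. x \<in> C \<Longrightarrow> \<bar>\<xi> x\<bar> \<le> K" using cmp[OF \<xi>] by blast
    show ?thesis
    proof (rule cs_sequence_limit(1)[of x0 r C "\<lambda>n x. \<xi> x * S1 n x" "K * (M1 * d)"])
      show "cs_in ?B C (\<lambda>x. \<xi> x * S1 n x)" for n using zS C by (auto simp: cs_in_def)
      show "continuous_on ?B (\<lambda>x. \<xi> x * S1 n x)" for n by (intro continuous_intros \<xi> cont)
      show "\<bar>\<xi> x * S1 n x\<bar> \<le> K * (M1 * d)" if "x \<in> C" for n x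
        unfolding abs_mult using K bds[OF that, of n] M1(1) that by (intro mult_mono) auto
      show "0 \<le> K * (M1 * d)" using K M1 d by simp
      show "(\<lambda>n. \<xi> x * S1 n x) \<longlonglongrightarrow> ?w x * (\<xi> x * W \<phi> (cinv c x))" if "x \<in> ?B" for x
        using tendsto_mult_left[OF lim(1)[OF that], of "\<xi> x"] by (simp add: mult_ac)
    qed
  qed
  have A1': "(\<lambda>x. ?w x * W \<phi> (cinv c x)) absolutely_integrable_on ?B"
    using A1[of "\<lambda>_. 1"] by simp
  obtain K where K: "K \<ge> 0" "\<And>x. x \<in> C \<Longrightarrow> \<bar>?f x\<bar> \<le> K" using cmp[OF C1_on_continuous[OF f]] by blast
  show A2: "(\<lambda>x. ?w x * (\<phi> (cinv c x) * Q (cinv c x))) absolutely_integrable_on ?B"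
  proof (rule cs_sequence_limit(1)[of x0 r C "\<lambda>n x. ?f x * S4 n x" "K * (M3 * d)"])
    show "cs_in ?B C (\<lambda>x. ?f x * S4 n x)" for n using zf C by (auto simp: cs_in_def)
    show "continuous_on ?B (\<lambda>x. ?f x * S4 n x)" for n by (intro continuous_intros C1_on_continuous[OF f] cont)
    show "\<bar>?f x * S4 n x\<bar> \<le> K * (M3 * d)" if "x \<in> C" for n x
      unfolding abs_mult using K bds[OF that, of n] M3(1) that by (intro mult_mono) auto
    show "0 \<le> K * (M3 * d)" using K M3 d by simp
    show "(\<lambda>n. ?f x * S4 n x) \<longlonglongrightarrow> ?w x * (\<phi> (cinv c x) * Q (cinv c x))" if "x \<in> ?B" for x
      using tendsto_mult_left[OF lim(4)[OF that], of "?f x"] by (simp add: mult_ac)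
  qed
  \<comment> \<open>the integrand of \<open>weak_chain\<close>, with integral zero; its limit is \<open>\<surd>(det g) (4 W \<phi> + 2 \<phi> Q)\<close>\<close>
  define T where "T n x = 2 * S1 n x + 2 * S2 n x - S3 n x + 2 * ?f x * S4 n x" for n x
  have ends: "grad (a 0) x = 0" "grad (a 1) x = 0" if x: "x \<in> ?B" for x
  proof -
    have "grad (a 0) x = grad (\<lambda>_. bot_val) x"
      by (rule grad_cong_open[OF open_ball x]) (simp add: a_def box_line(3)[OF b])
    moreover have "grad (a 1) x = grad (\<lambda>_. top_val) x"
      by (rule grad_cong_open[OF open_ball x]) (simp add: a_def box_line(4)[OF b])
    ultimately show "grad (a 0) x = 0" "grad (a 1) x = 0" by (simp_all add: grad_const)
  qed
  have T0: "integral ?B (T n) = 0" for n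
  proof -
    have "(T n has_integral 0) ?B"
      unfolding T_def[abs_def] S1_def S2_def S3_def S4_def P_def
      by (rule weak_chain[where a = "\<lambda>i. a (grid n i)" and N = "Suc n", OF met _ _ _ _ cs f])
        (use a2 al g01 ends in auto)
    then show ?thesis by (rule integral_unique)
  qed
  have "(\<lambda>n. integral ?B (T n)) \<longlonglongrightarrow> integral ?B (\<lambda>x. 4 * (?w x * W \<phi> (cinv c x)) + 2 * (?w x * (?f x * Q (cinv c x))))"
  proof (rule cs_sequence_limit(2)[of x0 r C T "2 * (M1 * d) + 2 * (M1 * d) + M2 * d * d + 2 * (K * (M3 * d))"])
    show "cs_in ?B C (T n)" for n using zS zf C by (auto simp: cs_in_def T_def)
    show "continuous_on ?B (T n)" for n
      unfolding T_def by (intro continuous_intros C1_on_continuous[OF f] cont)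
    show "\<bar>T n x\<bar> \<le> 2 * (M1 * d) + 2 * (M1 * d) + M2 * d * d + 2 * (K * (M3 * d))" if "x \<in> C" for n x
    proof -
      have "\<bar>?f x * S4 n x\<bar> \<le> K * (M3 * d)"
        unfolding abs_mult using K bds[OF that, of n] M3(1) that by (intro mult_mono) auto
      then show ?thesis using bds[OF that, of n] by (simp add: T_def abs_le_iff mult.assoc)
    qed
    show "0 \<le> 2 * (M1 * d) + 2 * (M1 * d) + M2 * d * d + 2 * (K * (M3 * d))"
      using K M1 M2 M3 d by simp
    show "(\<lambda>n. T n x) \<longlonglongrightarrow> 4 * (?w x * W \<phi> (cinv c x)) + 2 * (?w x * (?f x * Q (cinv c x)))" if "x \<in> ?B" for x
    proof -
      have "(\<lambda>n. T n x) \<longlonglongrightarrow> 2 * (?w x * W \<phi> (cinv c x)) + 2 * (?w x * W \<phi> (cinv c x)) - 0 + 2 * ?f x * (?w x * Q (cinv c x))"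
        unfolding T_def by (intro tendsto_intros lim[OF that])
      then show ?thesis by (simp add: algebra_simps)
    qed
  qed
  then have "integral ?B (\<lambda>x. 4 * (?w x * W \<phi> (cinv c x)) + 2 * (?w x * (?f x * Q (cinv c x)))) = 0"
    unfolding T0 by (simp add: LIMSEQ_const_iff)
  moreover have "integral ?B (\<lambda>x. 4 * (?w x * W \<phi> (cinv c x)) + 2 * (?w x * (?f x * Q (cinv c x))))
     = 4 * integral ?B (\<lambda>x. ?w x * W \<phi> (cinv c x)) + 2 * integral ?B (\<lambda>x. ?w x * (?f x * Q (cinv c x)))"
  proof -
    have i: "(\<lambda>x. ?w x * W \<phi> (cinv c x)) integrable_on ?B" "(\<lambda>x. ?w x * (?f x * Q (cinv c x))) integrable_on ?B"
      using A1' A2 by (auto simp: absolutely_integrable_on_def)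
    show ?thesis
      using integral_add[OF integrable_on_mult_right[OF i(1), of 4] integrable_on_mult_right[OF i(2), of 2]] by simp
  qed
  ultimately show "integral ?B (\<lambda>x. ?w x * (\<phi> (cinv c x) * Q (cinv c x))) = - 2 * integral ?B (\<lambda>x. ?w x * W \<phi> (cinv c x))"
    by simp
qed

end

section \<open>Partition of unity and the global energy identity\<close>

definition bump :: "real^'n::finite \<Rightarrow> real \<Rightarrow> real^'n \<Rightarrow> real" where
  "bump x0 r x = (max 0 (r\<^sup>2 - (x - x0) \<bullet> (x - x0)))\<^sup>2"

lemma DERIV_max_square: "DERIV (\<lambda>t::real. (max 0 t)\<^sup>2) t :> 2 * max 0 t"
proof -
  consider "t < 0" | "t > 0" | "t = 0" by linarith
  then show ?thesis
  proof cases
    case 1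
    have "DERIV (\<lambda>t::real. 0) t :> 2 * max 0 t" using 1 by simp
    then show ?thesis
      by (rule has_field_derivative_transform_within_open[where S = "{..<0}"]) (use 1 in auto)
  next
    case 2
    have "DERIV (\<lambda>t::real. t\<^sup>2) t :> 2 * max 0 t" using 2 by (auto intro!: derivative_eq_intros)
    then show ?thesis
      by (rule has_field_derivative_transform_within_open[where S = "{0<..}"]) (use 2 in auto)
  next
    case 3
    have "((\<lambda>s::real. (max 0 s)\<^sup>2 / s) \<longlongrightarrow> 0) (at 0)"
    proof (rule tendsto_rabs_zero_cancel, rule tendsto_sandwich[of "\<lambda>_. 0" _ _ abs])
      show "\<forall>\<^sub>F s::real in at 0. \<bar>(max 0 s)\<^sup>2 / s\<bar> \<le> \<bar>s\<bar>"
        by (intro always_eventually) (auto simp: max_def power2_eq_square)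
      show "(abs \<longlongrightarrow> 0) (at (0::real))" using tendsto_rabs[OF tendsto_ident_at[of "0::real" UNIV]] by simp
    qed auto
    then show ?thesis using 3 by (simp add: has_field_derivative_iff)
  qed
qed

lemma C1_on_bump: "C1_on UNIV (bump x0 r)"
proof -
  have g: "GDERIV (\<lambda>x. r\<^sup>2 - (x - x0) \<bullet> (x - x0)) x :> (- 2) *\<^sub>R (x - x0)" for x
    unfolding gderiv_def by (auto intro!: derivative_eq_intros simp: inner_commute algebra_simps)
  have "C1_on UNIV (\<lambda>x. r\<^sup>2 - (x - x0) \<bullet> (x - x0))"
    by (rule C1_onI[OF _ g]) (auto intro!: continuous_intros)
  then have "C1_on UNIV (\<lambda>x. (max 0 (r\<^sup>2 - (x - x0) \<bullet> (x - x0)))\<^sup>2)"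
    by (rule C1_on_compose_real[OF open_UNIV, where g = "\<lambda>t. (max 0 t)\<^sup>2" and g' = "\<lambda>t. 2 * max 0 t"])
      (auto intro!: DERIV_max_square continuous_intros)
  then show ?thesis by (simp add: bump_def[abs_def])
qed

lemma bump_pos_iff: "r > 0 \<Longrightarrow> bump x0 r x > 0 \<longleftrightarrow> x \<in> ball x0 r"
proof -
  assume r: "r > 0"
  have "(x - x0) \<bullet> (x - x0) = (dist x0 x)\<^sup>2"
    by (simp add: dist_norm power2_norm_eq_inner norm_minus_commute)
  then have "bump x0 r x > 0 \<longleftrightarrow> (dist x0 x)\<^sup>2 < r\<^sup>2" by (auto simp: bump_def max_def)
  also have "\<dots> \<longleftrightarrow> dist x0 x < r" using r by (auto intro: power_strict_mono power2_less_imp_less)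
  finally show ?thesis by simp
qed

lemma bump_nonneg: "bump x0 r x \<ge> 0"
  by (simp add: bump_def)

lemma C1_on_compose_map:
  fixes T :: "real^'n::finite \<Rightarrow> real^'n"
  assumes S: "open S" and T: "\<And>i. C1_on S (\<lambda>x. T x $ i)" and F: "C1_on UNIV F"
  shows "C1_on S (\<lambda>x. F (T x))"
proof (rule C1_onI[OF S])
  show "GDERIV (\<lambda>x. F (T x)) x :> transpose (jacobian T x) *v grad F (T x)" if "x \<in> S" for x
    by (rule GDERIV_compose_map[OF has_derivative_jacobian[OF S that T] C1_on_GDERIV[OF F open_UNIV]]) simp
  have cT: "continuous_on S T"
    using continuous_on_vec_lambda[of S "\<lambda>i x. T x $ i"] C1_on_continuous[OF T] by simp
  have "continuous_on S (\<lambda>x. pd j (\<lambda>y. T y $ i) x)" for i j using T[of i] by (simp add: C1_on_def)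
  then have "continuous_on S (\<lambda>x. transpose (jacobian T x))"
    unfolding transpose_def jacobian_def by (simp add: continuous_on_vec_lambda)
  then show "continuous_on S (\<lambda>x. transpose (jacobian T x) *v grad F (T x))"
    by (intro continuous_on_matrix_vector_mult continuous_on_compose2[OF C1_on_grad_continuous[OF F] cT]) auto
qed

lemma GDERIV_sum:
  assumes "\<And>i. i \<in> I \<Longrightarrow> GDERIV (f i) x :> D i"
  shows "GDERIV (\<lambda>x. \<Sum>i\<in>I. f i x) x :> (\<Sum>i\<in>I. D i)"
  using assms by (induction I rule: infinite_finite_induct) (auto intro: GDERIV_const GDERIV_add)

lemma nonneg_integral_zero_dense:
  fixes f :: "'a::euclidean_space \<Rightarrow> real"
  assumes f: "f absolutely_integrable_on S" "\<And>x. x \<in> S \<Longrightarrow> f x \<ge> 0" "integral S f = 0"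
    and O': "open O'" "O' \<subseteq> S" "O' \<noteq> {}"
  shows "\<exists>x\<in>O'. f x = 0"
proof (rule ccontr)
  assume n: "\<not> (\<exists>x\<in>O'. f x = 0)"
  have si: "set_integrable lebesgue S f" using f(1) .
  have "integral\<^sup>L lebesgue (\<lambda>x. indicator S x *\<^sub>R f x) = 0"
    using set_lebesgue_integral_eq_integral(2)[OF si] f(3) by (simp add: set_lebesgue_integral_def)
  moreover have "integrable lebesgue (\<lambda>x. indicator S x *\<^sub>R f x)" using si by (simp add: set_integrable_def)
  moreover have "AE x in lebesgue. 0 \<le> indicator S x *\<^sub>R f x" using f(2) by (auto simp: indicator_def)
  ultimately have "AE x in lebesgue. indicator S x *\<^sub>R f x = 0"
    using integral_nonneg_eq_0_iff_AE by blast
  then obtain N where N: "negligible N" "{x. \<not> indicat_real S x *\<^sub>R f x = 0} \<subseteq> N"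
    unfolding eventually_ae_filter_negligible by (elim exE conjE)
  have "O' \<subseteq> N"
  proof
    fix x assume "x \<in> O'"
    then have "indicat_real S x *\<^sub>R f x \<noteq> 0" using n O'(2) by (auto simp: indicator_def)
    then show "x \<in> N" using N(2) by blast
  qed
  then have "negligible O'" using N(1) negligible_subset by blast
  then show False using open_not_negligible[OF O'(1,3)] by blast
qed

context monotone_bundle
begin

abbreviation "xk k \<equiv> snd (bc k) k"

text \<open>Concentric parts of the box at \<open>k\<close>: the bump functions are positive exactly on the open half boxes and
  supported in their closures, which are compact in the whole boxes.\<close>

definition half :: "'k \<Rightarrow> 'k set" where "half k = cinv (bc k) ` ball (xk k) (br k / 2)"
definition core :: "'k \<Rightarrow> 'k set" where "core k = cinv (bc k) ` cball (xk k) (br k / 2)"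
definition whole :: "'k \<Rightarrow> 'k set" where "whole k = cinv (bc k) ` ball (xk k) (br k)"

text \<open>The bump function of the half box at \<open>k\<close>, extended by zero to the points outside the box, where the
  coordinate map has no meaning.\<close>

definition eta :: "'k \<Rightarrow> 'k \<Rightarrow> real" where
  "eta k y = (if y \<in> whole k then bump (xk k) (br k / 2) (snd (bc k) y) else 0)"

lemma half_facts:
  shows "br k > 0" "bc k \<in> \<A>" "cball (xk k) (br k / 2) \<subseteq> ball (xk k) (br k)"
    "open (half k)" "k \<in> half k" "closed (core k)" "half k \<subseteq> core k" "core k \<subseteq> whole k" "open (whole k)"
    "y \<in> half k \<longleftrightarrow> y \<in> fst (bc k) \<and> snd (bc k) y \<in> ball (xk k) (br k / 2)"
    "y \<in> core k \<longleftrightarrow> y \<in> fst (bc k) \<and> snd (bc k) y \<in> cball (xk k) (br k / 2)"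
    "y \<in> whole k \<longleftrightarrow> y \<in> fst (bc k) \<and> snd (bc k) y \<in> ball (xk k) (br k)"
proof -
  note B = full_box_facts[OF box_at(2)[of k]]
  show r: "br k > 0" and c: "bc k \<in> \<A>" using B by auto
  show sub: "cball (xk k) (br k / 2) \<subseteq> ball (xk k) (br k)" using r by auto
  have s1: "ball (xk k) (br k / 2) \<subseteq> snd (bc k) ` fst (bc k)" "cball (xk k) (br k / 2) \<subseteq> snd (bc k) ` fst (bc k)"
    using B(3) sub ball_subset_cball by blast+
  note I1 = cinv_image[OF c s1(1)] and I2 = cinv_image[OF c s1(2)]
  show h: "y \<in> half k \<longleftrightarrow> y \<in> fst (bc k) \<and> snd (bc k) y \<in> ball (xk k) (br k / 2)" for y
    unfolding half_def by (rule I1(1))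
  show "y \<in> core k \<longleftrightarrow> y \<in> fst (bc k) \<and> snd (bc k) y \<in> cball (xk k) (br k / 2)"
    unfolding core_def by (rule I2(1))
  show "y \<in> whole k \<longleftrightarrow> y \<in> fst (bc k) \<and> snd (bc k) y \<in> ball (xk k) (br k)"
    unfolding whole_def by (rule B(7))
  show "open (half k)" unfolding half_def by (rule I1(2)[OF open_ball])
  show "open (whole k)" unfolding whole_def by (rule B(5))
  show "k \<in> half k" using h[of k] box_at(1)[of k] r by simp
  show "closed (core k)"
    unfolding core_def
    by (intro compact_imp_closed compact_continuous_image continuous_on_subset[OF chart_facts(4)[OF c] s1(2)] compact_cball)
  show "half k \<subseteq> core k" unfolding half_def core_def using ball_subset_cball by (rule image_mono)
  show "core k \<subseteq> whole k" unfolding whole_def core_def using sub by (rule image_mono)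
qed

lemma eta_facts: "eta k y \<ge> 0" "eta k y > 0 \<longleftrightarrow> y \<in> half k" "y \<notin> core k \<Longrightarrow> eta k y = 0"
proof -
  have r: "br k / 2 > 0" using half_facts(1)[of k] by simp
  show n: "eta k y \<ge> 0" by (simp add: eta_def bump_nonneg)
  show p: "eta k y > 0 \<longleftrightarrow> y \<in> half k"
    using bump_pos_iff[OF r, of "xk k" "snd (bc k) y"] half_facts(7,8)[of k] half_facts(10,12)[of y k] by (auto simp: eta_def)
  show "eta k y = 0" if "y \<notin> core k" using p n that half_facts(7)[of k] by force
qed

lemma eta_C1:
  assumes b: "full_box c x0 r \<sigma>"
  shows "C1_on (ball x0 r) (\<lambda>x. eta k (cinv c x))"
proof (rule C1_on_local[OF open_ball])
  fix x assume x: "x \<in> ball x0 r"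
  note B = full_box_facts[OF b] and H = half_facts[of k]
  note T = transition_facts[OF B(1) H(2)]
  have cc: "continuous_on (ball x0 r) (cinv c)" by (rule continuous_on_subset[OF chart_facts(4)[OF B(1)] B(3)])
  show "\<exists>N. open N \<and> x \<in> N \<and> C1_on N (\<lambda>x. eta k (cinv c x))"
  proof (cases "cinv c x \<in> whole k")
    case True
    define N where "N = ball x0 r \<inter> cinv c -` whole k"
    have o: "open N" unfolding N_def by (rule continuous_open_preimage[OF cc open_ball H(9)])
    have NS: "N \<subseteq> snd c ` (fst c \<inter> fst (bc k))"
      using T(6) B(3) half_facts(12)[of _ k] by (auto simp: N_def)
    have "C1_on N (\<lambda>z. bump (xk k) (br k / 2) (transition c (bc k) z))"
      by (rule C1_on_compose_map[OF o C1_on_subset[OF T(2) NS] C1_on_bump])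
    then have "C1_on N (\<lambda>x. eta k (cinv c x))"
      by (rule C1_on_cong[OF o, rotated]) (use NS T(3) in \<open>auto simp: N_def eta_def\<close>)
    then show ?thesis using o x True by (auto simp: N_def)
  next
    case False
    define N where "N = ball x0 r \<inter> cinv c -` (- core k)"
    have o: "open N" unfolding N_def by (rule continuous_open_preimage[OF cc open_ball]) (use H(6) in auto)
    have "C1_on N (\<lambda>x. eta k (cinv c x))"
      by (rule C1_on_cong[OF o _ C1_on_const[OF o, of 0]]) (simp add: N_def eta_facts(3))
    moreover have "x \<in> N" using x False H(8) unfolding N_def by blast
    ultimately show ?thesis using o by blast
  qed
qed

text \<open>Let \<open>\<rho>\<^sub>k\<close> be a partition of unity. The energy identity for the test functions \<open>\<rho>\<^sub>k\<close> gives
  \<open>\<Sum>\<^sub>k \<integral> \<rho>\<^sub>k Q = - 2 \<Sum>\<^sub>k \<integral> W \<rho>\<^sub>k\<close>. On the right each term is split by the partition once more and moved to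
  the chart of the second index, where the sum over \<open>k\<close> is \<open>W 1 = 0\<close>. So the nonnegative function \<open>Q\<close>
  vanishes almost everywhere, which leaves a dense set of base points over which the leafwise gradient
  of \<open>h\<close> vanishes on the whole fibre. By continuity it vanishes everywhere.\<close>

theorem energy_contradiction: "False"
proof -
  have "compact (UNIV :: 'k set)" using mfd by (simp add: closed_C2_manifold_def)
  then obtain Y where Y: "finite Y" "UNIV \<subseteq> (\<Union>k\<in>Y. half k)"
    using compactE_image[of UNIV UNIV half] half_facts(4,5) by (metis UNIV_I UN_iff subsetI)
  define E where "E y = (\<Sum>k\<in>Y. eta k y)" for y
  have Epos: "E y > 0" for y
  proof -
    obtain k where k: "k \<in> Y" "y \<in> half k" using Y(2) by blast
    show ?thesis unfolding E_def
      by (rule sum_pos2[OF Y(1) k(1)]) (use k eta_facts in auto)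
  qed
  define rho where "rho k y = eta k y / E y" for k y
  have rho0: "rho k y \<ge> 0" "y \<notin> core k \<Longrightarrow> rho k y = 0" "rho k y > 0 \<longleftrightarrow> y \<in> half k" for k y
    using eta_facts(1,2)[of k y] eta_facts(3)[of y k] Epos[of y]
    by (auto simp: rho_def zero_less_divide_iff less_imp_le)
  have rho1: "(\<Sum>k\<in>Y. rho k y) = 1" for y
    using Epos[of y] by (simp add: rho_def E_def sum_divide_distrib[symmetric])
  have rhoC1: "C1_on (ball x0 r) (\<lambda>x. rho k (cinv c x))" if b: "full_box c x0 r \<sigma>" for c x0 r \<sigma> k
    unfolding rho_def
  proof (rule C1_on_divide[OF open_ball eta_C1[OF b]])
    show "C1_on (ball x0 r) (\<lambda>x. E (cinv c x))"
      unfolding E_def by (rule C1_on_sum[OF open_ball eta_C1[OF b]])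
    show "E (cinv c x) \<noteq> 0" for x using Epos[of "cinv c x"] by simp
  qed
  have cs: "cs_in (ball (xk k) (br k)) (cball (xk k) (br k / 2)) (\<lambda>x. rho k (cinv (bc k) x))" for k
    unfolding cs_in_def
  proof (intro conjI ballI)
    fix x assume x: "x \<in> ball (xk k) (br k) - cball (xk k) (br k / 2)"
    then have "snd (bc k) (cinv (bc k) x) = x" using full_box_facts(8)[OF box_at(2)[of k]] by blast
    then have "cinv (bc k) x \<notin> core k" using half_facts(11)[of "cinv (bc k) x" k] x by simp
    then show "rho k (cinv (bc k) x) = 0" by (rule rho0(2))
  qed (use half_facts(3) in auto)
  have centre: "xk y \<in> ball (xk y) (br y)" "cinv (bc y) (xk y) = y" for y
    using half_facts(1)[of y] full_box_facts(9)[OF box_at(2,3)[of y]] by auto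
  have rhoD: "GDERIV (\<lambda>x. rho k (cinv (bc y) x)) (xk y) :> grad (\<lambda>x. rho k (cinv (bc y) x)) (xk y)" for k y
    by (rule C1_on_GDERIV[OF rhoC1[OF box_at(2)] open_ball centre(1)])
  have Wzero: "W (rho k) y = 0" if y: "y \<notin> whole k" for k y
  proof -
    define N where "N = ball (xk y) (br y) \<inter> cinv (bc y) -` (- core k)"
    note B = full_box_facts[OF box_at(2)[of y]]
    have o: "open N" unfolding N_def
      by (rule continuous_open_preimage[OF continuous_on_subset[OF chart_facts(4)[OF B(1)] B(3)] open_ball])
        (use half_facts(6)[of k] in auto)
    have "grad (\<lambda>x. rho k (cinv (bc y) x)) (xk y) = grad (\<lambda>_. 0) (xk y)"
      by (rule grad_cong_open[OF o]) (use centre[of y] y half_facts(8)[of k] rho0(2) in \<open>auto simp: N_def\<close>)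
    then have "dpair (rho k) y t = 0" for t by (simp add: dpair_def gip_def grad_const)
    then show ?thesis by (simp add: W_def)
  qed
  \<comment> \<open>\<open>W\<close> is additive, and the gradient of the constant \<open>1\<close> vanishes\<close>
  have Wsum: "(\<Sum>k\<in>Y. W (rho k) y) = 0" for y
  proof -
    have "GDERIV (\<lambda>x. \<Sum>k\<in>Y. rho k (cinv (bc y) x)) (xk y) :> (\<Sum>k\<in>Y. grad (\<lambda>x. rho k (cinv (bc y) x)) (xk y))"
      by (rule GDERIV_sum) (rule rhoD)
    then have "(\<Sum>k\<in>Y. grad (\<lambda>x. rho k (cinv (bc y) x)) (xk y)) = grad (\<lambda>_. 1) (xk y)"
      unfolding rho1 by (rule GDERIV_grad[symmetric])
    then have s0: "(\<Sum>k\<in>Y. grad (\<lambda>x. rho k (cinv (bc y) x)) (xk y)) = 0" by (simp add: grad_const)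
    have dp: "(\<Sum>k\<in>Y. dpair (rho k) y t) = 0" for t
      unfolding dpair_def gip_def inner_sum_left[symmetric] s0 by simp
    have "(\<Sum>k\<in>Y. W (rho k) y) = integral {bot_val..top_val} (\<lambda>u. \<Sum>k\<in>Y. u * dpair (rho k) y (tsel y u))"
      unfolding W_def
    proof (rule integral_sum[OF Y(1), symmetric])
      fix k
      have "continuous_on {bot_val..top_val} (\<lambda>u. u * dpair (rho k) y (tsel y u))"
        using box_limits(5)[OF box_at(2) centre(1) rhoC1[OF box_at(2)], of k y] by (simp add: centre(2))
      then show "(\<lambda>u. u * dpair (rho k) y (tsel y u)) integrable_on {bot_val..top_val}"
        by (rule integrable_continuous_interval)
    qed
    also have "\<dots> = 0" by (simp add: sum_distrib_left[symmetric] dp)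
    finally show ?thesis .
  qed
  define B where "B k = ball (xk k) (br k)" for k
  define wt where "wt k x = sqrt (det (G (bc k) x))" for k x
  note BEI = box_energy_identity[OF box_at(2) rhoC1[OF box_at(2)] cs, folded B_def wt_def]
  define I where "I k = integral (B k) (\<lambda>x. wt k x * (rho k (cinv (bc k) x) * Q (cinv (bc k) x)))" for k
  \<comment> \<open>the integrand is supported in the boxes at \<open>k\<close> and at \<open>l\<close>\<close>
  have ch: "(\<lambda>x. wt l x * (rho l (cinv (bc l) x) * W (rho k) (cinv (bc l) x))) absolutely_integrable_on B l"
     "integral (B l) (\<lambda>x. wt l x * (rho l (cinv (bc l) x) * W (rho k) (cinv (bc l) x)))
       = integral (B k) (\<lambda>x. wt k x * (rho l (cinv (bc k) x) * W (rho k) (cinv (bc k) x)))" for k l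
  proof -
    have sub: "B j \<subseteq> snd (bc j) ` fst (bc j)" for j unfolding B_def by (rule full_box_facts(3)[OF box_at(2)])
    have z: "rho l y * W (rho k) y = 0" if "y \<notin> cinv (bc k) ` B k \<inter> cinv (bc l) ` B l" for y
      using that rho0(2)[of y l] half_facts(8)[of l] Wzero[of y k] by (auto simp: B_def whole_def)
    have cl: "continuous_on (B k) (\<lambda>x. rho l (cinv (bc k) x))"
      unfolding B_def by (rule C1_on_continuous[OF rhoC1[OF box_at(2)]])
    have int: "(\<lambda>x. sqrt (det (G (bc k) x)) * (rho l (cinv (bc k) x) * W (rho k) (cinv (bc k) x))) absolutely_integrable_on B k"
      using BEI(1)[OF cl] by (simp add: wt_def)
    have o: "open (B j)" "bounded (B j)" for j by (simp_all add: B_def)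
    show "(\<lambda>x. wt l x * (rho l (cinv (bc l) x) * W (rho k) (cinv (bc l) x))) absolutely_integrable_on B l"
     "integral (B l) (\<lambda>x. wt l x * (rho l (cinv (bc l) x) * W (rho k) (cinv (bc l) x)))
       = integral (B k) (\<lambda>x. wt k x * (rho l (cinv (bc k) x) * W (rho k) (cinv (bc k) x)))"
      unfolding wt_def
      using chart_integral_change[OF half_facts(2)[of k] half_facts(2)[of l] o[of k] sub[of k] o[of l] sub[of l],
          of "\<lambda>y. rho l y * W (rho k) y", OF z int] by auto
  qed
  have "(\<Sum>k\<in>Y. I k) = 0"
  proof -
    have Ik: "I k = - 2 * (\<Sum>l\<in>Y. integral (B l) (\<lambda>x. wt l x * (rho l (cinv (bc l) x) * W (rho k) (cinv (bc l) x))))" for k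
    proof -
      have "(\<Sum>l\<in>Y. integral (B k) (\<lambda>x. wt k x * (rho l (cinv (bc k) x) * W (rho k) (cinv (bc k) x))))
        = integral (B k) (\<lambda>x. \<Sum>l\<in>Y. wt k x * (rho l (cinv (bc k) x) * W (rho k) (cinv (bc k) x)))"
      proof (rule integral_sum[OF Y(1), symmetric])
        fix l
        have "continuous_on (B k) (\<lambda>x. rho l (cinv (bc k) x))"
          unfolding B_def by (rule C1_on_continuous[OF rhoC1[OF box_at(2)]])
        from BEI(1)[OF this] show "(\<lambda>x. wt k x * (rho l (cinv (bc k) x) * W (rho k) (cinv (bc k) x))) integrable_on B k"
          by (simp add: absolutely_integrable_on_def)
      qed
      also have "\<dots> = integral (B k) (\<lambda>x. wt k x * W (rho k) (cinv (bc k) x))"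
        by (simp add: sum_distrib_left[symmetric] sum_distrib_right[symmetric] rho1)
      finally have sumk: "(\<Sum>l\<in>Y. integral (B k) (\<lambda>x. wt k x * (rho l (cinv (bc k) x) * W (rho k) (cinv (bc k) x))))
        = integral (B k) (\<lambda>x. wt k x * W (rho k) (cinv (bc k) x))" .
      have "(\<Sum>l\<in>Y. integral (B l) (\<lambda>x. wt l x * (rho l (cinv (bc l) x) * W (rho k) (cinv (bc l) x))))
        = (\<Sum>l\<in>Y. integral (B k) (\<lambda>x. wt k x * (rho l (cinv (bc k) x) * W (rho k) (cinv (bc k) x))))"
        by (intro sum.cong refl ch(2))
      then show ?thesis unfolding I_def BEI(3) sumk by simp
    qed
    have "(\<Sum>k\<in>Y. \<Sum>l\<in>Y. integral (B l) (\<lambda>x. wt l x * (rho l (cinv (bc l) x) * W (rho k) (cinv (bc l) x))))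
      = (\<Sum>l\<in>Y. \<Sum>k\<in>Y. integral (B l) (\<lambda>x. wt l x * (rho l (cinv (bc l) x) * W (rho k) (cinv (bc l) x))))"
      by (rule sum.swap)
    also have "\<dots> = (\<Sum>l\<in>Y. integral (B l) (\<lambda>x. \<Sum>k\<in>Y. wt l x * (rho l (cinv (bc l) x) * W (rho k) (cinv (bc l) x))))"
      by (intro sum.cong refl integral_sum[OF Y(1), symmetric]) (use ch(1) in \<open>simp add: absolutely_integrable_on_def\<close>)
    also have "\<dots> = 0" by (simp add: sum_distrib_left[symmetric] Wsum)
    finally show ?thesis unfolding Ik sum_distrib_left[symmetric] by simp
  qed
  have denergy_nonneg: "denergy y t \<ge> 0" for y t
  proof -
    have "xk y \<in> snd (bc y) ` fst (bc y)" using box_at(1)[of y] by blast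
    then have "posdef (matrix_inv (G (bc y) (xk y)))"
      using metric_on_chart[OF half_facts(2)] posdef_inverse unfolding metric_on_def by blast
    then show ?thesis
      unfolding denergy_def gip_def posdef_def
      by (cases "grad (\<lambda>x. pl (bc y) (bs y) t (cinv (bc y) x)) (xk y) = 0") (auto intro: less_imp_le)
  qed
  have denergy_cont: "continuous_on {bot_val..top_val} (\<lambda>u. denergy y (tsel y u))" for y
    using box_limits(6)[OF box_at(2) centre(1) rhoC1[OF box_at(2)], of y] by (simp add: centre(2))
  have Q0: "Q y \<ge> 0" for y
    unfolding Q_def by (rule integral_nonneg[OF integrable_continuous_interval[OF denergy_cont]]) (rule denergy_nonneg)
  have Q_zero: "denergy y (tsel y u) = 0" if "Q y = 0" "u \<in> {bot_val..top_val}" for y u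
    using integral_eq_0_iff[OF denergy_cont bot_lt_top denergy_nonneg, of y] that unfolding Q_def by blast
  have wpos: "wt k x > 0" if "x \<in> B k" for k x
    using box_weight_pos[OF box_at(2)] that by (simp add: B_def wt_def)
  have nn: "wt k x * (rho k (cinv (bc k) x) * Q (cinv (bc k) x)) \<ge> 0" if "x \<in> B k" for k x
    using wpos[OF that] rho0(1) Q0 by simp
  have I0: "I k = 0" if "k \<in> Y" for k
  proof -
    have "I j \<ge> 0" for j unfolding I_def
      by (rule integral_nonneg) (use BEI(2)[of j] nn in \<open>auto simp: absolutely_integrable_on_def\<close>)
    then show ?thesis using \<open>(\<Sum>k\<in>Y. I k) = 0\<close> sum_nonneg_eq_0_iff[OF Y(1), of I] that by simp
  qed
  have grad0: "grad (\<lambda>x. h (cinv (bc k) x, bs k x s)) x = 0"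
    if k: "k \<in> Y" and s: "s \<in> {0..1}" and x: "x \<in> ball (xk k) (br k / 2)" for k s x
  proof (rule ccontr)
    assume nz: "grad (\<lambda>x. h (cinv (bc k) x, bs k x s)) x \<noteq> 0"
    define u where "u = (\<lambda>x. h (cinv (bc k) x, bs k x s))"
    note b = box_at(2)[of k]
    have HB: "ball (xk k) (br k / 2) \<subseteq> B k" using half_facts(3)[of k] ball_subset_cball unfolding B_def by blast
    have "continuous_on (ball (xk k) (br k / 2)) (grad u)"
      using C1_on_grad_continuous[OF C2_on_C1(1)[OF box_C2(1)[OF b s]]] HB unfolding u_def B_def by (rule continuous_on_subset)
    then have o: "open (ball (xk k) (br k / 2) \<inter> grad u -` (- {0}))"
      by (rule continuous_open_preimage[OF _ open_ball]) auto
    have "x \<in> ball (xk k) (br k / 2) \<inter> grad u -` (- {0})" using x nz by (simp add: u_def)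
    then have "\<exists>z\<in>ball (xk k) (br k / 2) \<inter> grad u -` (- {0}). wt k z * (rho k (cinv (bc k) z) * Q (cinv (bc k) z)) = 0"
      using HB by (intro nonneg_integral_zero_dense[OF BEI(2)[of k] nn I0[OF k, unfolded I_def] o]) auto
    then obtain z where z: "z \<in> ball (xk k) (br k / 2)" "grad u z \<noteq> 0"
      "wt k z * (rho k (cinv (bc k) z) * Q (cinv (bc k) z)) = 0" by blast
    have zB: "z \<in> B k" using z(1) HB by blast
    then have zB': "z \<in> ball (xk k) (br k)" by (simp add: B_def)
    have "cinv (bc k) z \<in> half k" unfolding half_def using z(1) by blast
    then have "rho k (cinv (bc k) z) > 0" using rho0(3) by blast
    then have "Q (cinv (bc k) z) = 0" using z(3) wpos[OF zB] by simp
    moreover have "h (cinv (bc k) z, bs k z s) \<in> {bot_val..top_val}"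
      using box_line(2)[OF b zB', of 0 s] box_line(2)[OF b zB', of s 1] box_line(3,4)[OF b zB'] s by auto
    ultimately have "denergy (cinv (bc k) z) (tsel (cinv (bc k) z) (h (cinv (bc k) z, bs k z s))) = 0" by (rule Q_zero)
    then have "gip (bc k) (pl (bc k) (bs k) s) (pl (bc k) (bs k) s) (cinv (bc k) z) = 0"
      using dpair_sel(2)[OF b zB' s] by simp
    then have "grad u z \<bullet> (matrix_inv (G (bc k) z) *v grad u z) = 0"
      unfolding gip_def u_def using full_box_facts(8)[OF b zB'] pl_GDERIV(2)[OF b zB' s] by simp
    moreover have "posdef (matrix_inv (G (bc k) z))"
      using metric_on_box[OF b] zB' posdef_inverse unfolding metric_on_def by blast
    ultimately show False using z(2) unfolding posdef_def by (metis less_irrefl)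
  qed
  show False
  proof (rule leafwise_constant_imp_equal_ends[OF _ ends_lt])
    fix y
    obtain k where k: "k \<in> Y" "y \<in> half k" using Y(2) by blast
    note b = box_at(2)[of k]
    have const: "h (y', bs k (snd (bc k) y') s) = h (y, bs k (snd (bc k) y) s)" if s: "s \<in> {0..1}" and y': "y' \<in> half k" for s y'
    proof -
      let ?H = "ball (xk k) (br k / 2)"
      have HB: "?H \<subseteq> ball (xk k) (br k)" using half_facts(3)[of k] ball_subset_cball by blast
      define u where "u = (\<lambda>x. h (cinv (bc k) x, bs k x s))"
      have "(u has_derivative (\<lambda>h. 0)) (at x within ?H)" if "x \<in> ?H" for x
      proof -
        have "GDERIV u x :> grad u x"
          using C1_on_GDERIV[OF C2_on_C1(1)[OF box_C2(1)[OF b s]] open_ball, of x] that HB unfolding u_def by blast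
        then show ?thesis
          using grad0[OF k(1) s that] unfolding u_def gderiv_def by (auto intro: has_derivative_at_withinI)
      qed
      from has_derivative_zero_constant[OF convex_ball this] obtain m where m: "\<forall>x\<in>?H. u x = m" by blast
      have "u (snd (bc k) z) = h (z, bs k (snd (bc k) z) s)" if "z \<in> half k" for z
        using chart_facts(5)[OF half_facts(2)] half_facts(10)[of z k] that by (simp add: u_def)
      then show ?thesis using m half_facts(10)[of _ k] k(2) y' by metis
    qed
    have "half k \<subseteq> cinv (bc k) ` ball (xk k) (br k)" using half_facts(7,8)[of k] by (simp add: whole_def)
    then have "full_box (bc k) (xk k) (br k) (bs k) \<and> open (half k) \<and> y \<in> half k \<and> half k \<subseteq> cinv (bc k) ` ball (xk k) (br k) \<and>
      (\<forall>s\<in>{0..1}. \<forall>y'\<in>half k. h (y', bs k (snd (bc k) y') s) = h (y, bs k (snd (bc k) y) s))"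
      using b half_facts(4) k(2) const by blast
    then show "\<exists>c x0 r \<sigma> U. full_box c x0 r \<sigma> \<and> open U \<and> y \<in> U \<and> U \<subseteq> cinv c ` ball x0 r \<and>
      (\<forall>s\<in>{0..1}. \<forall>y'\<in>U. h (y', \<sigma> (snd c y') s) = h (y, \<sigma> (snd c y) s))"
      by (intro exI[of _ "bc k"] exI[of _ "xk k"] exI[of _ "br k"] exI[of _ "bs k"] exI[of _ "half k"])
  qed
qed

end

theorem theorem2:
  fixes \<A> :: "('k::t2_space, 'n::finite) chart set"
    and G :: "('k, 'n) chart \<Rightarrow> real^'n \<Rightarrow> real^'n^'n"
    and \<L> :: "('k \<times> real) set set"
    and h :: "'k \<times> real \<Rightarrow> real"
  assumes "foliated_I_bundle \<A> G \<L>"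
    and "connected (UNIV :: 'k set)"
    and "\<not> (\<exists>L\<in>\<L>. compactin (leaf_topology \<A> \<L>) L \<and> L \<subseteq> interior_space)"
    and "leafwise_harmonic \<A> G \<L> h"
  shows "h constant_on total_space"
proof -
  have fb: "closed_C2_manifold \<A>" "C2_riemannian_metric \<A> G" "transverse_foliation \<A> \<L>"
    using assms(1) by (auto simp: foliated_I_bundle_def)
  interpret H: harmonic_bundle \<A> \<L> G h
    by unfold_locales (use fb assms(2-4) in auto)
  interpret N: harmonic_bundle \<A> \<L> G "\<lambda>z. - h z"
    by unfold_locales (use fb assms(2,3) H.leafwise_harmonic_minus in auto)
  let ?b = "h (undefined, 0)" and ?t = "h (undefined, 1)"
  have "\<not> ?b < ?t"
  proof
    assume lt: "?b < ?t"
    interpret monotone_bundle \<A> \<L> G h by unfold_locales (rule lt)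
    show False by (rule energy_contradiction)
  qed
  moreover have "\<not> ?t < ?b"
  proof
    assume lt: "?t < ?b"
    interpret monotone_bundle \<A> \<L> G "\<lambda>z. - h z" by unfold_locales (use lt in simp)
    show False by (rule energy_contradiction)
  qed
  ultimately have eq: "?b = ?t" by simp
  have "h z = ?b" if "z \<in> total_space" for z
    using H.h_le_boundary[OF that, of undefined] N.h_le_boundary[OF that, of undefined] eq by simp
  then show ?thesis unfolding constant_on_def by blast
qed

end
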